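(* Let $d \ge 3$, let $P$ be a simplicial $d$-polytope, and let $\delta$ be the minimum degree of the graph of $P$. Then the graph of $P$ is $\min\{\delta, d(d+1)/2\}$-edge-connected.
   Context: A polytope is the convex hull of finitely many points; its dimension is the dimension of its affine hull, and a $d$-polytope is a polytope of dimension $d$. Its faces are its intersections with its supporting hyperplanes, together with the polytope itself. A polytope is simplicial when all its proper faces are simplices. The graph of a polytope has as vertices its $0$-dimensional faces and as edges its $1$-dimensional faces. The edge connectivity of a connected graph is the minimum number of edges whose removal disconnects it; a graph is $k$-edge-connected if its edge connectivity is at least $k$. *)

theory Defs
  imports "HOL-Analysis.Analysis"
begin

text \<open>
  Simple undirected graphs are given by a vertex set \<open>V\<close> and a set \<open>E\<close> of edges, each edge being
  the two-element set of its endpoints.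
\<close>

definition graph_connected :: "'v set \<Rightarrow> 'v set set \<Rightarrow> bool" where
  "graph_connected V E \<longleftrightarrow>
     V \<noteq> {} \<and> (\<forall>u\<in>V. \<forall>v\<in>V. (u, v) \<in> {(x, y). x \<in> V \<and> y \<in> V \<and> {x, y} \<in> E}\<^sup>*)"

definition graph_degree :: "'v set set \<Rightarrow> 'v \<Rightarrow> nat" where
  "graph_degree E v = card {e \<in> E. v \<in> e}"

definition min_degree :: "'v set \<Rightarrow> 'v set set \<Rightarrow> nat" where
  "min_degree V E = Min (graph_degree E ` V)"

text \<open>
  The one-vertex graph cannot be disconnected; the infimum over the empty set makes its edge
  connectivity \<open>\<infinity>\<close>.
\<close>

definition edge_connectivity :: "'v set \<Rightarrow> 'v set set \<Rightarrow> enat" where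
  "edge_connectivity V E =
     Inf {enat (card C) | C. C \<subseteq> E \<and> finite C \<and> \<not> graph_connected V (E - C)}"

definition k_edge_connected :: "nat \<Rightarrow> 'v set \<Rightarrow> 'v set set \<Rightarrow> bool" where
  "k_edge_connected k V E \<longleftrightarrow> graph_connected V E \<and> enat k \<le> edge_connectivity V E"

text \<open>
  The faces of a polytope \<open>P\<close> are the sets \<open>F\<close> with \<open>F exposed_face_of P\<close>: the normal vector in that
  definition may be \<open>0\<close>, so \<open>P\<close> itself (and also the empty set, which is the \<open>-1\<close>-simplex) is included.
\<close>

definition simplicial_polytope :: "'a::euclidean_space set \<Rightarrow> bool" where
  "simplicial_polytope P \<longleftrightarrow>
     polytope P \<and> (\<forall>F. F exposed_face_of P \<and> F \<noteq> P \<longrightarrow> (\<exists>n. n simplex F))"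

definition polytope_vertices :: "'a::euclidean_space set \<Rightarrow> 'a set" where
  "polytope_vertices P = {v. {v} exposed_face_of P}"

text \<open>A one-dimensional face is represented by the set of the vertices of \<open>P\<close> lying on it.\<close>

definition polytope_edges :: "'a::euclidean_space set \<Rightarrow> 'a set set" where
  "polytope_edges P = {polytope_vertices P \<inter> F | F. F exposed_face_of P \<and> aff_dim F = 1}"

lemma polytope_vertices_eq:
  assumes "polytope P"
  shows "polytope_vertices P = {v. v extreme_point_of P}"
  unfolding polytope_vertices_def
  by (simp add: exposed_face_of_polyhedron[OF polytope_imp_polyhedron[OF assms]] face_of_singleton)

lemma finite_polytope_vertices: "polytope P \<Longrightarrow> finite (polytope_vertices P)"
  by (simp add: polytope_vertices_eq finite_polyhedron_extreme_points polytope_imp_polyhedron)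

lemma polytope_edges_eq:
  assumes "polytope P"
  shows "polytope_edges P =
    {{u, v} | u v. u \<noteq> v \<and> closed_segment u v face_of P}"
proof -
  have face: "F exposed_face_of P \<longleftrightarrow> F face_of P" for F
    by (rule exposed_face_of_polyhedron[OF polytope_imp_polyhedron[OF assms]])
  have V: "polytope_vertices P \<inter> F = {v. v extreme_point_of F}" if "F face_of P" for F
    using extreme_point_of_face[OF that] by (auto simp: polytope_vertices_eq[OF assms])
  have seg: "polytope_vertices P \<inter> closed_segment u v = {u, v}"
    if "closed_segment u v face_of P" for u v
    using V[OF that] by (auto simp: extreme_point_of_segment)
  have dim: "aff_dim (closed_segment u v) = (if u = v then 0 else 1)" for u v :: 'a
    by (simp add: segment_convex_hull aff_dim_convex_hull aff_dim_2)
  have "\<exists>u v. u \<noteq> v \<and> F = closed_segment u v"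
    if F: "F face_of P" and 1: "aff_dim F = 1" for F
  proof -
    have "polytope F"
      using F assms face_of_polytope_polytope by blast
    then obtain u v where "F = closed_segment u v"
      using 1 compact_convex_collinear_segment[of F]
      by (metis aff_dim_empty collinear_aff_dim order_refl polytope_imp_compact
          polytope_imp_convex one_neq_neg_one)
    then show ?thesis
      using 1 dim[of u v] by (metis zero_neq_one)
  qed
  then show ?thesis
    unfolding polytope_edges_def face
    by (auto simp: set_eq_iff[where 'a = "'a set"]) (metis seg, metis seg dim)
qed

end

theory Submission
  imports Defs "HOL-Library.Z2"
begin

text \<open>
  An edge cut \<open>C\<close> separates the vertices into two sides \<open>X\<close> and \<open>Y\<close>. If one side has at most \<open>\<delta>\<close>
  vertices, each of its vertices sends enough edges across for the cut to have at least \<open>\<delta>\<close> edges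
  (\<open>small_side_cut\<close>). Otherwise both sides have at least \<open>d\<close> vertices, and \<open>d (d + 1) / 2\<close>
  enters as the dimension of the space of infinitesimal isometries of \<open>d\<close>-space. The graph of a
  simplicial \<open>d\<close>-polytope with \<open>d \<ge> 3\<close> is infinitesimally rigid for a generic placement of its
  vertices. If the cut had fewer than \<open>d (d + 1) / 2\<close> edges, some nonzero infinitesimal isometry \<open>A\<close>
  would preserve the lengths of all cut edges to first order. Then moving \<open>X\<close> by \<open>A\<close> and keeping \<open>Y\<close> at
  rest is a motion of the whole framework, so it is induced by one infinitesimal isometry \<open>B\<close>. As \<open>B\<close>
  fixes the \<open>d\<close> generic points of \<open>Y\<close>, it is \<open>0\<close>; so \<open>A\<close> fixes the \<open>d\<close> generic points of \<open>X\<close> and is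
  \<open>0\<close> as well, a contradiction (\<open>large_cut\<close>).

  Generic rigidity is proved by Fogelsanger's method for every minimal cycle modulo 2 of
  \<open>(d-1)\<close>-simplices (\<open>minimal_cycle_generically_rigid\<close>). Contract an edge \<open>uv\<close> of the cycle. The result
  is a sum of minimal cycles with fewer vertices, which are rigid by induction. Each of them lifts to a
  cycle containing \<open>uv\<close> whose graph lies in the original graph, and the original cycle is the sum of
  these lifts and of boundaries of \<open>d\<close>-simplices (\<open>edge_decomposition\<close>). The lifts are rigid by vertex
  splitting (\<open>vertex_splitting\<close>), which needs \<open>d - 1\<close> common neighbours of \<open>u\<close> and \<open>v\<close>; the link of an
  edge provides them as soon as \<open>d \<ge> 3\<close>. Finally, a motion induces one infinitesimal isometry on every
  summand, and summands that share a facet receive the same one; the summands with a given isometry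
  add up to a subcycle, so minimality forces one isometry everywhere (\<open>rigid_of_decomposition\<close>).

  The facets of a simplicial polytope form such a cycle because a ridge lies in exactly two facets, and
  the cycle is minimal because facets are connected through ridges: the radial projection of a generic
  segment to the boundary crosses no face of codimension greater than two
  (\<open>facets_strongly_connected\<close>).
\<close>

section \<open>Homogeneous linear systems\<close>

text \<open>
  Gaussian elimination: one equation expresses one unknown by the others, and both disappear.
\<close>

lemma underdetermined_system_nontrivial:
  fixes a :: "'j \<Rightarrow> 'i \<Rightarrow> real"
  assumes "finite J" "finite I" "card J < card I"
  shows "\<exists>x. (\<exists>i\<in>I. x i \<noteq> 0) \<and> (\<forall>j\<in>J. (\<Sum>i\<in>I. a j i * x i) = 0)"
  using assms
proof (induction J arbitrary: I a rule: finite_induct)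
  case empty
  then have "I \<noteq> {}" by auto
  then show ?case by (auto intro!: exI[of _ "\<lambda>_. 1"])
next
  case (insert j J)
  show ?case
  proof (cases "\<forall>i\<in>I. a j i = 0")
    case True
    obtain x where "\<exists>i\<in>I. x i \<noteq> 0" "\<forall>j\<in>J. (\<Sum>i\<in>I. a j i * x i) = 0"
      using insert.IH[of I a] insert.prems insert.hyps by auto
    with True show ?thesis by (intro exI[of _ x]) auto
  next
    case False
    then obtain i0 where i0: "i0 \<in> I" "a j i0 \<noteq> 0" by auto
    define I' where "I' = I - {i0}"
    have I': "I = insert i0 I'" "i0 \<notin> I'" "finite I'"
      using i0 insert.prems by (auto simp: I'_def)
    have "card J < card I'"
      using insert.prems insert.hyps i0 by (simp add: I'_def)
    then obtain x where x: "\<exists>i\<in>I'. x i \<noteq> 0"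
      "\<And>k. k \<in> J \<Longrightarrow> (\<Sum>i\<in>I'. (a k i - a k i0 * a j i / a j i0) * x i) = 0"
      using insert.IH[of I' "\<lambda>k i. a k i - a k i0 * a j i / a j i0"] I' by auto
    define s where "s = (\<Sum>i\<in>I'. a j i * x i)"
    \<comment> \<open>the value of the eliminated unknown that satisfies equation \<open>j\<close>\<close>
  define y where "y = x(i0 := - s / a j i0)"
    have sum_y: "(\<Sum>i\<in>I. a k i * y i) = (\<Sum>i\<in>I'. a k i * x i) - a k i0 * s / a j i0" for k
    proof -
      have "(\<Sum>i\<in>I'. a k i * y i) = (\<Sum>i\<in>I'. a k i * x i)"
        using I' by (intro sum.cong) (auto simp: y_def)
      then show ?thesis using I' by (simp add: y_def)
    qed
    have "(\<Sum>i\<in>I. a k i * y i) = 0" if "k \<in> J" for k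
    proof -
      have "(\<Sum>i\<in>I'. a k i * x i) - a k i0 * s / a j i0
          = (\<Sum>i\<in>I'. (a k i - a k i0 * a j i / a j i0) * x i)"
        by (simp add: s_def sum_subtractf sum_distrib_left sum_divide_distrib algebra_simps)
      then show ?thesis using x(2)[OF that] sum_y by simp
    qed
    moreover have "(\<Sum>i\<in>I. a j i * y i) = 0"
      using sum_y[of j] i0 by (simp add: s_def)
    moreover have "\<exists>i\<in>I. y i \<noteq> 0"
      using x(1) I' by (auto simp: y_def)
    ultimately show ?thesis by blast
  qed
qed

definition poly_function :: "(real \<Rightarrow> real) \<Rightarrow> bool" where
  "poly_function f \<longleftrightarrow> (\<exists>p. f = poly p)"

lemma poly_function_const [intro!]: "poly_function (\<lambda>t. c)"
  unfolding poly_function_def by (rule exI[of _ "[:c:]"]) auto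

lemma poly_function_id [intro!]: "poly_function (\<lambda>t. t)"
  unfolding poly_function_def by (rule exI[of _ "[:0, 1:]"]) auto

lemma poly_function_add [intro!]:
  assumes "poly_function f" "poly_function g" shows "poly_function (\<lambda>t. f t + g t)"
proof -
  obtain p q where "f = poly p" "g = poly q" using assms by (auto simp: poly_function_def)
  then show ?thesis unfolding poly_function_def by (intro exI[of _ "p + q"]) auto
qed

lemma poly_function_diff [intro!]:
  assumes "poly_function f" "poly_function g" shows "poly_function (\<lambda>t. f t - g t)"
proof -
  obtain p q where "f = poly p" "g = poly q" using assms by (auto simp: poly_function_def)
  then show ?thesis unfolding poly_function_def by (intro exI[of _ "p - q"]) auto
qed

lemma poly_function_mult [intro!]:
  assumes "poly_function f" "poly_function g" shows "poly_function (\<lambda>t. f t * g t)"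
proof -
  obtain p q where "f = poly p" "g = poly q" using assms by (auto simp: poly_function_def)
  then show ?thesis unfolding poly_function_def by (intro exI[of _ "p * q"]) auto
qed

lemma finite_zeros_poly_function:
  assumes "poly_function f" "f t0 \<noteq> 0"
  shows "finite {t. f t = 0}"
proof -
  obtain p where p: "f = poly p" using assms(1) by (auto simp: poly_function_def)
  with assms(2) have "p \<noteq> 0" by auto
  then show ?thesis using poly_roots_finite p by simp
qed

text \<open>
  The coefficients of the system are polynomials in a parameter \<open>t\<close>. Eliminating an unknown with a pivot
  that is nonzero at \<open>t0\<close>, without dividing by it, leaves a system of the same kind that is still
  injective at \<open>t0\<close>. Only the finitely many zeros of the pivots are lost on the way.
\<close>

lemma generically_injective_rows:
  assumes "finite I" "\<And>r i. r \<in> R \<Longrightarrow> poly_function (r i)"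
    and "\<And>x. (\<forall>r\<in>R. (\<Sum>i\<in>I. r i t0 * x i) = 0) \<Longrightarrow> \<forall>i\<in>I. x i = 0"
  shows "finite {t. \<exists>x. (\<forall>r\<in>R. (\<Sum>i\<in>I. r i t * x i) = 0) \<and> (\<exists>i\<in>I. x i \<noteq> (0::real))}"
  using assms
proof (induction I arbitrary: R rule: finite_induct)
  case empty
  then show ?case by simp
next
  case (insert i0 I)
  obtain p where p: "p \<in> R" "p i0 t0 \<noteq> 0"
  proof (rule ccontr)
    assume "\<not> thesis"
    with that have "\<And>r. r \<in> R \<Longrightarrow> r i0 t0 = 0" by auto
    then have "\<forall>r\<in>R. (\<Sum>i\<in>insert i0 I. r i t0 * (if i = i0 then 1 else 0)) = 0"
      using insert.hyps by (simp add: sum.neutral)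
    from insert.prems(2)[OF this] show False by auto
  qed
  define e where "e r i t = r i t * p i0 t - r i0 t * p i t" for r :: "'a \<Rightarrow> real \<Rightarrow> real" and i t
  define R' where "R' = e ` R"
  define y where "y t x = (\<lambda>i. if i = i0 then - (\<Sum>i\<in>I. p i t * x i) else p i0 t * x i)"
    for t and x :: "'a \<Rightarrow> real"
  have sum_e: "(\<Sum>i\<in>I. e r i t * x i) =
      p i0 t * (\<Sum>i\<in>I. r i t * x i) - r i0 t * (\<Sum>i\<in>I. p i t * x i)" for r t and x :: "'a \<Rightarrow> real"
    by (simp add: e_def algebra_simps sum_subtractf sum_distrib_left)
  have sum_y: "(\<Sum>i\<in>insert i0 I. r i t * y t x i) = (\<Sum>i\<in>I. e r i t * x i)" for r t x
  proof -
    have "(\<Sum>i\<in>I. r i t * y t x i) = p i0 t * (\<Sum>i\<in>I. r i t * x i)"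
      unfolding sum_distrib_left using insert.hyps by (intro sum.cong) (auto simp: y_def)
    then show ?thesis using insert.hyps by (simp add: sum_e) (simp add: y_def)
  qed
  have "\<forall>i\<in>I. x i = 0" if x: "\<forall>r\<in>R'. (\<Sum>i\<in>I. r i t0 * x i) = 0" for x
  proof -
    have "\<forall>r\<in>R. (\<Sum>i\<in>insert i0 I. r i t0 * y t0 x i) = 0"
      using x by (simp only: sum_y) (simp add: R'_def)
    from insert.prems(2)[OF this] have "\<forall>i\<in>I. y t0 x i = 0" by blast
    then have "p i0 t0 * x i = 0" if "i \<in> I" for i
      using that insert.hyps by (auto simp: y_def split: if_splits)
    then show ?thesis using p by simp
  qed
  moreover have "poly_function (r i)" if r: "r \<in> R'" for r i
  proof -
    obtain r' where "r' \<in> R" "r i = (\<lambda>t. r' i t * p i0 t - r' i0 t * p i t)"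
      using r by (auto simp: R'_def e_def fun_eq_iff)
    then show ?thesis using insert.prems(1) p by auto
  qed
  ultimately have fin: "finite {t. \<exists>x. (\<forall>r\<in>R'. (\<Sum>i\<in>I. r i t * x i) = 0) \<and> (\<exists>i\<in>I. x i \<noteq> 0)}"
    using insert.IH[of R'] by auto
  have "finite {t. p i0 t = 0}"
    using finite_zeros_poly_function insert.prems(1) p by blast
  moreover have "{t. \<exists>x. (\<forall>r\<in>R. (\<Sum>i\<in>insert i0 I. r i t * x i) = 0) \<and> (\<exists>i\<in>insert i0 I. x i \<noteq> 0)}
     \<subseteq> {t. p i0 t = 0} \<union> {t. \<exists>x. (\<forall>r\<in>R'. (\<Sum>i\<in>I. r i t * x i) = 0) \<and> (\<exists>i\<in>I. x i \<noteq> 0)}"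
    (is "_ \<subseteq> ?A \<union> ?B")
  proof
    fix t
    assume "t \<in> {t. \<exists>x. (\<forall>r\<in>R. (\<Sum>i\<in>insert i0 I. r i t * x i) = 0) \<and> (\<exists>i\<in>insert i0 I. x i \<noteq> 0)}"
    then obtain x where x: "\<And>r. r \<in> R \<Longrightarrow> (\<Sum>i\<in>insert i0 I. r i t * x i) = 0"
      "\<exists>i\<in>insert i0 I. x i \<noteq> 0" by blast
    have x0: "r i0 t * x i0 = - (\<Sum>i\<in>I. r i t * x i)" if "r \<in> R" for r
      using x(1)[OF that] insert.hyps by simp
    show "t \<in> ?A \<union> ?B"
    proof (cases "p i0 t = 0")
      case False
      have "(\<Sum>i\<in>I. e r i t * x i) = 0" if "r \<in> R" for r
      proof -
        have "(\<Sum>i\<in>I. e r i t * x i) = p i0 t * (- (r i0 t * x i0)) - r i0 t * (- (p i0 t * x i0))"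
          using x0[OF that] x0[OF p(1)] by (simp add: sum_e)
        then show ?thesis by (simp add: algebra_simps)
      qed
      moreover have "\<exists>i\<in>I. x i \<noteq> 0"
      proof (rule ccontr)
        assume "\<not> ?thesis"
        then have "x i0 = 0" using x0[OF p(1)] False by simp
        with \<open>\<not> ?thesis\<close> x(2) show False by auto
      qed
      ultimately show ?thesis by (auto simp: R'_def)
    qed simp
  qed
  ultimately show ?case using fin by (meson finite_UnI finite_subset)
qed

text \<open>
  This form of the systems allows the individual equations to be recognised from their shape, without
  naming a coefficient matrix.
\<close>

definition poly_linear :: "'i set \<Rightarrow> (real \<Rightarrow> ('i \<Rightarrow> real) \<Rightarrow> real) \<Rightarrow> bool" where
  "poly_linear I l \<longleftrightarrow> (\<exists>r. (\<forall>i. poly_function (r i)) \<and> (\<forall>t x. l t x = (\<Sum>i\<in>I. r i t * x i)))"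

lemma poly_linear_component:
  assumes "finite I" "i \<in> I" "poly_function f"
  shows "poly_linear I (\<lambda>t x. f t * x i)"
  unfolding poly_linear_def
proof (intro exI[of _ "\<lambda>j. if j = i then f else (\<lambda>t. 0)"] conjI allI)
  show "f t * x i = (\<Sum>j\<in>I. (if j = i then f else (\<lambda>t. 0)) t * x j)" for t x
    using assms(1,2) by (subst sum.remove[OF assms(1,2)]) (auto intro!: sum.neutral)
qed (use assms(3) in auto)

lemma poly_linear_add:
  assumes "poly_linear I l" "poly_linear I l'"
  shows "poly_linear I (\<lambda>t x. l t x + l' t x)"
proof -
  obtain r r' where "\<forall>i. poly_function (r i)" "\<forall>t x. l t x = (\<Sum>i\<in>I. r i t * x i)"
    "\<forall>i. poly_function (r' i)" "\<forall>t x. l' t x = (\<Sum>i\<in>I. r' i t * x i)"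
    using assms unfolding poly_linear_def by blast
  then show ?thesis unfolding poly_linear_def
    by (intro exI[of _ "\<lambda>i t. r i t + r' i t"]) (auto simp: algebra_simps sum.distrib)
qed

lemma poly_linear_sum:
  assumes "finite S" "\<And>s. s \<in> S \<Longrightarrow> poly_linear I (l s)"
  shows "poly_linear I (\<lambda>t x. \<Sum>s\<in>S. l s t x)"
  using assms
proof (induction S rule: finite_induct)
  case empty
  show ?case unfolding poly_linear_def by (intro exI[of _ "\<lambda>_ _. 0"]) auto
next
  case (insert s S)
  then show ?case by (simp add: poly_linear_add)
qed

lemma generically_injective:
  assumes "finite I" "\<And>l. l \<in> L \<Longrightarrow> poly_linear I l"
    and inj: "\<And>x. (\<And>l. l \<in> L \<Longrightarrow> l t0 x = 0) \<Longrightarrow> \<forall>i\<in>I. x i = 0"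
  shows "finite {t. \<exists>x. (\<forall>l\<in>L. l t x = 0) \<and> (\<exists>i\<in>I. x i \<noteq> 0)}"
proof -
  have "\<forall>l\<in>L. \<exists>r. (\<forall>i. poly_function (r i)) \<and> (\<forall>t x. l t x = (\<Sum>i\<in>I. r i t * x i))"
    using assms(2) by (auto simp: poly_linear_def)
  then obtain r where r: "\<And>l i. l \<in> L \<Longrightarrow> poly_function (r l i)"
    "\<And>l t x. l \<in> L \<Longrightarrow> l t x = (\<Sum>i\<in>I. r l i t * x i)"
    by metis
  have "\<forall>i\<in>I. x i = 0" if "\<forall>q\<in>r ` L. (\<Sum>i\<in>I. q i t0 * x i) = 0" for x
    by (rule inj) (use that r(2) in auto)
  from generically_injective_rows[of I "r ` L" t0, OF assms(1) _ this]
  have "finite {t. \<exists>x. (\<forall>q\<in>r ` L. (\<Sum>i\<in>I. q i t * x i) = 0) \<and> (\<exists>i\<in>I. x i \<noteq> 0)}"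
    using r(1) by auto
  moreover have "(\<forall>q\<in>r ` L. (\<Sum>i\<in>I. q i t * x i) = 0) \<longleftrightarrow> (\<forall>l\<in>L. l t x = 0)" for t x
    using r(2) by auto
  ultimately show ?thesis by simp
qed

section \<open>Simplicial chains modulo 2\<close>

text \<open>
  The rules that unfold addition and multiplication of bits to Boolean operations would destroy the
  linear algebra below.
\<close>

declare add_bit_eq_xor [simp del] mult_bit_eq_and [simp del]

lemma bit_add_self [simp]: "(x::bit) + x = 0"
  by (cases x) auto

lemma bit_add_eq_0_iff: "(x::bit) + y = 0 \<longleftrightarrow> x = y"
  by (cases x; cases y) auto

lemma bit_eq_iff_nonzero: "(x::bit) = y \<longleftrightarrow> (x \<noteq> 0 \<longleftrightarrow> y \<noteq> 0)"
  by (cases x; cases y) auto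

text \<open>
  Every unordered pair is counted twice; this is the reason why the boundary of a boundary vanishes.
\<close>

lemma sum_symmetric_pairs_bit:
  fixes f :: "'a \<Rightarrow> 'a \<Rightarrow> bit"
  assumes "finite S" "\<And>x y. f x y = f y x"
  shows "(\<Sum>x\<in>S. \<Sum>y\<in>S - {x}. f x y) = 0"
  using assms(1)
proof (induction S rule: finite_induct)
  case empty
  show ?case by simp
next
  case (insert a S)
  have "(\<Sum>y\<in>insert a S - {x}. f x y) = f x a + (\<Sum>y\<in>S - {x}. f x y)" if "x \<in> S" for x
  proof -
    have "insert a S - {x} = insert a (S - {x})" using that insert.hyps by auto
    then show ?thesis using insert.hyps by simp
  qed
  moreover have "insert a S - {a} = S" using insert.hyps by auto
  ultimately have "(\<Sum>x\<in>insert a S. \<Sum>y\<in>insert a S - {x}. f x y)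
     = (\<Sum>y\<in>S. f a y) + ((\<Sum>x\<in>S. f x a) + (\<Sum>x\<in>S. \<Sum>y\<in>S - {x}. f x y))"
    using insert.hyps by (simp add: sum.distrib)
  also have "(\<Sum>x\<in>S. f x a) = (\<Sum>y\<in>S. f a y)"
    using assms(2) by simp
  also have "\<dots> + (\<Sum>x\<in>S. \<Sum>y\<in>S - {x}. f x y) = \<dots>"
    using insert.IH by simp
  finally show ?case by simp
qed

type_synonym 'v chain = "'v set \<Rightarrow> bit"

locale finite_ground =
  fixes U :: "'v set"
  assumes finite_U: "finite U"
begin

text \<open>
  A chain assigns a coefficient modulo 2 to every finite set of vertices; the vertex sets \<open>\<sigma>\<close> with
  \<open>c \<sigma> \<noteq> 0\<close> are its facets. The boundary counts, for every set, the facets obtained by adding one vertex.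
\<close>

definition boundary :: "'v chain \<Rightarrow> 'v chain" where
  "boundary c \<rho> = (\<Sum>w\<in>U - \<rho>. c (insert w \<rho>))"

definition cycle :: "nat \<Rightarrow> 'v chain \<Rightarrow> bool" where
  "cycle k c \<longleftrightarrow> (\<forall>\<sigma>. c \<sigma> \<noteq> 0 \<longrightarrow> \<sigma> \<subseteq> U \<and> card \<sigma> = k) \<and> (\<forall>\<rho>\<subseteq>U. boundary c \<rho> = 0)"

definition subchain :: "'v chain \<Rightarrow> 'v chain \<Rightarrow> bool" where
  "subchain c' c \<longleftrightarrow> (\<forall>\<sigma>. c' \<sigma> \<noteq> 0 \<longrightarrow> c \<sigma> \<noteq> 0)"

text \<open>
  Minimal cycles generalise connected closed pseudomanifolds. Unlike these they survive the contraction
  of an edge, up to a decomposition into smaller ones.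
\<close>

definition minimal_cycle :: "nat \<Rightarrow> 'v chain \<Rightarrow> bool" where
  "minimal_cycle k c \<longleftrightarrow> cycle k c \<and> (\<exists>\<sigma>. c \<sigma> \<noteq> 0) \<and>
     (\<forall>c'. cycle k c' \<longrightarrow> subchain c' c \<longrightarrow> (\<exists>\<sigma>. c' \<sigma> \<noteq> 0) \<longrightarrow> c' = c)"

definition chain_vertices :: "'v chain \<Rightarrow> 'v set" where
  "chain_vertices c = \<Union>{\<sigma>. c \<sigma> \<noteq> 0}"

lemma cycle_subset: "cycle k c \<Longrightarrow> c \<sigma> \<noteq> 0 \<Longrightarrow> \<sigma> \<subseteq> U"
  and cycle_card: "cycle k c \<Longrightarrow> c \<sigma> \<noteq> 0 \<Longrightarrow> card \<sigma> = k"
  and cycle_boundary: "cycle k c \<Longrightarrow> \<rho> \<subseteq> U \<Longrightarrow> boundary c \<rho> = 0"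
  by (auto simp: cycle_def)

lemma cycle_add:
  assumes "cycle k c" "cycle k c'" shows "cycle k (\<lambda>\<sigma>. c \<sigma> + c' \<sigma>)"
  unfolding cycle_def
proof (intro conjI allI impI)
  show "boundary (\<lambda>\<sigma>. c \<sigma> + c' \<sigma>) \<rho> = 0" if "\<rho> \<subseteq> U" for \<rho>
    using assms[THEN cycle_boundary, OF that] by (simp add: boundary_def sum.distrib)
  fix \<sigma> assume "c \<sigma> + c' \<sigma> \<noteq> 0"
  then have "c \<sigma> \<noteq> 0 \<or> c' \<sigma> \<noteq> 0" by auto
  then show "\<sigma> \<subseteq> U" "card \<sigma> = k" using assms by (auto simp: cycle_def)
qed

lemma cycle_zero: "cycle k (\<lambda>\<sigma>. 0)"
  by (simp add: cycle_def boundary_def)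

lemma cycle_sum:
  assumes "finite J" "\<And>j. j \<in> J \<Longrightarrow> cycle k (c j)"
  shows "cycle k (\<lambda>\<sigma>. \<Sum>j\<in>J. c j \<sigma>)"
  using assms by (induction J rule: finite_induct) (simp_all add: cycle_zero cycle_add)

lemma finite_support: "cycle k c \<Longrightarrow> finite {\<sigma>. c \<sigma> \<noteq> 0}"
  by (rule finite_subset[of _ "Pow U"]) (auto simp: cycle_def finite_U)

lemma cycle_adjacent_facet:
  assumes "cycle k c" "c \<sigma> \<noteq> 0" "w \<in> \<sigma>"
  obtains w' where "w' \<in> U - \<sigma>" "c (insert w' (\<sigma> - {w})) \<noteq> 0"
proof -
  have \<sigma>: "\<sigma> \<subseteq> U" using assms cycle_subset by blast
  have "boundary c (\<sigma> - {w}) = 0" using assms \<sigma> cycle_boundary by blast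
  moreover have "U - (\<sigma> - {w}) = insert w (U - \<sigma>)" using assms(3) \<sigma> by auto
  ultimately have "c \<sigma> + (\<Sum>w'\<in>U - \<sigma>. c (insert w' (\<sigma> - {w}))) = 0"
    using finite_U assms(3) by (simp add: boundary_def insert_absorb)
  then have "(\<Sum>w'\<in>U - \<sigma>. c (insert w' (\<sigma> - {w}))) \<noteq> 0"
    using assms(2) unfolding bit_add_eq_0_iff by auto
  then show thesis using that by (meson sum.neutral)
qed

lemma chain_vertices_subset: "cycle k c \<Longrightarrow> chain_vertices c \<subseteq> U"
  by (auto simp: chain_vertices_def cycle_def)

lemma finite_chain_vertices: "cycle k c \<Longrightarrow> finite (chain_vertices c)"
  using chain_vertices_subset finite_U finite_subset by blast

lemma card_chain_vertices:
  assumes "cycle k c" "c \<sigma> \<noteq> 0" "0 < k"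
  shows "k + 1 \<le> card (chain_vertices c)"
proof -
  have "\<sigma> \<noteq> {}" using cycle_card[OF assms(1,2)] assms(3) by auto
  then obtain w where "w \<in> \<sigma>" by blast
  then obtain w' where w': "w' \<notin> \<sigma>" "c (insert w' (\<sigma> - {w})) \<noteq> 0"
    using cycle_adjacent_facet[OF assms(1,2)] by blast
  have "finite \<sigma>" using assms(3) cycle_card[OF assms(1,2)] card.infinite by force
  then have "card (insert w' \<sigma>) = k + 1"
    using w' cycle_card[OF assms(1,2)] by simp
  moreover have "insert w' \<sigma> \<subseteq> chain_vertices c"
    using w' assms(2) by (auto simp: chain_vertices_def)
  ultimately show ?thesis
    using card_mono finite_chain_vertices[OF assms(1)] by metis
qed

text \<open>
  A nonzero subcycle with the fewest facets is minimal; subtract it and repeat.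
\<close>

lemma minimal_cycle_decomposition:
  assumes "cycle k l"
  shows "\<exists>M. finite M \<and> (\<forall>x\<in>M. minimal_cycle k x \<and> subchain x l) \<and> (\<forall>\<sigma>. l \<sigma> = (\<Sum>x\<in>M. x \<sigma>))"
  using assms
proof (induction "card {\<sigma>. l \<sigma> \<noteq> 0}" arbitrary: l rule: less_induct)
  case less
  show ?case
  proof (cases "\<exists>\<sigma>. l \<sigma> \<noteq> 0")
    case False
    then show ?thesis by (intro exI[of _ "{}"]) auto
  next
    case True
    define Q where "Q x \<longleftrightarrow> cycle k x \<and> (\<exists>\<sigma>. x \<sigma> \<noteq> 0) \<and> subchain x l" for x
    have "Q l" using True less.prems by (simp add: Q_def subchain_def)
    then obtain x where x: "Q x" "\<And>y. Q y \<Longrightarrow> card {\<sigma>. x \<sigma> \<noteq> 0} \<le> card {\<sigma>. y \<sigma> \<noteq> 0}"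
      using ex_has_least_nat[of Q l "\<lambda>x. card {\<sigma>. x \<sigma> \<noteq> 0}"] by blast
    have "minimal_cycle k x"
      unfolding minimal_cycle_def
    proof (intro conjI allI impI)
      fix y assume y: "cycle k y" "subchain y x" "\<exists>\<sigma>. y \<sigma> \<noteq> 0"
      then have "Q y" using x by (auto simp: Q_def subchain_def)
      then have "{\<sigma>. y \<sigma> \<noteq> 0} = {\<sigma>. x \<sigma> \<noteq> 0}"
        using x y finite_support[of k x] by (intro card_seteq) (auto simp: Q_def subchain_def)
      then show "y = x" by (intro ext) (metis (mono_tags, lifting) bit_eq_iff_nonzero mem_Collect_eq)
    qed (use x in \<open>auto simp: Q_def\<close>)
    define l' where "l' \<sigma> = l \<sigma> + x \<sigma>" for \<sigma>
    have l': "cycle k l'" unfolding l'_def using x less.prems by (intro cycle_add) (auto simp: Q_def)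
    have supp: "l' \<sigma> \<noteq> 0 \<longleftrightarrow> l \<sigma> \<noteq> 0 \<and> x \<sigma> = 0" for \<sigma>
      using x by (cases "l \<sigma>"; cases "x \<sigma>") (auto simp: l'_def Q_def subchain_def)
    obtain \<tau> where "x \<tau> \<noteq> 0" "l \<tau> \<noteq> 0"
      using x(1) by (auto simp: Q_def subchain_def)
    then have "{\<sigma>. l' \<sigma> \<noteq> 0} \<subset> {\<sigma>. l \<sigma> \<noteq> 0}"
      using supp by blast
    then have "card {\<sigma>. l' \<sigma> \<noteq> 0} < card {\<sigma>. l \<sigma> \<noteq> 0}"
      using finite_support[OF less.prems] psubset_card_mono by blast
    from less.hyps[OF this l'] obtain M where M: "finite M" "\<And>y. y \<in> M \<Longrightarrow> minimal_cycle k y \<and> subchain y l'"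
      "\<And>\<sigma>. l' \<sigma> = (\<Sum>y\<in>M. y \<sigma>)"
      by blast
    have "x \<notin> M"
      using M(2)[of x] x supp by (auto simp: Q_def subchain_def)
    have "l \<sigma> = (\<Sum>y\<in>insert x M. y \<sigma>)" for \<sigma>
    proof -
      have "l \<sigma> = x \<sigma> + l' \<sigma>" by (simp add: l'_def add.left_commute)
      then show ?thesis using M(1) M(3)[of \<sigma>] \<open>x \<notin> M\<close> by simp
    qed
    moreover have "subchain y l" if "y \<in> M" for y
      using M(2)[OF that] supp by (auto simp: subchain_def)
    ultimately show ?thesis
      using M \<open>minimal_cycle k x\<close> x by (intro exI[of _ "insert x M"]) (auto simp: Q_def)
  qed
qed

text \<open>
  With respect to an edge \<open>uv\<close>, a chain consists of four chains on the other vertices: the facets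
  containing neither, one, or both of \<open>u\<close> and \<open>v\<close>. These are the components of the boundary in this
  description.
\<close>

lemma boundary_split:
  assumes "u \<in> U" "v \<in> U" "u \<noteq> v" "u \<notin> \<rho>" "v \<notin> \<rho>"
  shows boundary_split_none: "boundary f \<rho> =
          f (insert u \<rho>) + f (insert v \<rho>) + (\<Sum>w\<in>U - {u, v} - \<rho>. f (insert w \<rho>))"
    and boundary_split_left: "boundary f (insert u \<rho>) =
          f (insert u (insert v \<rho>)) + (\<Sum>w\<in>U - {u, v} - \<rho>. f (insert u (insert w \<rho>)))"
    and boundary_split_right: "boundary f (insert v \<rho>) =
          f (insert u (insert v \<rho>)) + (\<Sum>w\<in>U - {u, v} - \<rho>. f (insert v (insert w \<rho>)))"
    and boundary_split_both: "boundary f (insert u (insert v \<rho>)) =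
          (\<Sum>w\<in>U - {u, v} - \<rho>. f (insert u (insert v (insert w \<rho>))))"
proof -
  define N where "N = U - {u, v} - \<rho>"
  have N: "finite N" "u \<notin> N" "v \<notin> N" using finite_U by (auto simp: N_def)
  have "U - \<rho> = insert u (insert v N)" "U - insert u \<rho> = insert v N"
    "U - insert v \<rho> = insert u N" "U - insert u (insert v \<rho>) = N"
    using assms by (auto simp: N_def)
  then show "boundary f \<rho> =
          f (insert u \<rho>) + f (insert v \<rho>) + (\<Sum>w\<in>U - {u, v} - \<rho>. f (insert w \<rho>))"
    "boundary f (insert u \<rho>) =
          f (insert u (insert v \<rho>)) + (\<Sum>w\<in>U - {u, v} - \<rho>. f (insert u (insert w \<rho>)))"
    "boundary f (insert v \<rho>) =
          f (insert u (insert v \<rho>)) + (\<Sum>w\<in>U - {u, v} - \<rho>. f (insert v (insert w \<rho>)))"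
    "boundary f (insert u (insert v \<rho>)) =
          (\<Sum>w\<in>U - {u, v} - \<rho>. f (insert u (insert v (insert w \<rho>))))"
    unfolding boundary_def N_def[symmetric] using N assms(3)
    by (simp_all add: add.assoc insert_commute)
qed

lemma edge_cases:
  assumes "\<sigma> \<subseteq> U"
  obtains (none) "\<sigma> \<subseteq> U - {u, v}"
  | (left) \<rho> where "\<rho> \<subseteq> U - {u, v}" "\<sigma> = insert u \<rho>"
  | (right) \<rho> where "\<rho> \<subseteq> U - {u, v}" "\<sigma> = insert v \<rho>"
  | (both) \<rho> where "\<rho> \<subseteq> U - {u, v}" "\<sigma> = insert u (insert v \<rho>)"
proof (cases "u \<in> \<sigma>"; cases "v \<in> \<sigma>")
  assume "u \<notin> \<sigma>" "v \<notin> \<sigma>"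
  then show thesis using none assms by auto
next
  assume "u \<in> \<sigma>" "v \<notin> \<sigma>"
  then show thesis using left[of "\<sigma> - {u}"] assms by auto
next
  assume "u \<notin> \<sigma>" "v \<in> \<sigma>"
  then show thesis using right[of "\<sigma> - {v}"] assms by auto
next
  assume "u \<in> \<sigma>" "v \<in> \<sigma>"
  then show thesis using both[of "\<sigma> - {u, v}"] assms by auto
qed

lemma cycleI_edge:
  assumes uv: "u \<in> U" "v \<in> U" "u \<noteq> v"
    and "\<And>\<sigma>. f \<sigma> \<noteq> 0 \<Longrightarrow> \<sigma> \<subseteq> U \<and> card \<sigma> = k"
    and "\<And>\<rho>. \<rho> \<subseteq> U - {u, v} \<Longrightarrow>
      f (insert u \<rho>) + f (insert v \<rho>) + (\<Sum>w\<in>U - {u, v} - \<rho>. f (insert w \<rho>)) = 0"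
    and "\<And>\<rho>. \<rho> \<subseteq> U - {u, v} \<Longrightarrow>
      f (insert u (insert v \<rho>)) + (\<Sum>w\<in>U - {u, v} - \<rho>. f (insert u (insert w \<rho>))) = 0"
    and "\<And>\<rho>. \<rho> \<subseteq> U - {u, v} \<Longrightarrow>
      f (insert u (insert v \<rho>)) + (\<Sum>w\<in>U - {u, v} - \<rho>. f (insert v (insert w \<rho>))) = 0"
    and "\<And>\<rho>. \<rho> \<subseteq> U - {u, v} \<Longrightarrow>
      (\<Sum>w\<in>U - {u, v} - \<rho>. f (insert u (insert v (insert w \<rho>)))) = 0"
  shows "cycle k f"
  unfolding cycle_def
proof (intro conjI allI impI)
  show "boundary f \<rho> = 0" if "\<rho> \<subseteq> U" for \<rho>
    using that
  proof (cases \<rho> rule: edge_cases[of _ u v])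
    case none
    then have "u \<notin> \<rho>" "v \<notin> \<rho>" by auto
    then show ?thesis using assms(5)[OF none] boundary_split_none[OF uv] by metis
  next
    case (left \<rho>)
    then have "u \<notin> \<rho>" "v \<notin> \<rho>" by auto
    then show ?thesis using assms(6)[OF left(1)] boundary_split_left[OF uv] left(2) by metis
  next
    case (right \<rho>)
    then have "u \<notin> \<rho>" "v \<notin> \<rho>" by auto
    then show ?thesis using assms(7)[OF right(1)] boundary_split_right[OF uv] right(2) by metis
  next
    case (both \<rho>)
    then have "u \<notin> \<rho>" "v \<notin> \<rho>" by auto
    then show ?thesis using assms(8)[OF both(1)] boundary_split_both[OF uv] both(2) by metis
  qed
qed (use assms(4) in auto)

lemma cycleD_edge:
  assumes "cycle k f" and uv: "u \<in> U" "v \<in> U" "u \<noteq> v" and \<rho>: "\<rho> \<subseteq> U - {u, v}"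
  shows "f (insert u \<rho>) + f (insert v \<rho>) + (\<Sum>w\<in>U - {u, v} - \<rho>. f (insert w \<rho>)) = 0"
    and "f (insert u (insert v \<rho>)) + (\<Sum>w\<in>U - {u, v} - \<rho>. f (insert u (insert w \<rho>))) = 0"
    and "f (insert u (insert v \<rho>)) + (\<Sum>w\<in>U - {u, v} - \<rho>. f (insert v (insert w \<rho>))) = 0"
proof -
  have n: "u \<notin> \<rho>" "v \<notin> \<rho>" and sub: "\<rho> \<subseteq> U" "insert u \<rho> \<subseteq> U" "insert v \<rho> \<subseteq> U"
    using \<rho> uv by auto
  note b = sub[THEN cycle_boundary[OF assms(1)]] and s = boundary_split[OF uv n, of f]
  show "f (insert u \<rho>) + f (insert v \<rho>) + (\<Sum>w\<in>U - {u, v} - \<rho>. f (insert w \<rho>)) = 0"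
    "f (insert u (insert v \<rho>)) + (\<Sum>w\<in>U - {u, v} - \<rho>. f (insert u (insert w \<rho>))) = 0"
    "f (insert u (insert v \<rho>)) + (\<Sum>w\<in>U - {u, v} - \<rho>. f (insert v (insert w \<rho>))) = 0"
    using b s by simp_all
qed

text \<open>
  The push-forward of a chain along the map that sends \<open>v\<close> to \<open>u\<close>: facets containing both vertices
  degenerate, and two facets that become equal cancel.
\<close>

definition contraction :: "'v \<Rightarrow> 'v \<Rightarrow> 'v chain \<Rightarrow> 'v chain" where
  "contraction u v c \<tau> =
     (if v \<in> \<tau> then 0 else if u \<in> \<tau> then c \<tau> + c (insert v (\<tau> - {u})) else c \<tau>)"

lemma contraction_simps:
  assumes "u \<noteq> v" "u \<notin> \<rho>" "v \<notin> \<rho>"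
  shows "contraction u v c \<rho> = c \<rho>"
    "contraction u v c (insert u \<rho>) = c (insert u \<rho>) + c (insert v \<rho>)"
    "contraction u v c (insert v \<rho>') = 0"
    "contraction u v c (insert u (insert v \<rho>')) = 0"
  using assms by (auto simp: contraction_def)

lemma cycle_contraction:
  assumes c: "cycle k c" and uv: "u \<in> U" "v \<in> U" "u \<noteq> v"
  shows "cycle k (contraction u v c)"
proof (rule cycleI_edge[OF uv])
  fix \<sigma> assume \<sigma>: "contraction u v c \<sigma> \<noteq> 0"
  then have "v \<notin> \<sigma>" and *: "c \<sigma> \<noteq> 0 \<or> u \<in> \<sigma> \<and> c (insert v (\<sigma> - {u})) \<noteq> 0"
    by (auto simp: contraction_def split: if_splits)
  from * show "\<sigma> \<subseteq> U \<and> card \<sigma> = k"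
  proof
    assume a: "u \<in> \<sigma> \<and> c (insert v (\<sigma> - {u})) \<noteq> 0"
    then have *: "insert v (\<sigma> - {u}) \<subseteq> U" "card (insert v (\<sigma> - {u})) = k"
      using c cycle_subset cycle_card by blast+
    have "\<sigma> \<subseteq> U" using uv * by auto
    moreover have "finite \<sigma>"
      using \<open>\<sigma> \<subseteq> U\<close> finite_U finite_subset by blast
    ultimately show ?thesis
      using \<open>v \<notin> \<sigma>\<close> a *(2) by (metis Diff_iff card.remove card_insert_disjoint finite_Diff)
  qed (use c in \<open>auto simp: cycle_def\<close>)
next
  fix \<rho> assume \<rho>: "\<rho> \<subseteq> U - {u, v}"
  then have n: "u \<notin> \<rho>" "v \<notin> \<rho>" by auto
  note S = contraction_simps[OF uv(3)]
  note D = cycleD_edge[OF c uv \<rho>]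
  have "contraction u v c (insert w \<rho>) = c (insert w \<rho>)" if "w \<in> U - {u, v} - \<rho>" for w
    using that n by (intro S) auto
  then show "contraction u v c (insert u \<rho>) + contraction u v c (insert v \<rho>)
      + (\<Sum>w\<in>U - {u, v} - \<rho>. contraction u v c (insert w \<rho>)) = 0"
    using D(1) n by (simp add: S)
  have *: "contraction u v c (insert u (insert w \<rho>)) = c (insert u (insert w \<rho>)) + c (insert v (insert w \<rho>))"
    if "w \<in> U - {u, v} - \<rho>" for w
    using that n by (intro S) auto
  have "(\<Sum>w\<in>U - {u, v} - \<rho>. contraction u v c (insert u (insert w \<rho>)))
     = c (insert u (insert v \<rho>)) + c (insert u (insert v \<rho>))"
    using D(2,3) by (simp only: * sum.distrib bit_add_eq_0_iff cong: sum.cong)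
  then show "contraction u v c (insert u (insert v \<rho>))
      + (\<Sum>w\<in>U - {u, v} - \<rho>. contraction u v c (insert u (insert w \<rho>))) = 0"
    using n by (simp add: S)
qed (use contraction_simps[OF uv(3)] in \<open>simp_all add: contraction_def\<close>)

text \<open>
  If \<open>l\<close> is a subcycle of the contraction of \<open>c\<close>, each of its facets comes from exactly one facet of \<open>c\<close>
  that does not contain both \<open>u\<close> and \<open>v\<close>. The chain of these facets has boundary consisting of pairs
  \<open>\<rho>u + \<rho>v\<close>; the last case adds the simplices \<open>\<rho>uv\<close> that close it up.
\<close>

definition lift :: "'v \<Rightarrow> 'v \<Rightarrow> 'v chain \<Rightarrow> 'v chain \<Rightarrow> 'v chain" where
  "lift u v c l \<sigma> =
     (if v \<notin> \<sigma> then if u \<in> \<sigma> then c \<sigma> * l \<sigma> else l \<sigma>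
      else if u \<notin> \<sigma> then c \<sigma> * l (insert u (\<sigma> - {v}))
      else \<Sum>w\<in>U - \<sigma>. c (insert w (\<sigma> - {v})) * l (insert w (\<sigma> - {v})))"

lemma lift_simps:
  assumes "u \<noteq> v" "u \<notin> \<rho>" "v \<notin> \<rho>"
  shows "lift u v c l \<rho> = l \<rho>"
    "lift u v c l (insert u \<rho>) = c (insert u \<rho>) * l (insert u \<rho>)"
    "lift u v c l (insert v \<rho>) = c (insert v \<rho>) * l (insert u \<rho>)"
    "lift u v c l (insert u (insert v \<rho>)) =
       (\<Sum>w\<in>U - {u, v} - \<rho>. c (insert u (insert w \<rho>)) * l (insert u (insert w \<rho>)))"
proof -
  have "insert u (insert v \<rho>) - {v} = insert u \<rho>" "U - insert u (insert v \<rho>) = U - {u, v} - \<rho>"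
    using assms by auto
  then show "lift u v c l (insert u (insert v \<rho>)) =
       (\<Sum>w\<in>U - {u, v} - \<rho>. c (insert u (insert w \<rho>)) * l (insert u (insert w \<rho>)))"
    using assms by (simp add: lift_def insert_commute)
qed (use assms in \<open>auto simp: lift_def\<close>)

lemma lift_nonzero:
  assumes l: "subchain l (contraction u v c)" and c: "cycle k c" and uv: "u \<in> U" "v \<in> U" "u \<noteq> v"
    and \<sigma>: "lift u v c l \<sigma> \<noteq> 0"
  shows "\<sigma> \<subseteq> U \<and> card \<sigma> = k \<and>
    (if u \<in> \<sigma> \<and> v \<in> \<sigma>
     then \<exists>\<rho> w. \<rho> \<subseteq> U - {u, v} \<and> w \<in> U - {u, v} - \<rho> \<and> \<sigma> = insert u (insert v \<rho>) \<and>
       c (insert u (insert w \<rho>)) \<noteq> 0 \<and> l (insert u (insert w \<rho>)) \<noteq> 0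
     else c \<sigma> \<noteq> 0)"
proof (cases "u \<in> \<sigma> \<and> v \<in> \<sigma>")
  case False
  have "c \<sigma> \<noteq> 0"
  proof (cases "u \<in> \<sigma> \<or> v \<in> \<sigma>")
    case True
    then show ?thesis using False \<sigma> by (cases "c \<sigma>") (auto simp: lift_def)
  next
    case no: False
    then have "contraction u v c \<sigma> \<noteq> 0" using \<sigma> l by (simp add: lift_def subchain_def)
    then show ?thesis using no by (simp add: contraction_def)
  qed
  then show ?thesis using cycle_subset[OF c, of \<sigma>] cycle_card[OF c, of \<sigma>] False by auto
next
  case True
  define \<rho> where "\<rho> = \<sigma> - {u, v}"
  have \<rho>: "\<sigma> = insert u (insert v \<rho>)" "u \<notin> \<rho>" "v \<notin> \<rho>" using True by (auto simp: \<rho>_def)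
  then have "(\<Sum>w\<in>U - {u, v} - \<rho>. c (insert u (insert w \<rho>)) * l (insert u (insert w \<rho>))) \<noteq> 0"
    using \<sigma> lift_simps(4)[OF uv(3) \<rho>(2,3), of c l] by simp
  then obtain w where w: "w \<in> U - {u, v} - \<rho>"
    "c (insert u (insert w \<rho>)) * l (insert u (insert w \<rho>)) \<noteq> 0"
    by (meson sum.neutral)
  then have w': "c (insert u (insert w \<rho>)) \<noteq> 0" "l (insert u (insert w \<rho>)) \<noteq> 0"
    using mult_not_zero by blast+
  have a: "insert u (insert w \<rho>) \<subseteq> U" "card (insert u (insert w \<rho>)) = k"
    using cycle_subset[OF c w'(1)] cycle_card[OF c w'(1)] .
  have "finite \<rho>" using a(1) by (intro finite_subset[OF _ finite_U]) simp
  then have "card (insert u (insert v \<rho>)) = card (insert u (insert w \<rho>))"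
    using \<rho>(2,3) w(1) uv(3) by (auto simp: card_insert_if)
  then have "card \<sigma> = k" using \<rho>(1) a(2) by simp
  moreover have "\<sigma> \<subseteq> U" "\<rho> \<subseteq> U - {u, v}" using \<rho> a(1) uv by auto
  ultimately have "\<exists>\<rho> w. \<rho> \<subseteq> U - {u, v} \<and> w \<in> U - {u, v} - \<rho> \<and> \<sigma> = insert u (insert v \<rho>) \<and>
       c (insert u (insert w \<rho>)) \<noteq> 0 \<and> l (insert u (insert w \<rho>)) \<noteq> 0"
    using w(1) w' \<rho>(1) by blast
  then show ?thesis using True \<open>card \<sigma> = k\<close> \<open>\<sigma> \<subseteq> U\<close> by simp
qed

lemma cycle_lift:
  assumes l: "cycle k l" "subchain l (contraction u v c)" and c: "cycle k c"
    and uv: "u \<in> U" "v \<in> U" "u \<noteq> v"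
  shows "cycle k (lift u v c l)"
proof (rule cycleI_edge[OF uv])
  show "\<sigma> \<subseteq> U \<and> card \<sigma> = k" if "lift u v c l \<sigma> \<noteq> 0" for \<sigma>
    using lift_nonzero[OF l(2) c uv that] by blast
next
  fix \<rho> assume \<rho>: "\<rho> \<subseteq> U - {u, v}"
  define N where "N = U - {u, v} - \<rho>"
  have n: "u \<notin> \<rho>" "v \<notin> \<rho>" using \<rho> by auto
  have n': "u \<notin> insert w \<rho>" "v \<notin> insert w \<rho>" if "w \<in> N" for w
    using that n by (auto simp: N_def)
  note S = lift_simps[OF uv(3)]
  have lv: "l \<sigma> = 0" if "v \<in> \<sigma>" for \<sigma>
    using l(2) that by (auto simp: subchain_def contraction_def)
  note D = cycleD_edge[OF l(1) uv \<rho>, folded N_def]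
  \<comment> \<open>The lift is described by \<open>e\<close>, its part over \<open>u\<close>: its part over \<open>v\<close> differs from \<open>e\<close> by the part of
    \<open>l\<close> over \<open>u\<close>, and its part over \<open>uv\<close> is the boundary of \<open>e\<close>.\<close>
  define e where "e \<tau> = c (insert u \<tau>) * l (insert u \<tau>)" for \<tau>
  have right: "lift u v c l (insert v \<tau>) = l (insert u \<tau>) + e \<tau>" if "u \<notin> \<tau>" "v \<notin> \<tau>" for \<tau>
  proof (cases "l (insert u \<tau>)")
    case zero
    then show ?thesis using that by (simp add: S e_def)
  next
    case one
    then have "contraction u v c (insert u \<tau>) \<noteq> 0"
      using l(2) by (auto simp: subchain_def)
    then have "c (insert u \<tau>) + c (insert v \<tau>) = 1"
      using contraction_simps(2)[OF uv(3) that] by simp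
    then show ?thesis using one that
      by (cases "c (insert u \<tau>)"; cases "c (insert v \<tau>)") (auto simp: S e_def)
  qed
  have both: "lift u v c l (insert u (insert v \<tau>)) = (\<Sum>w\<in>U - {u, v} - \<tau>. e (insert w \<tau>))"
    if "u \<notin> \<tau>" "v \<notin> \<tau>" for \<tau>
    using S(4)[OF that] by (simp add: e_def)
  show "lift u v c l (insert u \<rho>) + lift u v c l (insert v \<rho>)
      + (\<Sum>w\<in>U - {u, v} - \<rho>. lift u v c l (insert w \<rho>)) = 0"
  proof -
    have "(\<Sum>w\<in>N. lift u v c l (insert w \<rho>)) = (\<Sum>w\<in>N. l (insert w \<rho>))"
      using n' by (intro sum.cong S) auto
    also have "\<dots> = l (insert u \<rho>)"
      using D(1) by (simp add: lv bit_add_eq_0_iff)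
    finally have "(\<Sum>w\<in>N. lift u v c l (insert w \<rho>)) = l (insert u \<rho>)" .
    moreover have "lift u v c l (insert u \<rho>) = e \<rho>" using n by (simp add: S e_def)
    ultimately show ?thesis
      unfolding right[OF n] N_def[symmetric]
      by (cases "e \<rho>"; cases "l (insert u \<rho>)") auto
  qed
  show "lift u v c l (insert u (insert v \<rho>))
      + (\<Sum>w\<in>U - {u, v} - \<rho>. lift u v c l (insert u (insert w \<rho>))) = 0"
  proof -
    have "(\<Sum>w\<in>N. lift u v c l (insert u (insert w \<rho>))) = (\<Sum>w\<in>N. e (insert w \<rho>))"
      unfolding e_def using n' by (intro sum.cong S) auto
    then show ?thesis unfolding both[OF n] N_def by simp
  qed
  show "lift u v c l (insert u (insert v \<rho>))
      + (\<Sum>w\<in>U - {u, v} - \<rho>. lift u v c l (insert v (insert w \<rho>))) = 0"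
  proof -
    have "(\<Sum>w\<in>N. lift u v c l (insert v (insert w \<rho>)))
        = (\<Sum>w\<in>N. l (insert u (insert w \<rho>)) + e (insert w \<rho>))"
      using n' by (intro sum.cong right) auto
    also have "\<dots> = (\<Sum>w\<in>N. e (insert w \<rho>))"
      using D(2) by (simp add: lv sum.distrib)
    finally show ?thesis unfolding both[OF n] N_def by simp
  qed
  show "(\<Sum>w\<in>U - {u, v} - \<rho>. lift u v c l (insert u (insert v (insert w \<rho>)))) = 0"
  proof -
    have "(\<Sum>w\<in>N. lift u v c l (insert u (insert v (insert w \<rho>))))
        = (\<Sum>w\<in>N. \<Sum>w'\<in>N - {w}. e (insert w' (insert w \<rho>)))"
    proof (intro sum.cong refl)
      fix w assume "w \<in> N"
      moreover have "U - {u, v} - insert w \<rho> = N - {w}" by (auto simp: N_def)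
      ultimately show "lift u v c l (insert u (insert v (insert w \<rho>)))
          = (\<Sum>w'\<in>N - {w}. e (insert w' (insert w \<rho>)))"
        using both[OF n'] by simp
    qed
    also have "\<dots> = 0"
      using finite_U by (intro sum_symmetric_pairs_bit) (simp_all add: N_def insert_commute)
    finally show ?thesis by (simp add: N_def)
  qed
qed

definition simplex_boundary :: "'v set \<Rightarrow> 'v chain" where
  "simplex_boundary S \<sigma> = (if \<sigma> \<subseteq> S \<and> card S = Suc (card \<sigma>) then 1 else 0)"

text \<open>
  The difference between \<open>c\<close> and the sum of the lifts consists of the facets that cancel in pairs \<open>\<tau>u\<close>,
  \<open>\<tau>v\<close> under the contraction, and of simplices containing \<open>uv\<close>. A cycle is determined by its facets
  that do not contain both \<open>u\<close> and \<open>v\<close>, so the difference is the sum of the boundaries of the simplices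
  \<open>\<tau>uv\<close>.
\<close>

lemma edge_decomposition:
  assumes c: "cycle k c" and uv: "u \<in> U" "v \<in> U" "u \<noteq> v"
    and M: "finite M" "\<And>\<sigma>. contraction u v c \<sigma> = (\<Sum>l\<in>M. l \<sigma>)"
    and \<sigma>: "\<sigma> \<subseteq> U"
  shows "c \<sigma> = (\<Sum>l\<in>M. lift u v c l \<sigma>) +
    (\<Sum>\<tau> | \<tau> \<subseteq> U - {u, v} \<and> c (insert u \<tau>) \<noteq> 0 \<and> c (insert v \<tau>) \<noteq> 0.
       simplex_boundary (insert u (insert v \<tau>)) \<sigma>)"
proof -
  define D where "D = {\<tau>. \<tau> \<subseteq> U - {u, v} \<and> c (insert u \<tau>) \<noteq> 0 \<and> c (insert v \<tau>) \<noteq> 0}"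
  have D: "finite D" "\<And>\<tau>. \<tau> \<in> D \<Longrightarrow> u \<notin> \<tau> \<and> v \<notin> \<tau> \<and> finite \<tau>"
    using finite_U by (auto simp: D_def intro: finite_subset[of _ "Pow U"] finite_subset[of _ U])
  have inD: "(if \<tau> \<in> D then 1 else 0) = c (insert u \<tau>) * c (insert v \<tau>)" if "\<tau> \<subseteq> U - {u, v}" for \<tau>
    using that by (auto simp: D_def)
  note S = lift_simps[OF uv(3)]
  have sum_M: "(\<Sum>l\<in>M. l (insert u \<rho>)) = c (insert u \<rho>) + c (insert v \<rho>)"
    if "u \<notin> \<rho>" "v \<notin> \<rho>" for \<rho>
    using M(2)[of "insert u \<rho>"] contraction_simps(2)[OF uv(3) that] by simp
  have sb: "simplex_boundary (insert u (insert v \<tau>)) \<rho> = 0"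
    "simplex_boundary (insert u (insert v \<tau>)) (insert u \<rho>) = (if \<rho> = \<tau> then 1 else 0)"
    "simplex_boundary (insert u (insert v \<tau>)) (insert v \<rho>) = (if \<rho> = \<tau> then 1 else 0)"
    "simplex_boundary (insert u (insert v \<tau>)) (insert u (insert v \<rho>)) =
      (if \<rho> \<subseteq> \<tau> \<and> card \<tau> = Suc (card \<rho>) then 1 else 0)"
    if "\<tau> \<in> D" "u \<notin> \<rho>" "v \<notin> \<rho>" for \<tau> \<rho>
  proof -
    have t: "u \<notin> \<tau>" "v \<notin> \<tau>" "finite \<tau>" using D(2) that by auto
    have sub: "\<rho> \<subseteq> insert u (insert v \<tau>) \<longleftrightarrow> \<rho> \<subseteq> \<tau>" using that by auto
    have f: "finite \<rho>" if "\<rho> \<subseteq> \<tau>" using that t finite_subset by blast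
    have e: "\<rho> = \<tau>" if "\<rho> \<subseteq> \<tau>" "card \<tau> = card \<rho>" using that t card_subset_eq by metis
    show "simplex_boundary (insert u (insert v \<tau>)) \<rho> = 0"
      using t uv sub card_mono[OF t(3), of \<rho>] by (auto simp: simplex_boundary_def)
    show "simplex_boundary (insert u (insert v \<tau>)) (insert u \<rho>) = (if \<rho> = \<tau> then 1 else 0)"
      "simplex_boundary (insert u (insert v \<tau>)) (insert v \<rho>) = (if \<rho> = \<tau> then 1 else 0)"
      "simplex_boundary (insert u (insert v \<tau>)) (insert u (insert v \<rho>)) =
      (if \<rho> \<subseteq> \<tau> \<and> card \<tau> = Suc (card \<rho>) then 1 else 0)"
      using t uv sub that f e by (auto simp: simplex_boundary_def)
  qed
  \<comment> \<open>The facets over \<open>u\<close> that survive the contraction and those that cancel make up all of them.\<close>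
  have idem: "a * (a + b) + a * b = (a::bit)" for a b
    by (cases a; cases b) auto
  have "c \<sigma> = (\<Sum>l\<in>M. lift u v c l \<sigma>) + (\<Sum>\<tau>\<in>D. simplex_boundary (insert u (insert v \<tau>)) \<sigma>)"
    using \<sigma>
  proof (cases \<sigma> rule: edge_cases[of _ u v])
    case none
    then have n: "u \<notin> \<sigma>" "v \<notin> \<sigma>" by auto
    have "contraction u v c \<sigma> = c \<sigma>" using contraction_simps(1)[OF uv(3) n] .
    then show ?thesis using M(2)[of \<sigma>] n by (simp add: S sb)
  next
    case (left \<rho>)
    then have n: "u \<notin> \<rho>" "v \<notin> \<rho>" by auto
    have "(\<Sum>\<tau>\<in>D. simplex_boundary (insert u (insert v \<tau>)) \<sigma>) = (if \<rho> \<in> D then 1 else 0)"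
      using n D(1) by (simp add: left(2) sb)
    moreover have "(\<Sum>l\<in>M. lift u v c l \<sigma>) = c (insert u \<rho>) * (\<Sum>l\<in>M. l (insert u \<rho>))"
      using n by (simp add: left(2) S sum_distrib_left)
    ultimately show ?thesis
      using sum_M[OF n] inD[OF left(1)] left(2) idem
      by simp
  next
    case (right \<rho>)
    then have n: "u \<notin> \<rho>" "v \<notin> \<rho>" by auto
    have "(\<Sum>\<tau>\<in>D. simplex_boundary (insert u (insert v \<tau>)) \<sigma>) = (if \<rho> \<in> D then 1 else 0)"
      using n D(1) by (simp add: right(2) sb)
    moreover have "(\<Sum>l\<in>M. lift u v c l \<sigma>) = c (insert v \<rho>) * (\<Sum>l\<in>M. l (insert u \<rho>))"
      using n by (simp add: right(2) S sum_distrib_left)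
    ultimately show ?thesis
      using sum_M[OF n] inD[OF right(1)] right(2) idem[of "c (insert v \<rho>)" "c (insert u \<rho>)"]
      by (simp add: ac_simps)
  next
    case (both \<rho>)
    then have n: "u \<notin> \<rho>" "v \<notin> \<rho>" by auto
    define N where "N = U - {u, v} - \<rho>"
    have N: "finite N" "finite \<rho>"
      using finite_U both(1) by (auto simp: N_def intro: finite_subset[of _ U])
    have n': "u \<notin> insert w \<rho>" "v \<notin> insert w \<rho>" "insert w \<rho> \<subseteq> U - {u, v}" if "w \<in> N" for w
      using that n both(1) by (auto simp: N_def)
    have "{\<tau> \<in> D. \<rho> \<subseteq> \<tau> \<and> card \<tau> = Suc (card \<rho>)} = (\<lambda>w. insert w \<rho>) ` {w \<in> N. insert w \<rho> \<in> D}"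
      (is "?L = ?R")
    proof
      show "?L \<subseteq> ?R"
      proof
        fix \<tau> assume \<tau>: "\<tau> \<in> ?L"
        then have "card (\<tau> - \<rho>) = 1" using N by (simp add: card_Diff_subset)
        then obtain w where w: "\<tau> - \<rho> = {w}" by (auto simp: card_1_singleton_iff)
        then have "\<tau> = insert w \<rho>" "w \<in> N" using \<tau> by (auto simp: N_def D_def)
        then show "\<tau> \<in> ?R" using \<tau> by auto
      qed
      show "?R \<subseteq> ?L" using N by (auto simp: N_def)
    qed
    moreover have "inj_on (\<lambda>w. insert w \<rho>) {w \<in> N. insert w \<rho> \<in> D}"
      by (auto simp: inj_on_def N_def)
    ultimately have sum_D: "(\<Sum>\<tau> | \<tau> \<in> D \<and> \<rho> \<subseteq> \<tau> \<and> card \<tau> = Suc (card \<rho>). 1)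
       = (\<Sum>w | w \<in> N \<and> insert w \<rho> \<in> D. (1::bit))"
      by (simp only: sum.reindex) simp
    have "(\<Sum>\<tau>\<in>D. simplex_boundary (insert u (insert v \<tau>)) \<sigma>)
       = (\<Sum>\<tau>\<in>D. if \<rho> \<subseteq> \<tau> \<and> card \<tau> = Suc (card \<rho>) then 1 else 0)"
      unfolding both(2) using n by (intro sum.cong refl sb(4))
    also have "\<dots> = (\<Sum>w\<in>N. if insert w \<rho> \<in> D then 1 else 0)"
      using D(1) N(1) sum_D by (simp only: sum.inter_filter[symmetric])
    also have "\<dots> = (\<Sum>w\<in>N. c (insert u (insert w \<rho>)) * c (insert v (insert w \<rho>)))"
      using n' by (intro sum.cong refl) (simp only: inD)
    finally have sbd: "(\<Sum>\<tau>\<in>D. simplex_boundary (insert u (insert v \<tau>)) \<sigma>) = \<dots>" .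
    have "(\<Sum>l\<in>M. lift u v c l \<sigma>) = (\<Sum>l\<in>M. \<Sum>w\<in>N. c (insert u (insert w \<rho>)) * l (insert u (insert w \<rho>)))"
      using n by (simp add: both(2) S N_def)
    also have "\<dots> = (\<Sum>w\<in>N. c (insert u (insert w \<rho>)) * (\<Sum>l\<in>M. l (insert u (insert w \<rho>))))"
      by (subst sum.swap) (simp add: sum_distrib_left)
    also have "\<dots> = (\<Sum>w\<in>N. c (insert u (insert w \<rho>)) * (c (insert u (insert w \<rho>)) + c (insert v (insert w \<rho>))))"
      using n' by (intro sum.cong refl arg_cong2[where f = times] sum_M)
    finally have "(\<Sum>l\<in>M. lift u v c l \<sigma>) + (\<Sum>\<tau>\<in>D. simplex_boundary (insert u (insert v \<tau>)) \<sigma>)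
       = (\<Sum>w\<in>N. c (insert u (insert w \<rho>)))"
      unfolding sbd by (simp add: sum.distrib[symmetric] idem)
    then show ?thesis
      using cycleD_edge(2)[OF c uv both(1)] both(2) by (simp add: bit_add_eq_0_iff N_def)
  qed
  then show ?thesis by (simp add: D_def)
qed

end

section \<open>Infinitesimal motions in homogeneous coordinates\<close>

text \<open>
  A point of \<open>d\<close>-space is represented by a vector of \<open>d + 1\<close> homogeneous coordinates, the values at
  \<open>0, \<dots>, d\<close> of a function on the natural numbers. In these coordinates the infinitesimal isometries are
  the skew-symmetric matrices of size \<open>d + 1\<close>, a space of dimension \<open>d (d + 1) / 2\<close>, and the condition for
  an edge \<open>ab\<close> with velocities \<open>m\<close> is \<open>m a \<bullet> p b + m b \<bullet> p a = 0\<close>.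
\<close>

definition dot :: "nat \<Rightarrow> (nat \<Rightarrow> real) \<Rightarrow> (nat \<Rightarrow> real) \<Rightarrow> real" where
  "dot d x y = (\<Sum>i\<le>d. x i * y i)"

text \<open>
  Entries outside the range \<open>0, \<dots>, d\<close> are fixed to \<open>0\<close>, so that a matrix is determined as a function
  by its action.
\<close>

definition skew :: "nat \<Rightarrow> (nat \<Rightarrow> nat \<Rightarrow> real) \<Rightarrow> bool" where
  "skew d A \<longleftrightarrow> (\<forall>i j. A j i = - A i j) \<and> (\<forall>i j. d < i \<longrightarrow> A i j = 0)"

definition mat_app :: "nat \<Rightarrow> (nat \<Rightarrow> nat \<Rightarrow> real) \<Rightarrow> (nat \<Rightarrow> real) \<Rightarrow> nat \<Rightarrow> real" where
  "mat_app d A x i = (\<Sum>j\<le>d. A i j * x j)"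

definition line :: "('v \<Rightarrow> nat \<Rightarrow> real) \<Rightarrow> ('v \<Rightarrow> nat \<Rightarrow> real) \<Rightarrow> real \<Rightarrow> 'v \<Rightarrow> nat \<Rightarrow> real" where
  "line p q t v i = p v i + t * (q v i - p v i)"

lemma dot_commute: "dot d x y = dot d y x"
  by (simp add: dot_def mult.commute)

lemma dot_add: "dot d (\<lambda>i. x i + y i) z = dot d x z + dot d y z"
  and dot_diff: "dot d (\<lambda>i. x i - y i) z = dot d x z - dot d y z"
  and dot_scale: "dot d (\<lambda>i. a * x i) z = a * dot d x z"
  and dot_zero: "dot d (\<lambda>i. 0) z = 0"
  by (simp_all add: dot_def algebra_simps sum.distrib sum_subtractf sum_distrib_left)

lemma dot_cong: "(\<And>i. i \<le> d \<Longrightarrow> x i = x' i) \<Longrightarrow> (\<And>i. i \<le> d \<Longrightarrow> y i = y' i) \<Longrightarrow> dot d x y = dot d x' y'"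
  by (simp add: dot_def)

lemma dot_mat_app: "dot d (mat_app d A x) y = (\<Sum>i\<le>d. \<Sum>j\<le>d. A i j * x j * y i)"
  by (simp add: dot_def mat_app_def sum_distrib_right)

lemma skew_swap: "skew d A \<Longrightarrow> A j i = - A i j"
  unfolding skew_def by blast

lemma skew_outside: "skew d A \<Longrightarrow> d < i \<Longrightarrow> A i j = 0"
  unfolding skew_def by blast

lemma skewI: "(\<And>i j. A j i = - A i j) \<Longrightarrow> (\<And>i j. d < i \<Longrightarrow> A i j = 0) \<Longrightarrow> skew d A"
  unfolding skew_def by blast

lemma skew_dot:
  assumes "skew d A"
  shows "dot d (mat_app d A x) y = - dot d (mat_app d A y) x"
proof -
  have "dot d (mat_app d A x) y = (\<Sum>j\<le>d. \<Sum>i\<le>d. A i j * x j * y i)"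
    unfolding dot_mat_app by (rule sum.swap)
  also have "\<dots> = (\<Sum>j\<le>d. \<Sum>i\<le>d. - (A j i * y i * x j))"
    by (intro sum.cong refl) (metis skew_swap[OF assms] minus_mult_left mult_minus_left mult.assoc mult.commute)
  finally show ?thesis by (simp add: dot_mat_app sum_negf)
qed

lemma skew_dot_self: "skew d A \<Longrightarrow> dot d (mat_app d A x) x = 0"
  using skew_dot[of d A x x] by simp

lemma skew_diff: "skew d A \<Longrightarrow> skew d B \<Longrightarrow> skew d (\<lambda>i j. A i j - B i j)"
  by (rule skewI) (use skew_swap[of d A] skew_swap[of d B] in
      \<open>metis minus_diff_eq minus_diff_minus\<close>, simp add: skew_outside)

lemma mat_app_diff: "mat_app d (\<lambda>i j. A i j - B i j) x i = mat_app d A x i - mat_app d B x i"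
  by (simp add: mat_app_def algebra_simps sum_subtractf)

lemma sum_square_triangle:
  fixes g :: "nat \<Rightarrow> nat \<Rightarrow> real"
  assumes "\<And>i. g i i = 0"
  shows "(\<Sum>i\<le>d. \<Sum>j\<le>d. g i j) = (\<Sum>j\<le>d. \<Sum>i<j. g i j + g j i)"
proof (induction d)
  case (Suc d)
  have "(\<Sum>i\<le>Suc d. \<Sum>j\<le>Suc d. g i j)
    = (\<Sum>i\<le>d. \<Sum>j\<le>d. g i j) + (\<Sum>i\<le>d. g i (Suc d) + g (Suc d) i)"
    using assms by (simp add: sum.distrib)
  also have "\<dots> = (\<Sum>j\<le>Suc d. \<Sum>i<j. g i j + g j i)"
    by (simp add: Suc lessThan_Suc_atMost)
  finally show ?case .
qed (use assms in simp)

text \<open>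
  There are \<open>d (d + 1) / 2\<close> free entries of a skew-symmetric matrix and the further unknown \<open>s\<close>, which is
  one more unknown than there are equations.
\<close>

lemma skew_system:
  fixes a b :: "'j \<Rightarrow> nat \<Rightarrow> real"
  assumes "finite J" "card J \<le> d * (d + 1) div 2"
  shows "\<exists>A s. skew d A \<and> ((\<exists>i j. A i j \<noteq> 0) \<or> s \<noteq> 0) \<and>
    (\<forall>k\<in>J. dot d (mat_app d A (a k)) (b k) = s * r k)"
proof -
  define T where "T = (SIGMA j:{..d}. {..<j})"
  have T: "finite T" by (simp add: T_def)
  have "card T = (\<Sum>j\<le>d. j)" by (simp add: T_def)
  also have "\<dots> = d * (d + 1) div 2" using gauss_sum_nat[of d] by (simp add: atMost_atLeast0)
  finally have card_T: "card T = d * (d + 1) div 2" .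
  define coeff where "coeff k z =
    (case z of None \<Rightarrow> - r k | Some (j, i) \<Rightarrow> a k j * b k i - a k i * b k j)" for k z
  obtain x where x: "\<exists>z\<in>insert None (Some ` T). x z \<noteq> 0"
    "\<And>k. k \<in> J \<Longrightarrow> (\<Sum>z\<in>insert None (Some ` T). coeff k z * x z) = 0"
    using underdetermined_system_nontrivial[of J "insert None (Some ` T)" coeff] assms T card_T
    by (auto simp: card_image)
  define A where "A i j = (if i < j \<and> j \<le> d then x (Some (j, i))
      else if j < i \<and> i \<le> d then - x (Some (i, j)) else 0)" for i j
  have A: "skew d A" by (auto simp: skew_def A_def)
  have "dot d (mat_app d A (a k)) (b k) = x None * r k" if k: "k \<in> J" for k
  proof -
    have "dot d (mat_app d A (a k)) (b k) = (\<Sum>i\<le>d. \<Sum>j\<le>d. A i j * a k j * b k i)"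
      by (rule dot_mat_app)
    also have "\<dots> = (\<Sum>j\<le>d. \<Sum>i<j. A i j * a k j * b k i + A j i * a k i * b k j)"
      by (intro sum_square_triangle) (simp add: A_def)
    also have "\<dots> = (\<Sum>j\<le>d. \<Sum>i<j. coeff k (Some (j, i)) * x (Some (j, i)))"
      by (intro sum.cong) (auto simp: A_def coeff_def algebra_simps)
    also have "\<dots> = (\<Sum>z\<in>T. coeff k (Some z) * x (Some z))"
      unfolding T_def by (subst sum.Sigma) (auto simp: case_prod_unfold)
    also have "\<dots> = (\<Sum>z\<in>insert None (Some ` T). coeff k z * x z) - coeff k None * x None"
      using T by (simp add: sum.reindex)
    also have "\<dots> = x None * r k" unfolding x(2)[OF k] by (simp add: coeff_def)
    finally show ?thesis .
  qed
  moreover have "(\<exists>i j. A i j \<noteq> 0) \<or> x None \<noteq> 0"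
  proof (cases "x None = 0")
    case True
    then obtain j i where "(j, i) \<in> T" "x (Some (j, i)) \<noteq> 0" using x(1) by auto
    then have "A i j \<noteq> 0" by (auto simp: A_def T_def)
    then show ?thesis by blast
  qed simp
  ultimately show ?thesis using A by (intro exI[of _ A] exI[of _ "x None"]) auto
qed

text \<open>
  One equation is left over to force \<open>s = 0\<close> in the preceding lemma.
\<close>

lemma skew_vanishing_on_few_pairs:
  fixes a b :: "'j \<Rightarrow> nat \<Rightarrow> real"
  assumes "finite J" "card J < d * (d + 1) div 2"
  shows "\<exists>A. skew d A \<and> (\<exists>i j. A i j \<noteq> 0) \<and> (\<forall>k\<in>J. dot d (mat_app d A (a k)) (b k) = 0)"
proof -
  define ext where "ext x k = (case k of None \<Rightarrow> (\<lambda>_. 0) | Some k \<Rightarrow> x k)"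
    for x :: "'j \<Rightarrow> nat \<Rightarrow> real" and k
  have "card (insert None (Some ` J)) \<le> d * (d + 1) div 2"
    using assms by (simp add: card_image)
  moreover have "finite (insert None (Some ` J))" using assms(1) by simp
  ultimately obtain A s where A: "skew d A" "(\<exists>i j. A i j \<noteq> 0) \<or> s \<noteq> 0"
    "\<And>k. k \<in> insert None (Some ` J) \<Longrightarrow>
      dot d (mat_app d A (ext a k)) (ext b k) = s * (if k = None then 1 else 0)"
    using skew_system[of "insert None (Some ` J)" d "ext a" "ext b" "\<lambda>k. if k = None then 1 else 0"]
    by blast
  have "s = 0" using A(3)[of None] by (simp add: ext_def dot_def)
  moreover have "dot d (mat_app d A (a k)) (b k) = 0" if "k \<in> J" for k
    using A(3)[of "Some k"] that by (simp add: ext_def)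
  ultimately show ?thesis using A by auto
qed

context finite_ground
begin

definition general_position :: "nat \<Rightarrow> ('v \<Rightarrow> nat \<Rightarrow> real) \<Rightarrow> bool" where
  "general_position d p \<longleftrightarrow> (\<forall>S\<subseteq>U. card S = d + 1 \<longrightarrow>
     (\<forall>n. (\<forall>s\<in>S. dot d n (p s) = 0) \<longrightarrow> (\<forall>i\<le>d. n i = 0)))"

text \<open>
  A vertex of a chain is adjacent to itself. The edge condition for this loop says that \<open>m a\<close> is
  orthogonal to \<open>p a\<close>, which is the normalisation of velocities in homogeneous coordinates.
\<close>

definition adjacent :: "'v chain \<Rightarrow> 'v \<Rightarrow> 'v \<Rightarrow> bool" where
  "adjacent c a b \<longleftrightarrow> (\<exists>\<sigma>. c \<sigma> \<noteq> 0 \<and> a \<in> \<sigma> \<and> b \<in> \<sigma>)"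

definition motion :: "nat \<Rightarrow> 'v chain \<Rightarrow> ('v \<Rightarrow> nat \<Rightarrow> real) \<Rightarrow> ('v \<Rightarrow> nat \<Rightarrow> real) \<Rightarrow> bool" where
  "motion d c p m \<longleftrightarrow> (\<forall>a b. adjacent c a b \<longrightarrow> dot d (m a) (p b) + dot d (m b) (p a) = 0)"

definition trivial_on :: "nat \<Rightarrow> (nat \<Rightarrow> nat \<Rightarrow> real) \<Rightarrow> 'v set \<Rightarrow> ('v \<Rightarrow> nat \<Rightarrow> real)
    \<Rightarrow> ('v \<Rightarrow> nat \<Rightarrow> real) \<Rightarrow> bool" where
  "trivial_on d A W p m \<longleftrightarrow> (\<forall>w\<in>W. \<forall>i\<le>d. m w i = mat_app d A (p w) i)"

definition rigid :: "nat \<Rightarrow> 'v chain \<Rightarrow> ('v \<Rightarrow> nat \<Rightarrow> real) \<Rightarrow> bool" where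
  "rigid d c p \<longleftrightarrow> (\<forall>m. motion d c p m \<longrightarrow> (\<exists>A. skew d A \<and> trivial_on d A (chain_vertices c) p m))"

text \<open>
  Fixing the vertices of a set \<open>F\<close> removes the trivial motions, whose space varies with the placement,
  and turns rigidity into the injectivity of one linear system. Only this form can be perturbed with
  \<open>generically_injective\<close>.
\<close>

definition pinned_rigid :: "nat \<Rightarrow> 'v chain \<Rightarrow> 'v set \<Rightarrow> ('v \<Rightarrow> nat \<Rightarrow> real) \<Rightarrow> bool" where
  "pinned_rigid d c F p \<longleftrightarrow> (\<forall>m. motion d c p m \<longrightarrow> (\<forall>f\<in>F. \<forall>i\<le>d. m f i = 0) \<longrightarrow>
     (\<forall>w\<in>chain_vertices c. \<forall>i\<le>d. m w i = 0))"

lemma general_positionD: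
  assumes "general_position d p" "S \<subseteq> U" "card S = d + 1" "\<And>s. s \<in> S \<Longrightarrow> dot d n (p s) = 0" "i \<le> d"
  shows "n i = 0"
  using assms unfolding general_position_def by blast

text \<open>
  If \<open>A\<close> kills \<open>d\<close> points, then the image of a further point is orthogonal to all of these and to the point
  itself, by skew-symmetry; general position makes it \<open>0\<close>, and \<open>A\<close> vanishes on a basis.
\<close>

lemma skew_zero:
  assumes p: "general_position d p" and A: "skew d A"
    and F: "F \<subseteq> U" "card F = d" and U: "d < card U"
    and z: "\<And>f i. f \<in> F \<Longrightarrow> i \<le> d \<Longrightarrow> mat_app d A (p f) i = 0"
  shows "A i j = 0"
proof -
  have finF: "finite F" using F finite_U finite_subset by blast
  obtain e where e: "e \<in> U" "e \<notin> F" using F U by (metis less_irrefl subset_antisym subsetI)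
  define S where "S = insert e F"
  have S: "S \<subseteq> U" "card S = d + 1" using e F finF by (auto simp: S_def)
  have gp: "n i = 0" if "\<And>s. s \<in> S \<Longrightarrow> dot d n (p s) = 0" "i \<le> d" for n i
    using p S that unfolding general_position_def by blast
  have z': "dot d (mat_app d A (p f)) y = 0" if "f \<in> F" for f y
    using z[OF that] by (simp add: dot_def)
  have "mat_app d A (p e) i = 0" if "i \<le> d" for i
  proof (rule gp)
    fix s assume "s \<in> S"
    then show "dot d (mat_app d A (p e)) (p s) = 0"
      using skew_dot[OF A, of "p e" "p s"] z' skew_dot_self[OF A] by (auto simp: S_def)
  qed fact
  then have rows: "mat_app d A (p s) i = 0" if "s \<in> S" "i \<le> d" for s i
    using that z by (auto simp: S_def)
  have "A i j = 0" if "i \<le> d" "j \<le> d" for i j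
  proof (rule gp[of "A i" j])
    show "dot d (A i) (p s) = 0" if "s \<in> S" for s
      using rows[OF that \<open>i \<le> d\<close>]
      by (simp add: mat_app_def dot_def)
  qed fact
  moreover have "A i j = 0" if "d < i \<or> d < j"
    using that skew_outside[OF A] skew_swap[OF A, of i j] by auto
  ultimately show ?thesis by (meson not_le)
qed

lemma trivial_on_unique:
  assumes p: "general_position d p" and A: "skew d A" "skew d B"
    and F: "F \<subseteq> U" "card F = d" and U: "d < card U"
    and "trivial_on d A F p m" "trivial_on d B F p m"
  shows "A = B"
proof (intro ext)
  fix i j
  have "A i j - B i j = 0"
    using skew_zero[OF p skew_diff[OF A] F U, of i j] assms(7,8)
    by (simp add: mat_app_diff trivial_on_def)
  then show "A i j = B i j" by simp
qed

text \<open>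
  On a clique of \<open>d\<close> vertices every motion is trivial. Add a point \<open>e\<close> to complete the points of \<open>F\<close> to
  a basis. Prescribing the skew form on the \<open>d (d + 1) / 2\<close> pairs of basis vectors up to a common
  factor \<open>s\<close> is a system with a nonzero solution, and \<open>s \<noteq> 0\<close> because otherwise the form vanishes.
\<close>

lemma skew_extension:
  assumes p: "general_position d p" and F: "F \<subseteq> U" "card F = d" and U: "d < card U"
    and m: "\<And>f g. f \<in> F \<Longrightarrow> g \<in> F \<Longrightarrow> dot d (m f) (p g) + dot d (m g) (p f) = 0"
  shows "\<exists>A. skew d A \<and> trivial_on d A F p m"
proof -
  have finF: "finite F" using F finite_U finite_subset by blast
  obtain e where e: "e \<in> U" "e \<notin> F" using F U by (metis less_irrefl subset_antisym subsetI)
  define S where "S = insert e F"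
  have S: "S \<subseteq> U" "card S = d + 1" "finite S" using e F finF by (auto simp: S_def)
  define J where "J = {X. X \<subseteq> S \<and> card X = 2}"
  have "card J = (d + 1) choose 2" unfolding J_def using S n_subsets by metis
  then have J: "finite J" "card J \<le> d * (d + 1) div 2"
    using S by (auto simp: J_def choose_two mult.commute)
  have "\<exists>a b. X = {a, b} \<and> a \<in> F \<and> b \<in> S" if X: "X \<in> J" for X
  proof -
    obtain a b where "X = {a, b}" "a \<noteq> b" using X by (auto simp: J_def card_2_iff)
    moreover from this have "a \<in> S" "b \<in> S" using X by (auto simp: J_def)
    ultimately show ?thesis by (cases "a = e") (auto simp: S_def doubleton_eq_iff)
  qed
  then obtain a b where ab: "\<And>X. X \<in> J \<Longrightarrow> X = {a X, b X}" "\<And>X. X \<in> J \<Longrightarrow> a X \<in> F"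
    by metis
  obtain A s where A: "skew d A" "(\<exists>i j. A i j \<noteq> 0) \<or> s \<noteq> 0"
    "\<And>X. X \<in> J \<Longrightarrow> dot d (mat_app d A (p (a X))) (p (b X)) = s * dot d (m (a X)) (p (b X))"
    using skew_system[OF J, of "\<lambda>X. p (a X)" "\<lambda>X. p (b X)" "\<lambda>X. dot d (m (a X)) (p (b X))"] by blast
  have eq: "dot d (mat_app d A (p f)) (p g) = s * dot d (m f) (p g)" if f: "f \<in> F" and g: "g \<in> S" for f g
  proof (cases "f = g")
    case True
    then show ?thesis using m[of f f] f skew_dot_self[OF A(1)] by simp
  next
    case False
    then have X: "{f, g} \<in> J" using f g S by (auto simp: J_def S_def)
    have "{f, g} = {a {f, g}, b {f, g}}" using ab(1)[OF X] .
    then consider "a {f, g} = f" "b {f, g} = g" | "a {f, g} = g" "b {f, g} = f"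
      by (metis doubleton_eq_iff)
    then show ?thesis
    proof cases
      case 1
      then show ?thesis using A(3)[OF X] by simp
    next
      case 2
      then have "g \<in> F" using ab(2)[OF X] by simp
      have "dot d (mat_app d A (p g)) (p f) = s * dot d (m g) (p f)" using A(3)[OF X] 2 by simp
      moreover have "dot d (m g) (p f) = - dot d (m f) (p g)" using m[OF f \<open>g \<in> F\<close>] by simp
      ultimately show ?thesis using skew_dot[OF A(1), of "p f" "p g"] by simp
    qed
  qed
  have eq': "mat_app d A (p f) i = s * m f i" if "f \<in> F" "i \<le> d" for f i
  proof -
    have "\<forall>g\<in>S. dot d (\<lambda>i. mat_app d A (p f) i - s * m f i) (p g) = 0"
      using eq[OF that(1)] by (simp add: dot_diff dot_scale)
    then have "mat_app d A (p f) i - s * m f i = 0"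
      using p S that(2) unfolding general_position_def by blast
    then show ?thesis by simp
  qed
  have "s \<noteq> 0"
  proof
    assume "s = 0"
    then have "A i j = 0" for i j using eq' by (intro skew_zero[OF p A(1) F U]) auto
    with A(2) \<open>s = 0\<close> show False by blast
  qed
  define B where "B i j = A i j / s" for i j
  have "skew d B"
  proof (rule skewI)
    show "B j i = - B i j" for i j using skew_swap[OF A(1), of j i] by (simp add: B_def)
  qed (simp add: B_def skew_outside[OF A(1)])
  have "mat_app d B x i = mat_app d A x i / s" for x i
    by (simp add: mat_app_def B_def sum_divide_distrib)
  then have "trivial_on d B F p m"
    using \<open>s \<noteq> 0\<close> by (simp add: trivial_on_def eq')
  with \<open>skew d B\<close> show ?thesis by blast
qed

lemma motion_trivial:
  assumes "skew d A" shows "motion d c p (\<lambda>v. mat_app d A (p v))"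
  unfolding motion_def
proof (intro allI impI)
  show "dot d (mat_app d A (p a)) (p b) + dot d (mat_app d A (p b)) (p a) = 0" for a b
    using skew_dot[OF assms, of "p a" "p b"] by simp
qed

lemma motion_diff:
  assumes "motion d c p m" "motion d c p m'"
  shows "motion d c p (\<lambda>v i. m v i - m' v i)"
  unfolding motion_def dot_diff
proof (intro allI impI)
  fix a b assume "adjacent c a b"
  then have "dot d (m a) (p b) + dot d (m b) (p a) = 0" "dot d (m' a) (p b) + dot d (m' b) (p a) = 0"
    using assms by (auto simp: motion_def)
  then show "dot d (m a) (p b) - dot d (m' a) (p b) + (dot d (m b) (p a) - dot d (m' b) (p a)) = 0"
    by linarith
qed

lemma adjacent_facet: "c F \<noteq> 0 \<Longrightarrow> f \<in> F \<Longrightarrow> g \<in> F \<Longrightarrow> adjacent c f g"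
  by (auto simp: adjacent_def)

text \<open>
  A motion agrees on the clique \<open>F\<close> with a unique trivial motion, which can be subtracted.
\<close>

lemma rigid_iff_pinned_rigid:
  assumes p: "general_position d p" and c: "cycle d c" "c F \<noteq> 0" and U: "d < card U"
  shows "rigid d c p \<longleftrightarrow> pinned_rigid d c F p"
proof
  note F = cycle_subset[OF c] cycle_card[OF c]
  have FV: "F \<subseteq> chain_vertices c" using c by (auto simp: chain_vertices_def)
  assume r: "rigid d c p"
  show "pinned_rigid d c F p"
    unfolding pinned_rigid_def
  proof (intro allI impI)
    fix m assume m: "motion d c p m" "\<forall>f\<in>F. \<forall>i\<le>d. m f i = 0"
    then obtain A where A: "skew d A" "trivial_on d A (chain_vertices c) p m"
      using r by (auto simp: rigid_def)
    have "mat_app d A (p f) i = 0" if "f \<in> F" "i \<le> d" for f i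
      using A(2) m(2) FV that unfolding trivial_on_def by (metis subsetD)
    then have "A i j = 0" for i j
      by (rule skew_zero[OF p A(1) F U])
    then show "\<forall>w\<in>chain_vertices c. \<forall>i\<le>d. m w i = 0"
      using A(2) by (simp add: trivial_on_def mat_app_def)
  qed
next
  note F = cycle_subset[OF c] cycle_card[OF c]
  assume r: "pinned_rigid d c F p"
  show "rigid d c p"
    unfolding rigid_def
  proof (intro allI impI)
    fix m assume m: "motion d c p m"
    then obtain A where A: "skew d A" "trivial_on d A F p m"
      using skew_extension[OF p F U, of m] adjacent_facet[of c F] c(2) by (auto simp: motion_def)
    then have "\<forall>w\<in>chain_vertices c. \<forall>i\<le>d. m w i - mat_app d A (p w) i = 0"
      using r motion_diff[OF m motion_trivial[OF A(1)]]
      unfolding pinned_rigid_def trivial_on_def by auto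
    then show "\<exists>A. skew d A \<and> trivial_on d A (chain_vertices c) p m"
      using A(1) by (auto simp: trivial_on_def)
  qed
qed

end

section \<open>Generic placements\<close>

text \<open>
  A substitute for Zariski openness that needs no polynomials in several variables: a property that
  holds at one point of a line fails at only finitely many points of that line. Nonempty sets of this
  kind have common points, by joining a point of one to a point of the other.
\<close>

definition line_open :: "(('v \<Rightarrow> nat \<Rightarrow> real) \<Rightarrow> bool) \<Rightarrow> bool" where
  "line_open Q \<longleftrightarrow> (\<forall>p q. Q p \<longrightarrow> finite {t. \<not> Q (line p q t)})"

lemma line_open_conj:
  assumes "line_open P" "line_open Q" shows "line_open (\<lambda>p. P p \<and> Q p)"
  unfolding line_open_def
proof (intro allI impI)
  fix p q assume "P p \<and> Q p"
  then have "finite ({t. \<not> P (line p q t)} \<union> {t. \<not> Q (line p q t)})"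
    using assms by (auto simp: line_open_def)
  then show "finite {t. \<not> (P (line p q t) \<and> Q (line p q t))}"
    by (rule finite_subset[rotated]) auto
qed

lemma line_reverse: "line p q t = line q p (1 - t)"
  by (auto simp: line_def algebra_simps fun_eq_iff)

lemma line_open_meet:
  assumes "line_open P" "line_open Q" "P p" "Q q"
  shows "\<exists>r. P r \<and> Q r"
proof -
  have "finite {t. \<not> P (line p q t)}" using assms by (auto simp: line_open_def)
  moreover have "finite {t. \<not> Q (line q p t)}" using assms by (auto simp: line_open_def)
  then have "finite ((\<lambda>t. 1 - t) ` {t. \<not> Q (line q p t)})" by blast
  ultimately have "finite ({t. \<not> P (line p q t)} \<union> (\<lambda>t. 1 - t) ` {t. \<not> Q (line q p t)})" by blast
  then obtain t where t: "t \<notin> {t. \<not> P (line p q t)} \<union> (\<lambda>t. 1 - t) ` {t. \<not> Q (line q p t)}"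
    using ex_new_if_finite[OF infinite_UNIV_char_0] by blast
  then have "Q (line q p (1 - t))"
    by (metis (mono_tags, lifting) UnI2 diff_diff_eq2 add_diff_cancel_left' image_eqI mem_Collect_eq)
  then show ?thesis using t line_reverse by (metis (mono_tags, lifting) UnI1 mem_Collect_eq)
qed

lemma line_open_common:
  assumes "finite J" "\<And>j. j \<in> J \<Longrightarrow> line_open (Q j)" "\<And>j. j \<in> J \<Longrightarrow> \<exists>p. Q j p"
  shows "\<exists>p. \<forall>j\<in>J. Q j p"
proof -
  have "line_open (\<lambda>p. \<forall>j\<in>J. Q j p) \<and> (\<exists>p. \<forall>j\<in>J. Q j p)"
    using assms
  proof (induction J rule: finite_induct)
    case empty
    show ?case by (simp add: line_open_def)
  next
    case (insert j J)
    then have J: "line_open (\<lambda>p. \<forall>j\<in>J. Q j p)" "\<exists>p. \<forall>j\<in>J. Q j p" by auto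
    have "line_open (Q j)" "\<exists>p. Q j p" using insert.prems by auto
    then show ?case
      using line_open_conj[OF _ J(1), of "Q j"] line_open_meet[OF _ J(1), of "Q j"] J(2) by auto
  qed
  then show ?thesis by blast
qed

lemma poly_linear_dot_left:
  assumes "finite I" "\<And>i. i \<le> d \<Longrightarrow> k i \<in> I" "\<And>i. poly_function (\<lambda>t. f t i)"
  shows "poly_linear I (\<lambda>t x. dot d (\<lambda>i. x (k i)) (f t))"
  unfolding dot_def
proof (rule poly_linear_sum)
  show "poly_linear I (\<lambda>t x. x (k i) * f t i)" if "i \<in> {..d}" for i
    using poly_linear_component[of I "k i" "\<lambda>t. f t i"] assms that by (simp add: mult.commute)
qed simp

lemma poly_function_line [intro!]: "poly_function (\<lambda>t. line p q t v i)"
  unfolding line_def by auto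

lemma line_0 [simp]: "line p q 0 = p"
  by (auto simp: line_def fun_eq_iff)

context finite_ground
begin

lemma line_open_general_position: "line_open (general_position d)"
  unfolding line_open_def
proof (intro allI impI)
  fix p q assume p: "general_position d p"
  define Ss where "Ss = {S. S \<subseteq> U \<and> card S = d + 1}"
  have Ss: "finite Ss" using finite_U by (simp add: Ss_def)
  have "finite {t. \<exists>x. (\<forall>l\<in>(\<lambda>s t x. dot d x (line p q t s)) ` S. l t x = 0) \<and> (\<exists>i\<in>{..d}. x i \<noteq> 0)}"
    if S: "S \<in> Ss" for S
  proof (rule generically_injective[where ?t0.0 = 0])
    show "poly_linear {..d} l" if l_in: "l \<in> (\<lambda>s t x. dot d x (line p q t s)) ` S" for l
    proof -
      obtain s where l: "l = (\<lambda>t x. dot d x (line p q t s))" using l_in by (rule imageE)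
      show ?thesis unfolding l by (rule poly_linear_dot_left[of "{..d}" d "\<lambda>i. i"]) auto
    qed
    show "\<forall>i\<in>{..d}. x i = 0"
      if "\<And>l. l \<in> (\<lambda>s t x. dot d x (line p q t s)) ` S \<Longrightarrow> l 0 x = 0" for x
    proof -
      have "\<forall>s\<in>S. dot d x (p s) = 0" using that by force
      then show ?thesis using p S by (auto simp: general_position_def Ss_def)
    qed
  qed simp
  then have "finite (\<Union>S\<in>Ss. {t. \<exists>x. (\<forall>l\<in>(\<lambda>s t x. dot d x (line p q t s)) ` S. l t x = 0) \<and> (\<exists>i\<in>{..d}. x i \<noteq> 0)})"
    using Ss by blast
  then show "finite {t. \<not> general_position d (line p q t)}"
    by (rule finite_subset[rotated]) (auto simp: general_position_def Ss_def)
qed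

text \<open>
  Points on the moment curve: a linear form vanishing on \<open>d + 1\<close> of them is a polynomial of degree at
  most \<open>d\<close> with too many roots.
\<close>

lemma general_position_exists: "\<exists>p. general_position d p"
proof -
  obtain g :: "'v \<Rightarrow> nat" where g: "inj_on g U"
    using finite_U finite_imp_inj_to_nat_seg by blast
  define p where "p v i = real (g v) ^ i" for v i
  have "n i = 0" if S: "S \<subseteq> U" "card S = d + 1" and n: "\<forall>s\<in>S. dot d n (p s) = 0" and i: "i \<le> d"
    for S n i
  proof (rule ccontr)
    assume "n i \<noteq> 0"
    then have fin: "finite {z. (\<Sum>i\<le>d. n i * z ^ i) = 0}" "card {z. (\<Sum>i\<le>d. n i * z ^ i) = 0} \<le> d"
      using i polyfun_rootbound[where c = n and n = d] by auto
    have "inj_on (\<lambda>s. real (g s)) S"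
      using g S by (auto simp: inj_on_def)
    then have "d + 1 = card ((\<lambda>s. real (g s)) ` S)"
      using S by (simp add: card_image)
    also have "\<dots> \<le> card {z. (\<Sum>i\<le>d. n i * z ^ i) = 0}"
      using n by (intro card_mono fin) (auto simp: dot_def p_def)
    finally show False using fin by simp
  qed
  then show ?thesis by (intro exI[of _ p]) (auto simp: general_position_def)
qed

lemma line_open_pinned_rigid:
  assumes c: "cycle d c" "c F \<noteq> 0"
  shows "line_open (pinned_rigid d c F)"
  unfolding line_open_def
proof (intro allI impI)
  fix p q assume p: "pinned_rigid d c F p"
  define I where "I = chain_vertices c \<times> {..d}"
  have I: "finite I" using finite_chain_vertices[OF c(1)] by (simp add: I_def)
  define pin where "pin = (\<lambda>(f, i) (t::real) (x::'v \<times> nat \<Rightarrow> real). x (f, i))"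
  define edge where "edge = (\<lambda>(a, b) (t::real) x.
    dot d (\<lambda>i. x (a, i)) (line p q t b) + dot d (\<lambda>i. x (b, i)) (line p q t a))"
  define L where "L = pin ` (F \<times> {..d}) \<union> edge ` {(a, b). adjacent c a b}"
  have FI: "F \<times> {..d} \<subseteq> I" using c by (auto simp: I_def chain_vertices_def)
  have adjI: "a \<in> chain_vertices c" "b \<in> chain_vertices c" if "adjacent c a b" for a b
    using that by (auto simp: adjacent_def chain_vertices_def)
  have L: "(\<forall>l\<in>L. l t x = 0) \<longleftrightarrow>
      motion d c (line p q t) (\<lambda>v i. x (v, i)) \<and> (\<forall>f\<in>F. \<forall>i\<le>d. x (f, i) = 0)" for t x
    by (auto simp: L_def pin_def edge_def motion_def ball_Un)
  have "finite {t. \<exists>x. (\<forall>l\<in>L. l t x = 0) \<and> (\<exists>i\<in>I. x i \<noteq> 0)}"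
  proof (rule generically_injective[where ?t0.0 = 0, OF I])
    fix l assume "l \<in> L"
    then consider f i where "f \<in> F" "i \<le> d" "l = (\<lambda>t x. x (f, i))"
      | a b where "adjacent c a b" "l = edge (a, b)"
      by (auto simp: L_def pin_def)
    then show "poly_linear I l"
    proof cases
      case 1
      then show ?thesis using poly_linear_component[OF I, of "(f, i)" "\<lambda>_. 1"] FI by auto
    next
      case 2
      have "(a, i) \<in> I" "(b, i) \<in> I" if "i \<le> d" for i
        using that adjI[OF 2(1)] by (auto simp: I_def)
      then show ?thesis unfolding 2(2) edge_def prod.case
        using I by (intro poly_linear_add poly_linear_dot_left) auto
    qed
  next
    fix x assume "\<And>l. l \<in> L \<Longrightarrow> l 0 x = 0"
    then have "motion d c p (\<lambda>v i. x (v, i))" "\<forall>f\<in>F. \<forall>i\<le>d. x (f, i) = 0"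
      using L[of 0 x] by simp_all
    then show "\<forall>i\<in>I. x i = 0" using p unfolding pinned_rigid_def I_def by auto
  qed
  moreover have "{t. \<not> pinned_rigid d c F (line p q t)} \<subseteq> {t. \<exists>x. (\<forall>l\<in>L. l t x = 0) \<and> (\<exists>i\<in>I. x i \<noteq> 0)}"
  proof
    fix t assume "t \<in> {t. \<not> pinned_rigid d c F (line p q t)}"
    then obtain m w i where m: "motion d c (line p q t) m" "\<forall>f\<in>F. \<forall>i\<le>d. m f i = 0"
      "w \<in> chain_vertices c" "i \<le> d" "m w i \<noteq> 0"
      by (auto simp: pinned_rigid_def)
    then have "(\<forall>l\<in>L. l t (case_prod m) = 0) \<and> (\<exists>i\<in>I. case_prod m i \<noteq> 0)"
      unfolding L I_def by auto
    then show "t \<in> {t. \<exists>x. (\<forall>l\<in>L. l t x = 0) \<and> (\<exists>i\<in>I. x i \<noteq> 0)}" by blast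
  qed
  ultimately show "finite {t. \<not> pinned_rigid d c F (line p q t)}"
    by (rule rev_finite_subset)
qed

definition generically_rigid :: "nat \<Rightarrow> 'v chain \<Rightarrow> bool" where
  "generically_rigid d c \<longleftrightarrow> (\<exists>p. general_position d p \<and> rigid d c p)"

lemma line_open_rigid:
  assumes "cycle d c" "c F \<noteq> 0" "d < card U"
  shows "line_open (\<lambda>p. general_position d p \<and> rigid d c p)"
proof -
  have "(\<lambda>p. general_position d p \<and> rigid d c p) = (\<lambda>p. general_position d p \<and> pinned_rigid d c F p)"
    using rigid_iff_pinned_rigid assms by blast
  then show ?thesis
    using line_open_conj[OF line_open_general_position line_open_pinned_rigid[OF assms(1,2)]] by simp
qed

lemma generically_rigidI_pinned:
  assumes "cycle d c" "c F \<noteq> 0" "d < card U" "pinned_rigid d c F p"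
  shows "generically_rigid d c"
proof -
  obtain q where "general_position d q" using general_position_exists by blast
  then obtain r where "general_position d r" "pinned_rigid d c F r"
    using line_open_meet[OF line_open_general_position line_open_pinned_rigid[OF assms(1,2)]] assms(4)
    by blast
  then show ?thesis
    using rigid_iff_pinned_rigid[OF _ assms(1-3)] by (auto simp: generically_rigid_def)
qed

end

section \<open>Minimal cycles are generically rigid\<close>

context finite_ground
begin

lemma lift_vertices:
  assumes l: "subchain l (contraction u v c)" and c: "cycle k c" and uv: "u \<in> U" "v \<in> U" "u \<noteq> v"
  shows "chain_vertices (lift u v c l) \<subseteq> insert v (chain_vertices l)"
proof
  fix x assume "x \<in> chain_vertices (lift u v c l)"
  then obtain \<sigma> where \<sigma>: "lift u v c l \<sigma> \<noteq> 0" "x \<in> \<sigma>" by (auto simp: chain_vertices_def)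
  note N = lift_nonzero[OF l c uv \<sigma>(1)]
  show "x \<in> insert v (chain_vertices l)"
  proof (cases "v \<in> \<sigma>")
    case False
    then have "l \<sigma> \<noteq> 0" using \<sigma>(1) by (cases "l \<sigma>") (auto simp: lift_def split: if_splits)
    then show ?thesis using \<sigma>(2) by (auto simp: chain_vertices_def)
  next
    case v: True
    show ?thesis
    proof (cases "u \<in> \<sigma>")
      case False
      then have "l (insert u (\<sigma> - {v})) \<noteq> 0"
        using \<sigma>(1) v by (cases "l (insert u (\<sigma> - {v}))") (auto simp: lift_def)
      then show ?thesis using \<sigma>(2) by (auto simp: chain_vertices_def)
    next
      case True
      then obtain \<rho> w where "\<sigma> = insert u (insert v \<rho>)" "l (insert u (insert w \<rho>)) \<noteq> 0"
        using v N by auto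
      then show ?thesis using \<sigma>(2) by (auto simp: chain_vertices_def)
    qed
  qed
qed

text \<open>
  An edge of \<open>l\<close> is an edge of its lift, unless it ends in \<open>u\<close> and comes from an edge of the lift that
  ends in \<open>v\<close>. In the limit where \<open>v\<close> is placed at \<open>u\<close>, both impose the same condition.
\<close>

lemma lift_adjacent_of_contracted:
  assumes l: "subchain l (contraction u v c)" and uv: "u \<noteq> v"
    and ab: "adjacent l a b"
  shows "a \<noteq> v \<and> b \<noteq> v \<and> (adjacent (lift u v c l) a b
    \<or> a = u \<and> b \<noteq> u \<and> adjacent (lift u v c l) v b
    \<or> b = u \<and> a \<noteq> u \<and> adjacent (lift u v c l) v a
    \<or> a = u \<and> b = u)"
proof -
  obtain \<tau> where \<tau>: "l \<tau> \<noteq> 0" "a \<in> \<tau>" "b \<in> \<tau>" using ab by (auto simp: adjacent_def)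
  have con: "contraction u v c \<tau> \<noteq> 0" using l \<tau>(1) by (simp add: subchain_def)
  then have v: "v \<notin> \<tau>" by (auto simp: contraction_def)
  then have "a \<noteq> v" "b \<noteq> v" using \<tau> by auto
  show ?thesis
  proof (cases "lift u v c l \<tau> = 0")
    case False
    then show ?thesis using \<tau> \<open>a \<noteq> v\<close> \<open>b \<noteq> v\<close> by (auto simp: adjacent_def)
  next
    case True
    then have u: "u \<in> \<tau>" "c \<tau> = 0" using \<tau>(1) v
      by (auto simp: lift_def split: if_splits)
    have "c (insert v (\<tau> - {u})) \<noteq> 0"
      using con u v by (simp add: contraction_def)
    moreover have "insert u (\<tau> - {u}) = \<tau>" using u by auto
    ultimately have "lift u v c l (insert v (\<tau> - {u})) \<noteq> 0"
      using lift_simps(3)[OF uv, of "\<tau> - {u}" c l] v \<tau>(1) by simp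
    then show ?thesis using \<tau> \<open>a \<noteq> v\<close> \<open>b \<noteq> v\<close> by (auto simp: adjacent_def)
  qed
qed

text \<open>
  Whiteley's vertex splitting, for the reversal of the contraction of \<open>v\<close> to \<open>u\<close>. Start from a generic
  placement \<open>p\<close> for which \<open>l\<close> is rigid and place \<open>v\<close> at \<open>p u + t p v\<close>, close to \<open>u\<close>. In terms of
  the difference quotient \<open>n = (m v - m u) / t\<close>, the conditions on a motion \<open>m\<close> are equivalent for
  \<open>t \<noteq> 0\<close> to a system that also makes sense for \<open>t = 0\<close>. At \<open>t = 0\<close> it says that \<open>m\<close> is a motion of
  \<open>l\<close>, hence \<open>0\<close> once it is pinned, and then that \<open>n\<close> is orthogonal to the points of \<open>u\<close>, \<open>v\<close> and of all
  common neighbours. There are at least \<open>d - 1\<close> of the latter, so \<open>n = 0\<close>. Injectivity at \<open>t = 0\<close> gives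
  injectivity at some \<open>t \<noteq> 0\<close>.
\<close>

lemma vertex_splitting:
  assumes d: "3 \<le> d" "d < card U" and c: "cycle d c" and uv: "u \<in> U" "v \<in> U" "u \<noteq> v"
    and l: "cycle d l" "subchain l (contraction u v c)" "generically_rigid d l"
    and \<sigma>0: "lift u v c l \<sigma>0 \<noteq> 0" "u \<in> \<sigma>0" "v \<in> \<sigma>0"
  shows "generically_rigid d (lift u v c l)"
proof -
  define c' where "c' = lift u v c l"
  have c': "cycle d c'" unfolding c'_def using cycle_lift[OF l(1,2) c uv] .
  obtain p where p: "general_position d p" "rigid d l p"
    using l(3) by (auto simp: generically_rigid_def)
  obtain \<rho> w0 where \<rho>: "\<rho> \<subseteq> U - {u, v}" "w0 \<in> U - {u, v} - \<rho>" "\<sigma>0 = insert u (insert v \<rho>)"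
    "c (insert u (insert w0 \<rho>)) \<noteq> 0" "l (insert u (insert w0 \<rho>)) \<noteq> 0"
    using lift_nonzero[OF l(2) c uv \<sigma>0(1)] \<sigma>0 by auto
  define F where "F = insert u (insert w0 \<rho>)"
  have F: "u \<in> F" "v \<notin> F" "l F \<noteq> 0" "c' F \<noteq> 0"
    using \<rho> uv by (auto simp: F_def c'_def lift_def)
  define V where "V = chain_vertices c'"
  have V: "V \<subseteq> insert v (chain_vertices l)" "finite V"
    unfolding V_def c'_def using lift_vertices[OF l(2) c uv] finite_chain_vertices c' c'_def by auto
  have uvV: "u \<in> V" "v \<in> V" and adj_uv: "adjacent c' u v" "adjacent c' v u" "adjacent c' u u" "adjacent c' v v"
    using \<sigma>0 by (auto simp: V_def chain_vertices_def adjacent_def c'_def)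
  have adjV: "a \<in> V" "b \<in> V" if "adjacent c' a b" for a b
    using that by (auto simp: V_def chain_vertices_def adjacent_def)
  have adj_sym: "adjacent c' b a" if "adjacent c' a b" for a b
    using that by (auto simp: adjacent_def)
  define W where "W = {w. w \<noteq> u \<and> w \<noteq> v \<and> adjacent c' v w}"
  define X where "X = {w \<in> W. adjacent c' u w}"
  \<comment> \<open>Adjacent facets at \<open>uv\<close>, namely \<open>\<sigma>0\<close> and its neighbour opposite to a vertex \<open>y\<close> of \<open>\<rho>\<close>, give
    \<open>d - 1\<close> common neighbours. It is \<open>d \<ge> 3\<close> that makes \<open>\<rho>\<close> nonempty.\<close>
  obtain S where S: "S \<subseteq> X" "card S = d - 1"
  proof -
    have fin: "finite \<rho>" using \<rho>(1) finite_U finite_subset by blast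
    have "u \<notin> \<rho>" "v \<notin> \<rho>" using \<rho> by auto
    have "card \<sigma>0 = d" using cycle_card[OF c'] \<sigma>0(1) by (simp add: c'_def)
    then have card: "card \<rho> = d - 2"
      using fin \<open>u \<notin> \<rho>\<close> \<open>v \<notin> \<rho>\<close> uv by (simp add: \<rho>(3))
    then obtain y where y: "y \<in> \<rho>" using d by fastforce
    obtain w' where w': "w' \<in> U - \<sigma>0" "c' (insert w' (\<sigma>0 - {y})) \<noteq> 0"
      using cycle_adjacent_facet[OF c', of \<sigma>0 y] \<sigma>0(1) y \<rho>(3) by (auto simp: c'_def)
    have uvy: "u \<in> insert w' (\<sigma>0 - {y})" "v \<in> insert w' (\<sigma>0 - {y})"
      using y \<open>u \<notin> \<rho>\<close> \<open>v \<notin> \<rho>\<close> \<sigma>0 by auto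
    have "insert w' \<rho> \<subseteq> X"
    proof
      fix x assume x: "x \<in> insert w' \<rho>"
      have "adjacent c' u x \<and> adjacent c' v x"
      proof (cases "x = w'")
        case True
        then show ?thesis using w'(2) uvy adjacent_facet[of c' "insert w' (\<sigma>0 - {y})"] by auto
      next
        case False
        then show ?thesis using x \<rho>(3) \<sigma>0 adjacent_facet[of c' \<sigma>0] by (auto simp: c'_def)
      qed
      then show "x \<in> X" using x w'(1) \<rho>(3) \<open>u \<notin> \<rho>\<close> \<open>v \<notin> \<rho>\<close> by (auto simp: X_def W_def)
    qed
    moreover have "card (insert w' \<rho>) = d - 1"
      using w' fin card d by (simp add: \<rho>(3))
    ultimately show thesis using that by blast
  qed
  define I where "I = V \<times> {..d}"
  have I: "finite I" using V by (simp add: I_def)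
  have inI: "(a, i) \<in> I" if "a \<in> V" "i \<le> d" for a i using that by (simp add: I_def)
  define pin where "pin = (\<lambda>(f, i) (t::real) (x::'v \<times> nat \<Rightarrow> real). x (f, i))"
  define edge where "edge = (\<lambda>(a, b) (t::real) (x::'v \<times> nat \<Rightarrow> real).
    dot d (\<lambda>i. x (a, i)) (p b) + dot d (\<lambda>i. x (b, i)) (p a))"
  define self where "self = (\<lambda>(t::real) (x::'v \<times> nat \<Rightarrow> real). dot d (\<lambda>i. x (v, i)) (p v))"
  define half where "half = (\<lambda>w (t::real) (x::'v \<times> nat \<Rightarrow> real).
    dot d (\<lambda>i. x (u, i)) (p w) + dot d (\<lambda>i. x (w, i)) (p u)
    + (dot d (\<lambda>i. x (v, i)) (\<lambda>i. t * p w i) + dot d (\<lambda>i. x (w, i)) (\<lambda>i. t * p v i)))"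
  \<comment> \<open>The component of \<open>x\<close> at \<open>v\<close> stands for the difference quotient \<open>n\<close>. Modulo the loop
    at \<open>u\<close>, the conditions of the edge \<open>uv\<close> and of the loop at \<open>v\<close> become \<open>edge (v, u)\<close> and \<open>self\<close>
    after division by \<open>t\<close> and its square. For a neighbour \<open>w\<close>
    of \<open>v\<close>, \<open>half w\<close> is the condition of the edge \<open>vw\<close>; if \<open>w\<close> is also a neighbour of \<open>u\<close>, its
    difference with the condition of \<open>uw\<close>, divided by \<open>t\<close>, is \<open>edge (v, w)\<close>.\<close>
  define L where "L = pin ` (F \<times> {..d}) \<union> edge ` {(a, b). adjacent c' a b \<and> a \<noteq> v \<and> b \<noteq> v}
    \<union> {edge (v, u), self} \<union> edge ` {(v, w) | w. w \<in> X} \<union> half ` W"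
  have const: "poly_function (\<lambda>t. t * r)" "poly_function (\<lambda>t. r)" for r by auto
  have XV: "w \<in> V" if "w \<in> W" for w using that adjV by (auto simp: W_def)
  have FV: "f \<in> V" if "f \<in> F" for f using that F by (auto simp: V_def chain_vertices_def)
  have poly_edge: "poly_linear I (edge (a, b))" if "a \<in> V" "b \<in> V" for a b
    unfolding edge_def prod.case using I that inI const
    by (intro poly_linear_add poly_linear_dot_left) auto
  have poly_L: "poly_linear I k" if k: "k \<in> L" for k
  proof -
    consider f i where "f \<in> F" "i \<le> d" "k = pin (f, i)" | a b where "k = edge (a, b)" "a \<in> V" "b \<in> V"
      | "k = self" | w where "w \<in> W" "k = half w"
      using k adjV uvV XV by (auto simp: L_def X_def)
    then show ?thesis
    proof cases
      case 1
      then show ?thesis using poly_linear_component[OF I inI[OF FV[OF 1(1)] 1(2)], of "\<lambda>_. 1"]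
        by (auto simp: pin_def)
    next
      case 2
      then show ?thesis using poly_edge by simp
    next
      case 3
      then show ?thesis unfolding self_def using I uvV inI const by (auto intro!: poly_linear_dot_left)
    next
      case 4
      then show ?thesis unfolding 4(2) half_def using I uvV inI const XV
        by (intro poly_linear_add poly_linear_dot_left) auto
    qed
  qed
  have inj: "\<forall>i\<in>I. x i = 0" if x0: "\<And>k. k \<in> L \<Longrightarrow> k 0 x = 0" for x
  proof -
    define m where "m w i = x (w, i)" for w i
    have pinned: "m f i = 0" if "f \<in> F" "i \<le> d" for f i
    proof -
      have "pin (f, i) \<in> L" using that by (auto simp: L_def)
      from x0[OF this] show ?thesis by (simp add: pin_def m_def)
    qed
    have edge0: "dot d (m a) (p b) + dot d (m b) (p a) = 0" if "adjacent c' a b" "a \<noteq> v" "b \<noteq> v" for a b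
    proof -
      have "edge (a, b) \<in> L" using that by (auto simp: L_def)
      from x0[OF this] show ?thesis by (simp add: edge_def m_def[abs_def])
    qed
    have half0: "dot d (m u) (p w) + dot d (m w) (p u) = 0" if "w \<in> W" for w
    proof -
      have "half w \<in> L" using that by (auto simp: L_def)
      from x0[OF this] show ?thesis by (simp add: half_def m_def[abs_def]) (simp add: dot_def)
    qed
    have "motion d l p m"
      unfolding motion_def
    proof (intro allI impI)
      fix a b assume ab: "adjacent l a b"
      have "a \<noteq> v" "b \<noteq> v" and "adjacent c' a b \<or> a = u \<and> b \<noteq> u \<and> adjacent c' v b
        \<or> b = u \<and> a \<noteq> u \<and> adjacent c' v a \<or> a = u \<and> b = u"
        using lift_adjacent_of_contracted[OF l(2) uv(3) ab] by (auto simp: c'_def)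
      then show "dot d (m a) (p b) + dot d (m b) (p a) = 0"
        using edge0[of a b] half0[of b] half0[of a] edge0[of u u] adj_uv uv
        by (auto simp: W_def add.commute)
    qed
    then obtain A where A: "skew d A" "trivial_on d A (chain_vertices l) p m"
      using p(2) by (auto simp: rigid_def)
    have "mat_app d A (p f) i = 0" if "f \<in> F" "i \<le> d" for f i
    proof -
      have "f \<in> chain_vertices l" using that F by (auto simp: chain_vertices_def)
      then show ?thesis using A(2) pinned[OF that] that by (simp add: trivial_on_def)
    qed
    then have "A i j = 0" for i j
      by (rule skew_zero[OF p(1) A(1) cycle_subset[OF l(1) F(3)] cycle_card[OF l(1) F(3)] d(2)])
    then have m0: "m w i = 0" if "w \<in> chain_vertices l" "i \<le> d" for w i
      using A(2) that by (simp add: trivial_on_def mat_app_def)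
    have m0V: "m w i = 0" if "w \<in> V" "w \<noteq> v" "i \<le> d" for w i
      using m0 that V by blast
    then have dot0: "dot d (m w) y = 0" if "w \<in> V" "w \<noteq> v" for w y
      using that by (simp add: dot_def)
    have "m v i = 0" if "i \<le> d" for i
    proof -
      have "u \<notin> S" "v \<notin> S" using S by (auto simp: X_def W_def)
      moreover have "finite S" using S d by (intro card_ge_0_finite) simp
      ultimately have "card (insert u (insert v S)) = d + 1"
        using S uv d by simp
      moreover have "insert u (insert v S) \<subseteq> U"
        using S XV uv chain_vertices_subset[OF c'] by (auto simp: X_def V_def)
      moreover have "dot d (m v) (p s) = 0" if s: "s \<in> insert u (insert v S)" for s
      proof -
        consider "s = u" | "s = v" | "s \<in> X" using s S by auto
        then show ?thesis
        proof cases
          case 1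
          have "edge (v, u) \<in> L" by (simp add: L_def)
          from x0[OF this] show ?thesis using dot0[OF uvV(1) uv(3), of "p v"]
            by (simp add: 1 edge_def m_def[abs_def])
        next
          case 2
          have "self \<in> L" by (simp add: L_def)
          from x0[OF this] show ?thesis by (simp add: 2 self_def m_def[abs_def])
        next
          case 3
          then have "edge (v, s) \<in> L" by (auto simp: L_def)
          moreover have "s \<in> V" "s \<noteq> v" using 3 XV by (auto simp: X_def W_def)
          ultimately show ?thesis using x0[of "edge (v, s)"] dot0[of s "p v"]
            by (simp add: edge_def m_def[abs_def])
        qed
      qed
      ultimately show ?thesis using p(1) that unfolding general_position_def by blast
    qed
    then show ?thesis using m0V by (auto simp: I_def m_def)
  qed
  define bad where "bad = {t. \<exists>x. (\<forall>k\<in>L. k t x = 0) \<and> (\<exists>i\<in>I. x i \<noteq> 0)}"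
  have "finite bad"
    unfolding bad_def by (rule generically_injective[OF I poly_L inj])
  then have "finite (insert 0 bad)" by simp
  then obtain t where t: "t \<noteq> 0" "t \<notin> bad"
    using ex_new_if_finite[OF infinite_UNIV_char_0, of "insert 0 bad"] by blast
  define q where "q = p(v := (\<lambda>i. p u i + t * p v i))"
  have "pinned_rigid d c' F q"
    unfolding pinned_rigid_def
  proof (intro allI impI)
    fix m assume m: "motion d c' q m" "\<forall>f\<in>F. \<forall>i\<le>d. m f i = 0"
    define n where "n i = (m v i - m u i) / t" for i
    have mv: "dot d (m v) y = dot d (m u) y + t * dot d n y" for y
    proof -
      have "m v = (\<lambda>i. m u i + t * n i)" using t by (auto simp: n_def)
      then show ?thesis by (simp add: dot_add dot_scale)
    qed
    have qv: "dot d y (q v) = dot d y (p u) + t * dot d y (p v)" for y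
      by (simp add: q_def dot_add dot_scale dot_commute[of d y])
    have q: "q w = p w" if "w \<noteq> v" for w using that by (simp add: q_def)
    have mE: "dot d (m a) (q b) + dot d (m b) (q a) = 0" if "adjacent c' a b" for a b
      using m(1) that by (simp add: motion_def)
    have uu: "dot d (m u) (p u) = 0" using mE[OF adj_uv(3)] q uv by simp
    have E1: "dot d (m u) (p v) + dot d n (p u) = 0"
    proof -
      have "t * (dot d (m u) (p v) + dot d n (p u)) = 0"
        using mE[OF adj_uv(1)] uu q uv by (simp add: mv qv algebra_simps)
      then show ?thesis using t by simp
    qed
    have E2: "dot d n (p v) = 0"
    proof -
      have "dot d (m v) (q v) = 0" using mE[OF adj_uv(4)] by simp
      then have "t * (dot d (m u) (p v) + dot d n (p u)) + t * t * dot d n (p v) = 0"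
        using uu by (simp add: mv qv algebra_simps)
      then show ?thesis using E1 t by simp
    qed
    have E4: "dot d (m u) (p w) + dot d (m w) (p u) + t * (dot d n (p w) + dot d (m w) (p v)) = 0"
      if "w \<in> W" for w
    proof -
      have w: "w \<noteq> v" "adjacent c' v w" using that by (auto simp: W_def)
      then show ?thesis using mE[OF w(2)] q[OF w(1)] by (simp add: mv qv algebra_simps)
    qed
    have E3: "dot d n (p w) + dot d (m w) (p v) = 0" if "w \<in> X" for w
    proof -
      have "adjacent c' u w" "w \<noteq> v" using that by (auto simp: X_def W_def)
      then have "dot d (m u) (p w) + dot d (m w) (p u) = 0"
        using mE[of u w] q uv by simp
      then have "t * (dot d n (p w) + dot d (m w) (p v)) = 0"
        using E4[of w] that by (simp add: X_def)
      then show ?thesis using t by simp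
    qed
    define x where "x = (\<lambda>(w, i). if w = v then n i else m w i)"
    have xv: "(\<lambda>i. x (v, i)) = n" and xw: "(\<lambda>i. x (w, i)) = m w" if "w \<noteq> v" for w
      using that by (auto simp: x_def)
    have "k t x = 0" if k: "k \<in> L" for k
    proof -
      consider f i where "f \<in> F" "i \<le> d" "k = pin (f, i)"
        | a b where "k = edge (a, b)" "adjacent c' a b" "a \<noteq> v" "b \<noteq> v"
        | "k = edge (v, u)" | "k = self" | w where "w \<in> X" "k = edge (v, w)" | w where "w \<in> W" "k = half w"
        using k by (auto simp: L_def)
      then show ?thesis
      proof cases
        case 1
        then show ?thesis using m(2) F(2) by (auto simp: pin_def x_def)
      next
        case 2
        then show ?thesis using mE[OF 2(2)] q xw by (simp add: edge_def)
      next
        case 3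
        then show ?thesis using E1 xv[of u] xw[of u] uv by (simp add: edge_def)
      next
        case 4
        then show ?thesis using E2 xv[of u] uv by (simp add: self_def)
      next
        case 5
        then have "w \<noteq> v" by (auto simp: X_def W_def)
        then show ?thesis using E3[OF 5(1)] xv[of w] xw[of w] by (simp add: 5(2) edge_def)
      next
        case 6
        then have "w \<noteq> v" by (auto simp: W_def)
        have sc: "dot d y (\<lambda>i. t * z i) = t * dot d y z" for y z
          by (simp add: dot_commute[of d y] dot_scale)
        show ?thesis using E4[OF 6(1)] xv[of w] xw[of w] xw[of u] uv \<open>w \<noteq> v\<close>
          by (simp add: 6(2) half_def sc algebra_simps)
      qed
    qed
    then have x0: "x (w, i) = 0" if "w \<in> V" "i \<le> d" for w i
      using t(2) inI[OF that] unfolding bad_def by blast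
    have mw: "m w i = 0" if "w \<in> V" "w \<noteq> v" "i \<le> d" for w i
      using x0[OF that(1,3)] that by (simp add: x_def)
    have "m v i = 0" if "i \<le> d" for i
      using x0[OF uvV(2) that] mw[OF uvV(1) uv(3) that] t by (simp add: x_def n_def)
    then show "\<forall>w\<in>chain_vertices c'. \<forall>i\<le>d. m w i = 0"
      using mw V_def by metis
  qed
  then show ?thesis using generically_rigidI_pinned[OF c' F(4) d(2)] by (simp add: c'_def)
qed

lemma cycle_simplex_boundary:
  assumes "S \<subseteq> U" "card S = d + 1"
  shows "cycle d (simplex_boundary S)"
  unfolding cycle_def
proof (intro conjI allI impI)
  show "\<sigma> \<subseteq> U" "card \<sigma> = d" if "simplex_boundary S \<sigma> \<noteq> 0" for \<sigma>
    using that assms by (auto simp: simplex_boundary_def split: if_splits)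
  fix \<rho> assume \<rho>: "\<rho> \<subseteq> U"
  have fin: "finite S" "finite \<rho>" using \<rho> assms(1) finite_U finite_subset by blast+
  show "boundary (simplex_boundary S) \<rho> = 0"
  proof (cases "\<rho> \<subseteq> S \<and> card \<rho> + 2 = card S")
    case True
    have "boundary (simplex_boundary S) \<rho> = (\<Sum>w\<in>S - \<rho>. simplex_boundary S (insert w \<rho>))"
      unfolding boundary_def using finite_U assms(1)
      by (intro sum.mono_neutral_right) (auto simp: simplex_boundary_def)
    also have "\<dots> = (\<Sum>w\<in>S - \<rho>. 1)"
      using True fin by (intro sum.cong) (auto simp: simplex_boundary_def)
    also have "\<dots> = of_nat (card S - card \<rho>)"
      using True fin by (simp add: card_Diff_subset)
    also have "card S - card \<rho> = 2" using True by arith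
    finally show ?thesis by simp
  next
    case False
    then have "simplex_boundary S (insert w \<rho>) = 0" if "w \<in> U - \<rho>" for w
      using that fin by (auto simp: simplex_boundary_def)
    then show ?thesis by (simp add: boundary_def)
  qed
qed

text \<open>
  The graph is complete on \<open>d + 1\<close> vertices: the motion is trivial on \<open>d\<close> of them, and the edge
  conditions determine the velocity of the last one.
\<close>

lemma rigid_simplex_boundary:
  assumes p: "general_position d p" and d: "2 \<le> d" "d < card U" and S: "S \<subseteq> U" "card S = d + 1"
  shows "rigid d (simplex_boundary S) p"
  unfolding rigid_def
proof (intro allI impI)
  have fin: "finite S" using S finite_U finite_subset by blast
  fix m assume m: "motion d (simplex_boundary S) p m"
  have adj: "adjacent (simplex_boundary S) a b" if "a \<in> S" "b \<in> S" for a b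
  proof -
    have "card {a, b} < card S" using S d by (cases "a = b") auto
    then obtain e where "e \<in> S" "e \<notin> {a, b}"
      by (metis card_mono finite.emptyI finite.insertI not_le subsetI)
    then have "simplex_boundary S (S - {e}) \<noteq> 0" "a \<in> S - {e}" "b \<in> S - {e}"
      using that S fin by (auto simp: simplex_boundary_def card_Suc_Diff1)
    then show ?thesis using adjacent_facet by metis
  qed
  have mE: "dot d (m a) (p b) + dot d (m b) (p a) = 0" if "a \<in> S" "b \<in> S" for a b
    using m adj[OF that] by (simp add: motion_def)
  obtain e where e: "e \<in> S" using S by fastforce
  define F where "F = S - {e}"
  have F: "F \<subseteq> U" "card F = d" using S e fin by (auto simp: F_def)
  obtain A where A: "skew d A" "trivial_on d A F p m"
    using skew_extension[OF p F d(2), of m] mE by (auto simp: F_def)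
  have dotA: "dot d (m f) y = dot d (mat_app d A (p f)) y" if "f \<in> F" for f y
    using A(2) that by (intro dot_cong) (auto simp: trivial_on_def)
  have "dot d (\<lambda>i. m e i - mat_app d A (p e) i) (p s) = 0" if s: "s \<in> S" for s
  proof (cases "s = e")
    case True
    then show ?thesis using mE[OF e e] skew_dot_self[OF A(1)] by (simp add: dot_diff)
  next
    case False
    then have "s \<in> F" using s by (simp add: F_def)
    then show ?thesis
      using mE[OF e s] dotA[of s "p e"] skew_dot[OF A(1), of "p e" "p s"] by (simp add: dot_diff)
  qed
  then have "m e i = mat_app d A (p e) i" if "i \<le> d" for i
    using general_positionD[OF p S _ that, of "\<lambda>i. m e i - mat_app d A (p e) i"] by simp
  then have "trivial_on d A S p m"
    using A(2) by (auto simp: trivial_on_def F_def)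
  moreover have "chain_vertices (simplex_boundary S) \<subseteq> S"
    by (auto simp: chain_vertices_def simplex_boundary_def split: if_splits)
  ultimately show "\<exists>A. skew d A \<and> trivial_on d A (chain_vertices (simplex_boundary S)) p m"
    using A(1) unfolding trivial_on_def by blast
qed

text \<open>
  Fogelsanger's gluing argument. Every summand carries the matrix of the trivial motion that it
  undergoes. Two summands with a common facet have the same matrix, since \<open>d\<close> points in general
  position determine it. Hence the sum \<open>Z\<close> of the summands with one given matrix has no facet in common
  with the sum \<open>W\<close> of the others, and \<open>Z\<close> is a subcycle of \<open>c\<close>.
\<close>

lemma rigid_of_decomposition:
  assumes c: "minimal_cycle d c" and p: "general_position d p" and U: "d < card U" and J: "finite J"
    and x: "\<And>j. j \<in> J \<Longrightarrow> cycle d (x j)" "\<And>j. j \<in> J \<Longrightarrow> rigid d (x j) p"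
      "\<And>j a b. j \<in> J \<Longrightarrow> adjacent (x j) a b \<Longrightarrow> adjacent c a b"
    and sum: "\<And>\<sigma>. \<sigma> \<subseteq> U \<Longrightarrow> c \<sigma> = (\<Sum>j\<in>J. x j \<sigma>)"
  shows "rigid d c p"
  unfolding rigid_def
proof (intro allI impI)
  fix m assume m: "motion d c p m"
  have cyc: "cycle d c" using c by (simp add: minimal_cycle_def)
  have "\<exists>A. skew d A \<and> trivial_on d A (chain_vertices (x j)) p m" if "j \<in> J" for j
    using x(2,3)[OF that] m unfolding rigid_def motion_def by blast
  then obtain A where A: "\<And>j. j \<in> J \<Longrightarrow> skew d (A j)"
    "\<And>j. j \<in> J \<Longrightarrow> trivial_on d (A j) (chain_vertices (x j)) p m" by metis
  have triv: "trivial_on d (A j) \<sigma> p m" if "j \<in> J" "x j \<sigma> \<noteq> 0" for j \<sigma>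
    using A(2)[OF that(1)] that(2) by (auto simp: trivial_on_def chain_vertices_def)
  have same: "A i = A j" if "i \<in> J" "j \<in> J" "x i \<sigma> \<noteq> 0" "x j \<sigma> \<noteq> 0" for i j \<sigma>
    by (rule trivial_on_unique[OF p A(1)[OF that(1)] A(1)[OF that(2)]
          cycle_subset[OF x(1)[OF that(1)] that(3)] cycle_card[OF x(1)[OF that(1)] that(3)] U
          triv[OF that(1,3)] triv[OF that(2,4)]])
  obtain \<sigma>0 where \<sigma>0: "c \<sigma>0 \<noteq> 0" using c by (auto simp: minimal_cycle_def)
  then have "(\<Sum>j\<in>J. x j \<sigma>0) \<noteq> 0" using sum cycle_subset[OF cyc \<sigma>0] by simp
  then obtain j0 where j0: "j0 \<in> J" "x j0 \<sigma>0 \<noteq> 0" by (meson sum.neutral)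
  define Jin where "Jin = {j \<in> J. A j = A j0}"
  define Z where "Z \<sigma> = (\<Sum>j\<in>Jin. x j \<sigma>)" for \<sigma>
  define W where "W \<sigma> = (\<Sum>j\<in>J - Jin. x j \<sigma>)" for \<sigma>
  have Z: "cycle d Z" unfolding Z_def using J x(1) by (intro cycle_sum) (auto simp: Jin_def)
  have ZW: "c \<sigma> = W \<sigma> + Z \<sigma>" if "\<sigma> \<subseteq> U" for \<sigma>
    unfolding sum[OF that] Z_def W_def using J by (intro sum.subset_diff) (auto simp: Jin_def)
  have disj: "W \<sigma> = 0" if "Z \<sigma> \<noteq> 0 \<or> \<sigma> = \<sigma>0" for \<sigma>
  proof -
    obtain i where i: "i \<in> Jin" "x i \<sigma> \<noteq> 0"
    proof (cases "\<sigma> = \<sigma>0")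
      case True
      then show thesis using that j0 by (auto simp: Jin_def)
    next
      case False
      then have "Z \<sigma> \<noteq> 0" using \<open>Z \<sigma> \<noteq> 0 \<or> \<sigma> = \<sigma>0\<close> by blast
      then show thesis using that unfolding Z_def by (meson sum.neutral)
    qed
    have "x j \<sigma> = 0" if j: "j \<in> J - Jin" for j
      using same[of i j \<sigma>] i j by (auto simp: Jin_def)
    then show ?thesis by (simp add: W_def)
  qed
  have "subchain Z c"
    using disj ZW cycle_subset[OF Z] by (auto simp: subchain_def)
  moreover have "Z \<sigma>0 \<noteq> 0" using disj[of \<sigma>0] ZW[OF cycle_subset[OF cyc \<sigma>0]] \<sigma>0 by simp
  ultimately have "Z = c" using c Z by (auto simp: minimal_cycle_def)
  have "trivial_on d (A j0) \<sigma> p m" if "c \<sigma> \<noteq> 0" for \<sigma>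
  proof -
    have "(\<Sum>j\<in>Jin. x j \<sigma>) \<noteq> 0" using that \<open>Z = c\<close> Z_def by metis
    then obtain j where "j \<in> Jin" "x j \<sigma> \<noteq> 0" by (meson sum.neutral)
    then show ?thesis using triv[of j \<sigma>] by (simp add: Jin_def)
  qed
  then have "trivial_on d (A j0) (chain_vertices c) p m"
    by (auto simp: trivial_on_def chain_vertices_def)
  then show "\<exists>A. skew d A \<and> trivial_on d A (chain_vertices c) p m"
    using A(1)[OF j0(1)] by blast
qed

lemma contraction_vertices:
  assumes "u \<in> chain_vertices c" "u \<noteq> v"
  shows "chain_vertices (contraction u v c) \<subseteq> chain_vertices c - {v}"
proof
  fix x assume "x \<in> chain_vertices (contraction u v c)"
  then obtain \<sigma> where \<sigma>: "contraction u v c \<sigma> \<noteq> 0" "x \<in> \<sigma>" by (auto simp: chain_vertices_def)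
  then have v: "v \<notin> \<sigma>" by (auto simp: contraction_def)
  have "c \<sigma> \<noteq> 0 \<or> u \<in> \<sigma> \<and> c (insert v (\<sigma> - {u})) \<noteq> 0"
    using \<sigma> v by (auto simp: contraction_def split: if_splits)
  then show "x \<in> chain_vertices c - {v}"
    using \<sigma> v assms by (auto simp: chain_vertices_def)
qed

text \<open>
  The simplices \<open>\<rho>uv\<close> added by the lift bring no new edges: the cycle condition provides facets of \<open>c\<close>
  containing \<open>\<rho>u\<close> and \<open>\<rho>v\<close>.
\<close>

lemma lift_adjacent:
  assumes l: "cycle k l" "subchain l (contraction u v c)" and c: "cycle k c"
    and uv: "u \<in> U" "v \<in> U" "u \<noteq> v" "adjacent c u v"
    and ab: "adjacent (lift u v c l) a b"
  shows "adjacent c a b"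
proof -
  obtain \<sigma> where \<sigma>: "lift u v c l \<sigma> \<noteq> 0" "a \<in> \<sigma>" "b \<in> \<sigma>"
    using ab by (auto simp: adjacent_def)
  note N = lift_nonzero[OF l(2) c uv(1-3)]
  show ?thesis
  proof (cases "u \<in> \<sigma> \<and> v \<in> \<sigma>")
    case False
    then show ?thesis using N[OF \<sigma>(1)] \<sigma> by (auto simp: adjacent_def)
  next
    case True
    then obtain \<rho> w where \<rho>: "\<rho> \<subseteq> U - {u, v}" "\<sigma> = insert u (insert v \<rho>)" "c (insert u (insert w \<rho>)) \<noteq> 0"
      using N[OF \<sigma>(1)] by auto
    obtain w' where w': "w' \<in> U - \<sigma>" "lift u v c l (insert w' (\<sigma> - {u})) \<noteq> 0"
      using cycle_adjacent_facet[OF cycle_lift[OF l c uv(1-3)] \<sigma>(1), of u] True by blast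
    have "u \<notin> insert w' (\<sigma> - {u})" using w' True by auto
    then have c2: "c (insert w' (\<sigma> - {u})) \<noteq> 0" using N[OF w'(2)] by auto
    have "a = u \<and> b = v \<or> a = v \<and> b = u \<or> a \<in> insert u \<rho> \<and> b \<in> insert u \<rho>
       \<or> a \<in> \<sigma> - {u} \<and> b \<in> \<sigma> - {u}"
      using \<sigma> \<rho> by auto
    then show ?thesis
      using uv(4) \<rho>(3) c2 unfolding adjacent_def by blast
  qed
qed

lemma simplex_boundary_adjacent:
  assumes uv: "adjacent c u v" and \<tau>: "c (insert u \<tau>) \<noteq> 0" "c (insert v \<tau>) \<noteq> 0"
    and ab: "adjacent (simplex_boundary (insert u (insert v \<tau>))) a b"
  shows "adjacent c a b"
proof -
  have "a \<in> insert u (insert v \<tau>)" "b \<in> insert u (insert v \<tau>)"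
    using ab by (auto simp: adjacent_def simplex_boundary_def split: if_splits)
  then have "a = u \<and> b = v \<or> a = v \<and> b = u \<or> a \<in> insert u \<tau> \<and> b \<in> insert u \<tau>
       \<or> a \<in> insert v \<tau> \<and> b \<in> insert v \<tau>" by auto
  then show ?thesis
    using uv \<tau> unfolding adjacent_def by blast
qed

text \<open>
  Induction on the number of vertices. The induction hypothesis applies to the minimal cycles of
  which the contraction is composed; a cycle that is itself the boundary of a simplex contracts to
  \<open>0\<close>, so there is no separate base case.
\<close>

theorem minimal_cycle_generically_rigid:
  assumes "minimal_cycle d c" "3 \<le> d"
  shows "generically_rigid d c"
  using assms(1)
proof (induction "card (chain_vertices c)" arbitrary: c rule: less_induct)
  case less
  have c: "cycle d c" using less.prems by (simp add: minimal_cycle_def)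
  obtain \<sigma>0 where \<sigma>0: "c \<sigma>0 \<noteq> 0" using less.prems by (auto simp: minimal_cycle_def)
  have "d < card (chain_vertices c)" using card_chain_vertices[OF c \<sigma>0] assms(2) by simp
  also have "\<dots> \<le> card U" by (rule card_mono[OF finite_U chain_vertices_subset[OF c]])
  finally have U: "d < card U" .
  have "2 \<le> card \<sigma>0" using cycle_card[OF c \<sigma>0] assms(2) by simp
  then obtain u v where uv\<sigma>: "u \<in> \<sigma>0" "v \<in> \<sigma>0" and "u \<noteq> v"
    by (metis card_2_iff' card_le_Suc0_iff_eq finite_U cycle_subset[OF c \<sigma>0] finite_subset
        not_less_eq_eq numeral_2_eq_2)
  then have uv: "u \<in> U" "v \<in> U" "u \<noteq> v" using cycle_subset[OF c \<sigma>0] by auto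
  have adj: "adjacent c u v" using uv\<sigma> \<sigma>0 by (auto simp: adjacent_def)
  obtain M where M: "finite M" "\<And>l. l \<in> M \<Longrightarrow> minimal_cycle d l"
    "\<And>l. l \<in> M \<Longrightarrow> subchain l (contraction u v c)"
    "\<And>\<sigma>. contraction u v c \<sigma> = (\<Sum>l\<in>M. l \<sigma>)"
    using minimal_cycle_decomposition[OF cycle_contraction[OF c uv]] by blast
  have Mc: "cycle d l" if "l \<in> M" for l using M(2)[OF that] by (simp add: minimal_cycle_def)
  define D where "D = {\<tau>. \<tau> \<subseteq> U - {u, v} \<and> c (insert u \<tau>) \<noteq> 0 \<and> c (insert v \<tau>) \<noteq> 0}"
  have D: "finite D" using finite_U by (auto simp: D_def intro: finite_subset[of _ "Pow U"])
  have DS: "insert u (insert v \<tau>) \<subseteq> U \<and> card (insert u (insert v \<tau>)) = d + 1" if "\<tau> \<in> D" for \<tau>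
  proof -
    have "finite \<tau>" "u \<notin> \<tau>" "v \<notin> \<tau>" using that finite_U finite_subset by (auto simp: D_def)
    moreover have "card (insert v \<tau>) = d" using cycle_card[OF c] that by (simp add: D_def)
    ultimately show ?thesis using that uv by (auto simp: D_def)
  qed
  \<comment> \<open>A lift without a facet containing \<open>uv\<close> is a subcycle of \<open>c\<close>, hence all of \<open>c\<close>, but \<open>c\<close> has such a
    facet.\<close>
  have lift_edge: "\<exists>\<sigma>. lift u v c l \<sigma> \<noteq> 0 \<and> u \<in> \<sigma> \<and> v \<in> \<sigma>" if l: "l \<in> M" for l
  proof (rule ccontr)
    assume no: "\<not> ?thesis"
    have sub: "subchain (lift u v c l) c"
      unfolding subchain_def
    proof (intro allI impI)
      fix \<sigma> assume s: "lift u v c l \<sigma> \<noteq> 0"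
      then have "\<not> (u \<in> \<sigma> \<and> v \<in> \<sigma>)" using no by blast
      then show "c \<sigma> \<noteq> 0" using lift_nonzero[OF M(3)[OF l] c uv s] by auto
    qed
    obtain \<tau> where "l \<tau> \<noteq> 0" using M(2)[OF l] by (auto simp: minimal_cycle_def)
    then have ll: "adjacent l a b" if "a \<in> \<tau>" "b \<in> \<tau>" for a b
      using that by (auto simp: adjacent_def)
    have "\<tau> \<noteq> {}" using cycle_card[OF Mc[OF l] \<open>l \<tau> \<noteq> 0\<close>] assms(2) by auto
    have "card \<tau> = d" using cycle_card[OF Mc[OF l] \<open>l \<tau> \<noteq> 0\<close>] .
    then have "\<tau> \<noteq> {u}" using assms(2) by auto
    then obtain a where "a \<in> \<tau>" "a \<noteq> u" using \<open>\<tau> \<noteq> {}\<close> by blast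
    then obtain x y where "adjacent (lift u v c l) x y"
      using lift_adjacent_of_contracted[OF M(3)[OF l] uv(3) ll, of a a] by auto
    then have "\<exists>\<sigma>. lift u v c l \<sigma> \<noteq> 0" by (auto simp: adjacent_def)
    then have "lift u v c l = c"
      using less.prems sub cycle_lift[OF Mc[OF l] M(3)[OF l] c uv] by (auto simp: minimal_cycle_def)
    then show False using no \<sigma>0 uv\<sigma> by auto
  qed
  have lift_rigid: "generically_rigid d (lift u v c l)" if l: "l \<in> M" for l
  proof -
    have "chain_vertices l \<subseteq> chain_vertices (contraction u v c)"
      using M(3)[OF l] by (auto simp: subchain_def chain_vertices_def)
    also have "\<dots> \<subseteq> chain_vertices c - {v}"
      using \<sigma>0 uv\<sigma> uv by (intro contraction_vertices) (auto simp: chain_vertices_def)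
    finally have "chain_vertices l \<subseteq> chain_vertices c - {v}" .
    moreover have "v \<in> chain_vertices c"
      using \<sigma>0 uv\<sigma> by (auto simp: chain_vertices_def)
    ultimately have "chain_vertices l \<subset> chain_vertices c" by blast
    then have rl: "generically_rigid d l"
      using less.hyps[OF _ M(2)[OF l]] psubset_card_mono finite_chain_vertices[OF c] by blast
    show ?thesis
      using vertex_splitting[OF assms(2) U c uv Mc[OF l] M(3)[OF l] rl] lift_edge[OF l] by blast
  qed
  have "\<exists>p. \<forall>Q\<in>insert (general_position d) ((\<lambda>l p. general_position d p \<and> rigid d (lift u v c l) p) ` M). Q p"
  proof (rule line_open_common[where Q = "\<lambda>Q. Q"])
    fix Q assume "Q \<in> insert (general_position d) ((\<lambda>l p. general_position d p \<and> rigid d (lift u v c l) p) ` M)"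
    then consider "Q = general_position d"
      | l where "l \<in> M" "Q = (\<lambda>p. general_position d p \<and> rigid d (lift u v c l) p)" by blast
    then have "line_open Q \<and> (\<exists>p. Q p)"
    proof cases
      case 1
      then show ?thesis using line_open_general_position general_position_exists by blast
    next
      case 2
      have cl: "cycle d (lift u v c l)" using cycle_lift[OF Mc M(3) c uv] 2 by blast
      obtain F where "lift u v c l F \<noteq> 0" using lift_edge[OF 2(1)] by blast
      then show ?thesis
        using line_open_rigid[OF cl _ U] lift_rigid[OF 2(1)] 2(2) by (simp add: generically_rigid_def)
    qed
    then show "line_open Q" "\<exists>p. Q p" by auto
  qed (use M(1) in simp)
  then obtain p where p: "general_position d p" "\<And>l. l \<in> M \<Longrightarrow> rigid d (lift u v c l) p" by auto
  define x where "x = case_sum (lift u v c) (\<lambda>\<tau>. simplex_boundary (insert u (insert v \<tau>)))"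
  have "rigid d c p"
  proof (rule rigid_of_decomposition[OF less.prems p(1) U, where J = "M <+> D" and x = x])
    show "finite (M <+> D)" using M(1) D by simp
    fix j assume "j \<in> M <+> D"
    then consider l where "l \<in> M" "x j = lift u v c l"
      | \<tau> where "\<tau> \<in> D" "x j = simplex_boundary (insert u (insert v \<tau>))"
      by (auto simp: x_def)
    then have "cycle d (x j) \<and> rigid d (x j) p \<and> (\<forall>a b. adjacent (x j) a b \<longrightarrow> adjacent c a b)"
    proof cases
      case 1
      then show ?thesis
        using cycle_lift[OF Mc M(3) c uv] p(2) lift_adjacent[OF Mc M(3) c uv adj] by metis
    next
      case 2
      note S = DS[OF 2(1)]
      have "adjacent c a b" if "adjacent (simplex_boundary (insert u (insert v \<tau>))) a b" for a b
        using simplex_boundary_adjacent[OF adj _ _ that] 2(1) by (simp add: D_def)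
      then show ?thesis
        using cycle_simplex_boundary rigid_simplex_boundary[OF p(1) _ U] S 2(2) assms(2) by auto
    qed
    then show "cycle d (x j)" "rigid d (x j) p" "\<And>a b. adjacent (x j) a b \<Longrightarrow> adjacent c a b" by auto
  next
    fix \<sigma> assume "\<sigma> \<subseteq> U"
    then show "c \<sigma> = (\<Sum>j\<in>M <+> D. x j \<sigma>)"
      using edge_decomposition[OF c uv M(1,4)] M(1) D by (simp add: sum.Plus x_def D_def)
  qed
  then show ?case using p(1) by (auto simp: generically_rigid_def)
qed

end

section \<open>The boundary complex of a simplicial polytope\<close>

text \<open>
  Join a point outside one of the affine sets to a point outside all the others. Each of the sets
  contains at most one point of this segment.
\<close>

lemma finite_affine_cover:
  fixes C :: "'a::euclidean_space set"
  assumes "finite \<A>" "convex C" "C \<noteq> {}" "\<And>A. A \<in> \<A> \<Longrightarrow> affine A \<and> \<not> C \<subseteq> A"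
  shows "\<exists>x\<in>C. \<forall>A\<in>\<A>. x \<notin> A"
  using assms(1,4)
proof (induction \<A> rule: finite_induct)
  case empty
  then show ?case using assms(3) by auto
next
  case (insert A \<A>)
  then obtain x where x: "x \<in> C" "\<And>B. B \<in> \<A> \<Longrightarrow> x \<notin> B" by auto
  obtain y where y: "y \<in> C" "y \<notin> A" using insert.prems by blast
  define g where "g t = x + t *\<^sub>R (y - x)" for t :: real
  have g_mix: "(1 - k) *\<^sub>R g s + k *\<^sub>R g t = g (s + k * (t - s))" for k s t
    by (simp add: g_def algebra_simps)
  define T where "T B = {t \<in> {0..1}. g t \<in> B}" for B
  have "finite (T B)" if B: "B \<in> insert A \<A>" for B
  proof -
    have "s = t" if "s \<in> T B" "t \<in> T B" for s t
    proof (rule ccontr)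
      assume "s \<noteq> t"
      have aff: "affine B" using insert.prems B by blast
      have on_line: "g r \<in> B" for r
      proof -
        have "(1 - (r - s) / (t - s)) *\<^sub>R g s + ((r - s) / (t - s)) *\<^sub>R g t \<in> B"
          using that aff unfolding affine_alt T_def by blast
        moreover have "s + (r - s) / (t - s) * (t - s) = r" using \<open>s \<noteq> t\<close> by simp
        ultimately show ?thesis by (simp only: g_mix)
      qed
      have "x \<in> B" "y \<in> B" using on_line[of 0] on_line[of 1] by (auto simp: g_def)
      then show False using x(2) y(2) B by auto
    qed
    then have "T B \<subseteq> {s}" if "s \<in> T B" for s using that by blast
    then show ?thesis by (metis finite.emptyI finite.insertI finite_subset subsetI)
  qed
  then have "finite (\<Union>(T ` insert A \<A>))" using insert.hyps by blast
  moreover have "infinite {0..1::real}" by simp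
  ultimately obtain t where t: "t \<in> {0..1}" "t \<notin> \<Union>(T ` insert A \<A>)"
    by (meson finite_subset subsetI)
  have "g t = (1 - t) *\<^sub>R x + t *\<^sub>R y" by (simp add: g_def algebra_simps)
  then have "g t \<in> C" using t(1) x(1) y(1) assms(2) by (simp add: convex_alt)
  moreover have "\<forall>B\<in>insert A \<A>. g t \<notin> B" using t by (auto simp: T_def)
  ultimately show ?case by blast
qed

locale simplicial_d_polytope =
  fixes P :: "'a::euclidean_space set" and d :: nat
  assumes d: "2 \<le> d" and simplicial: "simplicial_polytope P" and dim: "aff_dim P = int d"
begin

definition facets :: "'a set set" where
  "facets = {\<sigma>. \<sigma> \<subseteq> polytope_vertices P \<and> (convex hull \<sigma>) facet_of P}"

lemma polytope: "polytope P" and polyhedron: "polyhedron P" and convex: "convex P"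
  using simplicial polytope_imp_polyhedron polytope_imp_convex
  by (auto simp: simplicial_polytope_def)

lemma finite_vertices: "finite (polytope_vertices P)"
  using finite_polytope_vertices[OF polytope] .

lemma vertices_subset: "polytope_vertices P \<subseteq> P"
  by (auto simp: polytope_vertices_eq[OF polytope] extreme_point_of_def)

lemma facet_vertices:
  assumes "F facet_of P"
  obtains \<sigma> where "\<sigma> \<in> facets" "F = convex hull \<sigma>" "\<not> affine_dependent \<sigma>" "card \<sigma> = d"
    "polytope_vertices P \<inter> F = \<sigma>"
proof -
  have face: "F face_of P" using facet_of_imp_face_of[OF assms] .
  have "F exposed_face_of P" "F \<noteq> P"
    using face exposed_face_of_polyhedron[OF polyhedron] facet_of_irrefl assms by auto
  then obtain n where n: "n simplex F" using simplicial by (auto simp: simplicial_polytope_def)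
  then obtain C where C: "\<not> affine_dependent C" "int (card C) = n + 1" "F = convex hull C"
    by (auto simp: simplex)
  have "aff_dim F = int d - 1" using assms dim by (simp add: facet_of_def)
  then have "card C = d" using aff_dim_simplex[OF n] C(2) d by simp
  have "polytope_vertices P \<inter> F = {v. v extreme_point_of F}"
    using extreme_point_of_face[OF face] by (auto simp: polytope_vertices_eq[OF polytope])
  also have "\<dots> = C" unfolding C(3) using extreme_point_of_convex_hull_affine_independent[OF C(1)] by auto
  finally have "polytope_vertices P \<inter> F = C" .
  then show thesis using that[of C] C \<open>card C = d\<close> assms by (auto simp: facets_def)
qed

lemma facetsD:
  assumes "\<sigma> \<in> facets"
  shows "\<sigma> \<subseteq> polytope_vertices P" "convex hull \<sigma> facet_of P" "\<not> affine_dependent \<sigma>" "card \<sigma> = d"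
    "polytope_vertices P \<inter> convex hull \<sigma> = \<sigma>"
proof -
  show sub: "\<sigma> \<subseteq> polytope_vertices P" and f: "convex hull \<sigma> facet_of P"
    using assms by (auto simp: facets_def)
  obtain \<tau> where \<tau>: "convex hull \<sigma> = convex hull \<tau>" "\<not> affine_dependent \<tau>" "card \<tau> = d"
    "polytope_vertices P \<inter> convex hull \<sigma> = \<tau>"
    using facet_vertices[OF f] by metis
  have "\<sigma> \<subseteq> \<tau>" using \<tau>(4) sub hull_subset[of \<sigma> convex] by blast
  moreover have "x \<in> \<sigma>" if "x \<in> \<tau>" for x
  proof -
    have "x extreme_point_of (convex hull \<sigma>)"
      using that \<tau>(1,2) by (simp add: extreme_point_of_convex_hull_affine_independent)
    then show ?thesis by (rule extreme_point_of_convex_hull)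
  qed
  ultimately have "\<sigma> = \<tau>" by blast
  then show "\<not> affine_dependent \<sigma>" "card \<sigma> = d" "polytope_vertices P \<inter> convex hull \<sigma> = \<sigma>"
    using \<tau> by auto
qed

lemma facets_finite: "\<sigma> \<in> facets \<Longrightarrow> finite \<sigma>"
  using facetsD(1) finite_vertices finite_subset by blast

lemma face_of_facet:
  assumes "\<sigma> \<in> facets" "\<rho> \<subseteq> \<sigma>"
  shows "convex hull \<rho> face_of P"
proof (rule face_of_trans)
  show "convex hull \<rho> face_of convex hull \<sigma>"
    unfolding face_of_convex_hull_affine_independent[OF facetsD(3)[OF assms(1)]] using assms(2) by blast
  show "convex hull \<sigma> face_of P" using facetsD(2)[OF assms(1)] by (rule facet_of_imp_face_of)
qed

lemma facet_height:
  assumes "\<sigma> \<in> facets"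
  obtains a b where "\<And>x. x \<in> P \<Longrightarrow> a \<bullet> x \<le> b" "\<And>x. x \<in> P \<Longrightarrow> a \<bullet> x = b \<longleftrightarrow> x \<in> convex hull \<sigma>"
proof -
  obtain a b where "P \<subseteq> {x. a \<bullet> x \<le> b}" "convex hull \<sigma> = P \<inter> {x. a \<bullet> x = b}"
    using facet_of_polyhedron[OF polyhedron facetsD(2)[OF assms]] by metis
  then show thesis using that[of a b] by auto
qed

lemma facet_edge:
  assumes "\<sigma> \<in> facets" "x \<in> \<sigma>" "y \<in> \<sigma>" "x \<noteq> y"
  shows "{x, y} \<in> polytope_edges P"
  using face_of_facet[OF assms(1), of "{x, y}"] assms
  by (auto simp: polytope_edges_eq[OF polytope] segment_convex_hull)

lemma vertex_in_facet:
  assumes "v \<in> polytope_vertices P"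
  obtains \<sigma> where "\<sigma> \<in> facets" "v \<in> \<sigma>"
proof -
  have "{v} face_of P" using assms by (simp add: polytope_vertices_eq[OF polytope] face_of_singleton)
  moreover have "{v} \<noteq> P" using dim d by auto
  ultimately obtain F where F: "F facet_of P" "v \<in> F"
    using face_of_polyhedron_subset_facet[OF polyhedron, of "{v}"] by auto
  then show thesis using facet_vertices[OF F(1)] assms that by (metis IntI)
qed

text \<open>
  A face is the intersection of the facets containing it, so a ridge cannot lie in only one facet.
\<close>

lemma ridge_second_facet:
  assumes "\<sigma> \<in> facets" "\<rho> \<subseteq> \<sigma>" "card \<rho> = d - 1"
  obtains \<tau> where "\<tau> \<in> facets" "\<rho> \<subseteq> \<tau>" "\<tau> \<noteq> \<sigma>"
proof -
  have face: "convex hull \<rho> face_of P" using face_of_facet[OF assms(1,2)] .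
  have ne: "convex hull \<rho> \<noteq> {}" using assms(3) d by auto
  have small: "convex hull \<rho> \<noteq> convex hull \<sigma>"
  proof
    assume eq: "convex hull \<rho> = convex hull \<sigma>"
    have "\<not> affine_dependent \<rho>" using facetsD(3)[OF assms(1)] assms(2) affine_dependent_subset by blast
    then have "aff_dim \<rho> = aff_dim \<sigma> - 1"
      using assms d facetsD(3,4)[OF assms(1)] by (simp add: affine_independent_iff_card)
    then show False using eq by (metis aff_dim_convex_hull diff_numeral_special(11) diff_add_cancel
          add_cancel_right_right less_irrefl zle_diff1_eq order_refl)
  qed
  have "convex hull \<rho> \<noteq> P"
    using small facetsD(2)[OF assms(1)] assms(2) hull_mono[OF assms(2), of convex] facet_of_imp_subset
    by (metis subset_antisym)
  then have eq: "convex hull \<rho> = \<Inter>{F. F facet_of P \<and> convex hull \<rho> \<subseteq> F}"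
    using face_of_polyhedron[OF polyhedron face ne] by blast
  have "\<exists>F. F facet_of P \<and> convex hull \<rho> \<subseteq> F \<and> F \<noteq> convex hull \<sigma>"
  proof (rule ccontr)
    assume no: "\<not> ?thesis"
    have "convex hull \<sigma> facet_of P" "convex hull \<rho> \<subseteq> convex hull \<sigma>"
      using facetsD(2)[OF assms(1)] hull_mono[OF assms(2)] by auto
    then have "{F. F facet_of P \<and> convex hull \<rho> \<subseteq> F} = {convex hull \<sigma>}"
      using no by blast
    then show False using eq small by simp
  qed
  then obtain F where F: "F facet_of P" "convex hull \<rho> \<subseteq> F" "F \<noteq> convex hull \<sigma>" by blast
  obtain \<tau> where \<tau>: "\<tau> \<in> facets" "F = convex hull \<tau>" "polytope_vertices P \<inter> F = \<tau>"
    using facet_vertices[OF F(1)] by metis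
  have "\<rho> \<subseteq> \<tau>" using \<tau>(3) F(2) hull_subset[of \<rho> convex] assms(2) facetsD(1)[OF assms(1)] by blast
  then show thesis using that[of \<tau>] \<tau> F by auto
qed

text \<open>
  Three facets over the same ridge \<open>\<rho>\<close> have together \<open>d + 2\<close> vertices, which satisfy an affine relation
  \<open>u\<close>. Evaluating the height above one of the facets on this relation involves only the apexes of the
  other two, where the height is positive; so their coefficients have opposite signs or vanish. For
  three coefficients this is possible only if all vanish, and then the relation lives on \<open>\<rho>\<close>, which
  is affinely independent.
\<close>

lemma ridge_at_most_two_facets:
  assumes f: "\<sigma>1 \<in> facets" "\<sigma>2 \<in> facets" "\<sigma>3 \<in> facets"
    and \<rho>: "card \<rho> = d - 1" "\<rho> \<subseteq> \<sigma>1" "\<rho> \<subseteq> \<sigma>2" "\<rho> \<subseteq> \<sigma>3"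
    and ne: "\<sigma>1 \<noteq> \<sigma>2" "\<sigma>2 \<noteq> \<sigma>3" "\<sigma>1 \<noteq> \<sigma>3"
  shows False
proof -
  have fin\<rho>: "finite \<rho>" using facets_finite[OF f(1)] \<rho>(2) finite_subset by blast
  have apex: "\<exists>x. x \<notin> \<rho> \<and> \<sigma> = insert x \<rho>" if "\<sigma> \<in> facets" "\<rho> \<subseteq> \<sigma>" for \<sigma>
  proof -
    have "card (\<sigma> - \<rho>) = 1"
      using facetsD(4)[OF that(1)] \<rho>(1) d fin\<rho> that(2) by (simp add: card_Diff_subset)
    then obtain x where "\<sigma> - \<rho> = {x}" by (auto simp: card_1_singleton_iff)
    then show ?thesis using that(2) by blast
  qed
  obtain x1 where x1: "x1 \<notin> \<rho>" "\<sigma>1 = insert x1 \<rho>" using apex[OF f(1) \<rho>(2)] by blast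
  obtain x2 where x2: "x2 \<notin> \<rho>" "\<sigma>2 = insert x2 \<rho>" using apex[OF f(2) \<rho>(3)] by blast
  obtain x3 where x3: "x3 \<notin> \<rho>" "\<sigma>3 = insert x3 \<rho>" using apex[OF f(3) \<rho>(4)] by blast
  have x: "x1 \<noteq> x2" "x2 \<noteq> x3" "x1 \<noteq> x3" using ne x1 x2 x3 by auto
  define S where "S = insert x1 (insert x2 (insert x3 \<rho>))"
  have S: "finite S" "card S = d + 2" "S \<subseteq> P"
    using fin\<rho> x x1 x2 x3 \<rho>(1) d f[THEN facetsD(1)] vertices_subset by (auto simp: S_def)
  have SV: "S \<subseteq> polytope_vertices P" using x1 x2 x3 f[THEN facetsD(1)] by (auto simp: S_def)
  have "affine_dependent S"
  proof (rule ccontr)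
    assume "\<not> affine_dependent S"
    then have "aff_dim S = int (card S) - 1" by (simp add: affine_independent_iff_card)
    then show False using aff_dim_subset[OF S(3)] dim S(2) by simp
  qed
  then obtain u where u: "sum u S = 0" "\<exists>v\<in>S. u v \<noteq> 0" "(\<Sum>v\<in>S. u v *\<^sub>R v) = 0"
    using affine_dependent_explicit_finite[OF S(1)] by blast
  have key: "\<exists>h. (\<forall>v\<in>\<sigma>. h v = 0) \<and> (\<forall>v\<in>S - \<sigma>. 0 < h v) \<and> (\<Sum>v\<in>S. u v * h v) = (0::real)"
    if \<sigma>: "\<sigma> \<in> facets" for \<sigma>
  proof -
    obtain a b where ab: "\<And>x. x \<in> P \<Longrightarrow> a \<bullet> x \<le> b" "\<And>x. x \<in> P \<Longrightarrow> a \<bullet> x = b \<longleftrightarrow> x \<in> convex hull \<sigma>"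
      using facet_height[OF \<sigma>] by blast
    define h where "h v = b - a \<bullet> v" for v
    have "h v = 0" if "v \<in> \<sigma>" for v
      using ab(2)[of v] that facetsD(1)[OF \<sigma>] vertices_subset hull_inc[of v \<sigma>] by (auto simp: h_def)
    moreover have "0 < h v" if "v \<in> S - \<sigma>" for v
      using ab[of v] that SV S(3) facetsD(5)[OF \<sigma>] by (force simp: h_def)
    moreover have "(\<Sum>v\<in>S. u v * h v) = 0"
    proof -
      have "(\<Sum>v\<in>S. u v * h v) = b * sum u S - a \<bullet> (\<Sum>v\<in>S. u v *\<^sub>R v)"
        by (simp add: h_def algebra_simps sum_subtractf sum_distrib_left inner_sum_right)
      then show ?thesis using u by simp
    qed
    ultimately show ?thesis by blast
  qed
  have sumS: "(\<Sum>v\<in>S. g v) = g x1 + g x2 + g x3 + (\<Sum>v\<in>\<rho>. g v)" for g :: "'a \<Rightarrow> real"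
    using fin\<rho> x x1 x2 x3 by (simp add: S_def)
  \<comment> \<open>two coefficients that cancel against positive heights\<close>
  have opp: "sgn p = - sgn q" if "p * r + q * s = 0" "0 < r" "0 < s" for p q r s :: real
  proof -
    have "p * r = - (q * s)" using that(1) by linarith
    then have "sgn (p * r) = sgn (- (q * s))" by (rule arg_cong)
    then show ?thesis using that(2,3) by (simp add: sgn_mult sgn_minus)
  qed
  obtain h1 where h1: "\<forall>v\<in>\<sigma>1. h1 v = 0" "\<forall>v\<in>S - \<sigma>1. 0 < h1 v" "(\<Sum>v\<in>S. u v * h1 v) = 0"
    using key[OF f(1)] by blast
  obtain h2 where h2: "\<forall>v\<in>\<sigma>2. h2 v = 0" "\<forall>v\<in>S - \<sigma>2. 0 < h2 v" "(\<Sum>v\<in>S. u v * h2 v) = 0"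
    using key[OF f(2)] by blast
  obtain h3 where h3: "\<forall>v\<in>\<sigma>3. h3 v = 0" "\<forall>v\<in>S - \<sigma>3. 0 < h3 v" "(\<Sum>v\<in>S. u v * h3 v) = 0"
    using key[OF f(3)] by blast
  have "sgn (u x2) = - sgn (u x3)"
  proof (rule opp)
    have "h1 x1 = 0" "\<forall>v\<in>\<rho>. h1 v = 0" using h1(1) x1 by auto
    then show "u x2 * h1 x2 + u x3 * h1 x3 = 0" using h1(3) by (simp add: sumS)
    show "0 < h1 x2" "0 < h1 x3" using h1(2) x x1 x2 x3 by (auto simp: S_def)
  qed
  moreover have "sgn (u x1) = - sgn (u x3)"
  proof (rule opp)
    have "h2 x2 = 0" "\<forall>v\<in>\<rho>. h2 v = 0" using h2(1) x2 by auto
    then show "u x1 * h2 x1 + u x3 * h2 x3 = 0" using h2(3) by (simp add: sumS)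
    show "0 < h2 x1" "0 < h2 x3" using h2(2) x x1 x2 x3 by (auto simp: S_def)
  qed
  moreover have "sgn (u x1) = - sgn (u x2)"
  proof (rule opp)
    have "h3 x3 = 0" "\<forall>v\<in>\<rho>. h3 v = 0" using h3(1) x3 by auto
    then show "u x1 * h3 x1 + u x2 * h3 x2 = 0" using h3(3) by (simp add: sumS)
    show "0 < h3 x1" "0 < h3 x2" using h3(2) x x1 x2 x3 by (auto simp: S_def)
  qed
  ultimately have "sgn (u x1) = 0" "sgn (u x2) = 0" "sgn (u x3) = 0" by linarith+
  then have u0: "u x1 = 0" "u x2 = 0" "u x3 = 0" by (simp_all add: sgn_eq_0_iff)
  have "sum u \<rho> = 0" using u(1) sumS[of u] u0 by simp
  moreover have "(\<Sum>v\<in>\<rho>. u v *\<^sub>R v) = 0"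
    using u(3) fin\<rho> x x1 x2 x3 u0 by (simp add: S_def)
  moreover have "\<exists>v\<in>\<rho>. u v \<noteq> 0" using u(2) u0 by (auto simp: S_def)
  ultimately have "affine_dependent \<rho>" using affine_dependent_explicit_finite[OF fin\<rho>] by blast
  then show False using facetsD(3)[OF f(1)] \<rho>(2) affine_dependent_subset by blast
qed

lemma facet_intersection:
  assumes "\<sigma> \<in> facets" "\<tau> \<in> facets"
  shows "convex hull \<sigma> \<inter> convex hull \<tau> = convex hull (\<sigma> \<inter> \<tau>)"
proof
  have "(convex hull \<sigma> \<inter> convex hull \<tau>) face_of P"
    using assms[THEN facetsD(2), THEN facet_of_imp_face_of] by (rule face_of_Int)
  moreover have "convex hull \<sigma> \<subseteq> P" using facet_of_imp_subset[OF facetsD(2)[OF assms(1)]] .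
  ultimately have "(convex hull \<sigma> \<inter> convex hull \<tau>) face_of (convex hull \<sigma>)"
    by (rule face_of_subset[OF _ Int_lower1])
  then obtain C where C: "C \<subseteq> \<sigma>" "convex hull \<sigma> \<inter> convex hull \<tau> = convex hull C"
    using face_of_convex_hull_affine_independent[OF facetsD(3)[OF assms(1)]] by blast
  have "C \<subseteq> polytope_vertices P \<inter> convex hull \<tau>"
    using C hull_subset[of C convex] facetsD(1)[OF assms(1)] by blast
  then have "C \<subseteq> \<sigma> \<inter> \<tau>" using C(1) facetsD(5)[OF assms(2)] by blast
  then show "convex hull \<sigma> \<inter> convex hull \<tau> \<subseteq> convex hull (\<sigma> \<inter> \<tau>)"
    using C(2) hull_mono by metis
qed (simp add: hull_mono)

text \<open>
  These cones with apex an interior point \<open>z\<close> replace the radial projection to the boundary.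
\<close>

definition facet_cone :: "'a \<Rightarrow> 'a set \<Rightarrow> 'a set" where
  "facet_cone z \<sigma> = {z + s *\<^sub>R (x - z) | s x. 0 \<le> s \<and> x \<in> convex hull \<sigma>}"

lemma closed_facet_cone:
  assumes "\<sigma> \<in> facets" shows "closed (facet_cone z \<sigma>)"
proof -
  have "polytope ((\<lambda>x. - z + x) ` (convex hull \<sigma>))"
    using polytope_translation_eq polytope_convex_hull[OF facets_finite[OF assms]] by metis
  then have "closed (conic hull ((\<lambda>x. - z + x) ` (convex hull \<sigma>)))"
    using closed_conic_hull_strong by blast
  then have "closed ((\<lambda>x. z + x) ` (conic hull ((\<lambda>x. - z + x) ` (convex hull \<sigma>))))"
    by (rule closed_translation)
  also have "(\<lambda>x. z + x) ` (conic hull ((\<lambda>x. - z + x) ` (convex hull \<sigma>))) = facet_cone z \<sigma>"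
    unfolding conic_hull_explicit facet_cone_def by (force simp: algebra_simps)
  finally show ?thesis .
qed

lemma facet_cones_cover:
  assumes z: "z \<in> rel_interior P" and y: "y \<in> affine hull P" "y \<noteq> z"
  obtains \<sigma> where "\<sigma> \<in> facets" "y \<in> facet_cone z \<sigma>"
proof -
  have "bounded P" using polytope_imp_bounded[OF polytope] .
  then obtain t where t: "0 < t" "z + t *\<^sub>R (y - z) \<in> rel_frontier P"
    using ray_to_rel_frontier[OF _ z, of "y - z"] y by auto
  then obtain F where F: "F facet_of P" "z + t *\<^sub>R (y - z) \<in> F"
    using rel_frontier_of_polyhedron[OF polyhedron] by blast
  obtain \<sigma> where \<sigma>: "\<sigma> \<in> facets" "F = convex hull \<sigma>" using facet_vertices[OF F(1)] by metis
  have "y = z + (1 / t) *\<^sub>R ((z + t *\<^sub>R (y - z)) - z)" using t by simp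
  then have "y \<in> facet_cone z \<sigma>"
    unfolding facet_cone_def using t(1) F(2) \<sigma>(2)
    by (intro CollectI exI[of _ "1 / t"] exI[of _ "z + t *\<^sub>R (y - z)"]) auto
  then show thesis using that \<sigma> by blast
qed

lemma interior_not_in_affine_hull_facet:
  assumes "z \<in> rel_interior P" "\<sigma> \<in> facets"
  shows "z \<notin> affine hull (convex hull \<sigma>)"
  using affine_hull_face_of_disjoint_rel_interior[OF convex facet_of_imp_face_of[OF facetsD(2)[OF assms(2)]]]
    facetsD(2)[OF assms(2)] assms(1) facet_of_irrefl by fastforce

text \<open>
  A ray from an interior point leaves the polytope at a single point; the supporting hyperplane of the
  facet measures how far along the ray this happens.
\<close>

lemma facet_cone_scale_le:
  assumes z: "z \<in> rel_interior P" and \<sigma>: "\<sigma> \<in> facets" and x: "x \<in> convex hull \<sigma>" "x' \<in> P"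
    and s: "0 \<le> s'" and eq: "s *\<^sub>R (x - z) = s' *\<^sub>R (x' - z)"
  shows "s \<le> s'"
proof -
  obtain a b where ab: "\<And>x. x \<in> P \<Longrightarrow> a \<bullet> x \<le> b" "\<And>x. x \<in> P \<Longrightarrow> a \<bullet> x = b \<longleftrightarrow> x \<in> convex hull \<sigma>"
    using facet_height[OF \<sigma>] by blast
  have "convex hull \<sigma> \<subseteq> P" using facet_of_imp_subset[OF facetsD(2)[OF \<sigma>]] .
  then have ax: "a \<bullet> x = b" using ab(2) x(1) by blast
  have "z \<in> P" using z rel_interior_subset by blast
  moreover have "z \<notin> convex hull \<sigma>"
    using interior_not_in_affine_hull_facet[OF z \<sigma>] hull_inc[of z "convex hull \<sigma>" affine] by blast
  ultimately have az: "a \<bullet> z < b" using ab[of z] by fastforce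
  have "s * (b - a \<bullet> z) = s' * (a \<bullet> x' - a \<bullet> z)"
    using arg_cong[OF eq, of "\<lambda>y. a \<bullet> y"] ax by (simp add: inner_diff_right)
  also have "\<dots> \<le> s' * (b - a \<bullet> z)" using ab(1)[OF x(2)] s by (intro mult_left_mono) auto
  finally show ?thesis using az by simp
qed

lemma facet_cones_meet:
  assumes z: "z \<in> rel_interior P" and f: "\<sigma> \<in> facets" "\<tau> \<in> facets"
    and y: "y \<in> facet_cone z \<sigma>" "y \<in> facet_cone z \<tau>" "y \<noteq> z"
  shows "y \<in> affine hull (insert z (\<sigma> \<inter> \<tau>))"
proof -
  obtain s x where s: "y = z + s *\<^sub>R (x - z)" "0 \<le> s" "x \<in> convex hull \<sigma>"
    using y(1) by (auto simp: facet_cone_def)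
  obtain s' x' where s': "y = z + s' *\<^sub>R (x' - z)" "0 \<le> s'" "x' \<in> convex hull \<tau>"
    using y(2) by (auto simp: facet_cone_def)
  have P: "x \<in> P" "x' \<in> P" using s(3) s'(3) f[THEN facetsD(2), THEN facet_of_imp_subset] by auto
  have eq: "s *\<^sub>R (x - z) = s' *\<^sub>R (x' - z)" using s(1) s'(1) by simp
  have "s = s'"
    using facet_cone_scale_le[OF z f(1) s(3) P(2) s'(2) eq]
      facet_cone_scale_le[OF z f(2) s'(3) P(1) s(2) eq[symmetric]] by simp
  moreover have "s \<noteq> 0" using s(1) y(3) by auto
  ultimately have "x = x'" using eq by simp
  then have "x \<in> convex hull (\<sigma> \<inter> \<tau>)" using facet_intersection[OF f] s(3) s'(3) by blast
  then have "x \<in> affine hull (insert z (\<sigma> \<inter> \<tau>))"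
    using convex_hull_subset_affine_hull hull_mono[of "\<sigma> \<inter> \<tau>" "insert z (\<sigma> \<inter> \<tau>)" affine] by blast
  moreover have "z \<in> affine hull (insert z (\<sigma> \<inter> \<tau>))" by (simp add: hull_inc)
  ultimately have "(1 - s) *\<^sub>R z + s *\<^sub>R x \<in> affine hull (insert z (\<sigma> \<inter> \<tau>))"
    using affine_affine_hull unfolding affine_alt by blast
  moreover have "y = (1 - s) *\<^sub>R z + s *\<^sub>R x" using s(1) by (simp add: algebra_simps)
  ultimately show ?thesis by simp
qed

text \<open>
  The affine hull of \<open>z\<close>, \<open>w\<close> and at most \<open>d - 2\<close> vertices has dimension at most \<open>d - 1\<close> and contains an
  interior point, so it cannot contain a facet. The point \<open>w\<close> is the other end of a segment that is to
  avoid the faces of small dimension as seen from \<open>z\<close>.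
\<close>

lemma generic_point_in_facet:
  assumes z: "z \<in> rel_interior P" and \<sigma>: "\<sigma> \<in> facets"
  obtains b where "b \<in> convex hull \<sigma>"
    "\<And>\<tau>. \<tau> \<subseteq> polytope_vertices P \<Longrightarrow> card \<tau> \<le> d - 2 \<Longrightarrow> b \<notin> affine hull (insert z (insert w \<tau>))"
proof -
  define T where "T = {\<tau>. \<tau> \<subseteq> polytope_vertices P \<and> card \<tau> \<le> d - 2}"
  have "finite T" using finite_vertices by (simp add: T_def)
  have not_in: "\<not> convex hull \<sigma> \<subseteq> affine hull (insert z (insert w \<tau>))" if "\<tau> \<in> T" for \<tau>
  proof
    assume sub: "convex hull \<sigma> \<subseteq> affine hull (insert z (insert w \<tau>))"
    have fin: "finite (insert z (insert w \<tau>))"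
      using that finite_vertices finite_subset by (auto simp: T_def)
    have "card (insert z (insert w \<tau>)) \<le> d"
      using that d card_insert_le_m1[of d] fin
      by (auto simp: T_def card_insert_if)
    then have "aff_dim (affine hull (insert z (insert w \<tau>))) \<le> int d - 1"
      using aff_dim_le_card[OF fin] by simp
    moreover have "aff_dim (convex hull \<sigma>) = int d - 1"
      using facetsD(2)[OF \<sigma>] dim by (simp add: facet_of_def)
    ultimately have "aff_dim (convex hull \<sigma>) = aff_dim (affine hull (insert z (insert w \<tau>)))"
      using aff_dim_subset[OF sub] by simp
    then have "affine hull (convex hull \<sigma>) = affine hull (insert z (insert w \<tau>))"
      using aff_dim_eq_full_gen[OF sub] by simp
    then show False
      using interior_not_in_affine_hull_facet[OF z \<sigma>] hull_inc[of z "insert z (insert w \<tau>)" affine] by auto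
  qed
  have ne: "convex hull \<sigma> \<noteq> {}" using facetsD(4)[OF \<sigma>] d by auto
  have "\<exists>x\<in>convex hull \<sigma>. \<forall>A\<in>(\<lambda>\<tau>. affine hull (insert z (insert w \<tau>))) ` T. x \<notin> A"
    using \<open>finite T\<close> ne not_in by (intro finite_affine_cover) auto
  then show thesis using that by (auto simp: T_def)
qed

text \<open>
  Join a generic point of a facet in \<open>S\<close> to a generic point of a facet outside \<open>S\<close>. The cones over the
  facets in \<open>S\<close> and over the others are two closed sets covering this connected segment, so they meet
  on it. The two facets whose cones meet there share a ridge, since the segment misses the cones over
  smaller faces.
\<close>

lemma facets_strongly_connected:
  assumes S: "S \<subseteq> facets" "S \<noteq> {}"
    and closed: "\<And>\<sigma> \<tau>. \<sigma> \<in> S \<Longrightarrow> \<tau> \<in> facets \<Longrightarrow> card (\<sigma> \<inter> \<tau>) = d - 1 \<Longrightarrow> \<tau> \<in> S"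
  shows "S = facets"
proof (rule ccontr)
  assume "S \<noteq> facets"
  then obtain \<sigma>b where \<sigma>b: "\<sigma>b \<in> facets" "\<sigma>b \<notin> S" using S by blast
  obtain \<sigma>a where \<sigma>a: "\<sigma>a \<in> S" "\<sigma>a \<in> facets" using S by blast
  have "P \<noteq> {}" using dim d by auto
  then obtain z where z: "z \<in> rel_interior P" using rel_interior_eq_empty[OF convex] by auto
  obtain a where a: "a \<in> convex hull \<sigma>a"
    "\<And>\<tau>. \<tau> \<subseteq> polytope_vertices P \<Longrightarrow> card \<tau> \<le> d - 2 \<Longrightarrow> a \<notin> affine hull (insert z (insert z \<tau>))"
    using generic_point_in_facet[OF z \<sigma>a(2)] by blast
  obtain b where b: "b \<in> convex hull \<sigma>b"
    "\<And>\<tau>. \<tau> \<subseteq> polytope_vertices P \<Longrightarrow> card \<tau> \<le> d - 2 \<Longrightarrow> b \<notin> affine hull (insert z (insert a \<tau>))"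
    using generic_point_in_facet[OF z \<sigma>b(1)] by blast
  have generic: "y \<notin> affine hull (insert z \<tau>)"
    if y: "y \<in> closed_segment a b" and \<tau>: "\<tau> \<subseteq> polytope_vertices P" "card \<tau> \<le> d - 2" for y \<tau>
  proof
    assume in_hull: "y \<in> affine hull (insert z \<tau>)"
    obtain t where t: "y = (1 - t) *\<^sub>R a + t *\<^sub>R b" using y by (auto simp: in_segment)
    show False
    proof (cases "t = 0")
      case True
      then show False using a(2)[OF \<tau>] in_hull t by simp
    next
      case False
      have "insert z \<tau> \<subseteq> insert z (insert a \<tau>)" by auto
      then have "y \<in> affine hull (insert z (insert a \<tau>))" using in_hull hull_mono by blast
      moreover have "a \<in> affine hull (insert z (insert a \<tau>))" by (simp add: hull_inc)
      ultimately have "(1 - 1 / t) *\<^sub>R a + (1 / t) *\<^sub>R y \<in> affine hull (insert z (insert a \<tau>))"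
        using affine_affine_hull unfolding affine_alt by blast
      moreover have "(1 - 1 / t) *\<^sub>R a + (1 / t) *\<^sub>R y = b"
        using False by (simp add: t algebra_simps)
      ultimately show False using b(2)[OF \<tau>] by simp
    qed
  qed
  have yz: "y \<noteq> z" if "y \<in> closed_segment a b" for y
    using generic[OF that, of "{}"] by auto
  have aP: "a \<in> P" "b \<in> P"
    using a(1) b(1) facet_of_imp_subset[OF facetsD(2)] \<sigma>a \<sigma>b by blast+
  have seg: "closed_segment a b \<subseteq> affine hull P"
    using closed_segment_subset[OF aP convex] hull_subset[of P affine] by blast
  have fin: "finite facets"
    using finite_vertices by (rule finite_subset[of _ "Pow (polytope_vertices P)", rotated, OF finite_Pow_iff[THEN iffD2]])
      (auto simp: facets_def)
  define C where "C X = (\<Union>\<sigma>\<in>X. facet_cone z \<sigma>)" for X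
  have closed_C: "closed (C X)" if "X \<subseteq> facets" for X
    unfolding C_def using that fin finite_subset closed_facet_cone by (intro closed_UN) blast+
  have in_cone: "x \<in> facet_cone z \<sigma>" if "x \<in> convex hull \<sigma>" for x \<sigma>
    using that by (auto simp: facet_cone_def intro!: exI[of _ "1::real"] exI[of _ x])
  have "\<exists>y \<in> closed_segment a b. y \<in> C S \<and> y \<in> C (facets - S)"
  proof (rule ccontr)
    assume no: "\<not> ?thesis"
    have "closed_segment a b \<subseteq> C S \<union> C (facets - S)"
    proof
      fix y assume y: "y \<in> closed_segment a b"
      obtain \<sigma> where "\<sigma> \<in> facets" "y \<in> facet_cone z \<sigma>"
        using facet_cones_cover[OF z _ yz[OF y]] seg y by blast
      then show "y \<in> C S \<union> C (facets - S)" by (auto simp: C_def)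
    qed
    moreover have "C S \<inter> C (facets - S) \<inter> closed_segment a b = {}" using no by auto
    moreover have "a \<in> C S" "b \<in> C (facets - S)"
      using in_cone a(1) b(1) \<sigma>a \<sigma>b by (auto simp: C_def)
    ultimately show False
      using connected_segment(1)[of a b] closed_C[OF S(1)] closed_C[OF Diff_subset]
        ends_in_segment[of a b] unfolding connected_closed by blast
  qed
  then obtain y \<sigma> \<tau> where y: "y \<in> closed_segment a b" and \<sigma>: "\<sigma> \<in> S" "y \<in> facet_cone z \<sigma>"
    and \<tau>: "\<tau> \<in> facets" "\<tau> \<notin> S" "y \<in> facet_cone z \<tau>"
    by (auto simp: C_def)
  have \<sigma>f: "\<sigma> \<in> facets" using \<sigma> S by blast
  have "y \<in> affine hull (insert z (\<sigma> \<inter> \<tau>))"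
    using facet_cones_meet[OF z \<sigma>f \<tau>(1) \<sigma>(2) \<tau>(3) yz[OF y]] .
  moreover have "\<sigma> \<inter> \<tau> \<subseteq> polytope_vertices P" using facetsD(1)[OF \<sigma>f] by blast
  ultimately have "\<not> card (\<sigma> \<inter> \<tau>) \<le> d - 2" using generic[OF y] by blast
  moreover have "card (\<sigma> \<inter> \<tau>) < d"
  proof -
    have "\<sigma> \<inter> \<tau> \<subset> \<sigma>"
      using \<sigma> \<tau> facetsD(4)[OF \<sigma>f] facetsD(4)[OF \<tau>(1)] card_subset_eq[OF facets_finite[OF \<tau>(1)], of \<sigma>]
      by (cases "\<sigma> \<subseteq> \<tau>") auto
    then show ?thesis using psubset_card_mono[OF facets_finite[OF \<sigma>f]] facetsD(4)[OF \<sigma>f] by metis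
  qed
  ultimately have "card (\<sigma> \<inter> \<tau>) = d - 1" by simp
  then show False using closed[OF \<sigma>(1) \<tau>(1)] \<tau>(2) by blast
qed

end

sublocale simplicial_d_polytope \<subseteq> finite_ground "polytope_vertices P"
  by unfold_locales (rule finite_vertices)

context simplicial_d_polytope
begin

definition facet_chain :: "'a chain" where
  "facet_chain \<sigma> = (if \<sigma> \<in> facets then 1 else 0)"

lemma facet_chain_nonzero: "facet_chain \<sigma> \<noteq> 0 \<longleftrightarrow> \<sigma> \<in> facets"
  and facet_chain_eq_1 [simp]: "facet_chain \<sigma> = 1 \<longleftrightarrow> \<sigma> \<in> facets"
  by (simp_all add: facet_chain_def)

lemma cycle_facet_chain: "cycle d facet_chain"
  unfolding cycle_def
proof (intro conjI allI impI)
  show "\<sigma> \<subseteq> polytope_vertices P" "card \<sigma> = d" if "facet_chain \<sigma> \<noteq> 0" for \<sigma>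
    using that facetsD(1,4) by auto
  fix \<rho> assume \<rho>: "\<rho> \<subseteq> polytope_vertices P"
  define N where "N = {w \<in> polytope_vertices P - \<rho>. insert w \<rho> \<in> facets}"
  have fin: "finite N" "finite \<rho>" using finite_vertices \<rho> finite_subset by (auto simp: N_def)
  have bd: "boundary facet_chain \<rho> = of_nat (card N)"
  proof -
    have "boundary facet_chain \<rho> = (\<Sum>w\<in>polytope_vertices P - \<rho>. if insert w \<rho> \<in> facets then 1 else 0)"
      by (simp add: boundary_def facet_chain_def)
    also have "\<dots> = (\<Sum>w\<in>N. 1)"
      unfolding N_def using finite_vertices by (simp only: sum.inter_filter finite_Diff)
    finally show ?thesis by simp
  qed
  have card_N: "card N = 2" if "N \<noteq> {}"
  proof -
    obtain w1 where w1: "w1 \<in> polytope_vertices P - \<rho>" "insert w1 \<rho> \<in> facets"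
      using \<open>N \<noteq> {}\<close> by (auto simp: N_def)
    have card: "card \<rho> = d - 1" using facetsD(4)[OF w1(2)] w1(1) fin by simp
    have apex: "\<exists>w\<in>N. \<tau> = insert w \<rho>" if \<tau>: "\<tau> \<in> facets" "\<rho> \<subseteq> \<tau>" for \<tau>
    proof -
      have "card (\<tau> - \<rho>) = 1"
        using facetsD(4)[OF \<tau>(1)] card fin d \<tau>(2) by (simp add: card_Diff_subset)
      then obtain w where "\<tau> - \<rho> = {w}" by (auto simp: card_1_singleton_iff)
      then have "\<tau> = insert w \<rho>" "w \<in> \<tau> - \<rho>" using \<tau>(2) by auto
      then show ?thesis using \<tau>(1) facetsD(1)[OF \<tau>(1)] by (auto simp: N_def)
    qed
    obtain \<tau> where \<tau>: "\<tau> \<in> facets" "\<rho> \<subseteq> \<tau>" "\<tau> \<noteq> insert w1 \<rho>"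
      using ridge_second_facet[OF w1(2) _ card] by auto
    obtain w2 where w2: "w2 \<in> N" "\<tau> = insert w2 \<rho>" using apex[OF \<tau>(1,2)] by blast
    have "N \<subseteq> {w1, w2}"
    proof
      fix w assume w: "w \<in> N"
      show "w \<in> {w1, w2}"
      proof (rule ccontr)
        assume "w \<notin> {w1, w2}"
        then have "insert w \<rho> \<noteq> insert w1 \<rho>" "insert w \<rho> \<noteq> \<tau>"
          using w w1 w2 by (auto simp: N_def)
        then show False
          using ridge_at_most_two_facets[OF w1(2) \<tau>(1) _ card] w \<tau> by (auto simp: N_def)
      qed
    qed
    then have "N = {w1, w2}" using w1 w2 by (auto simp: N_def)
    moreover have "w1 \<noteq> w2" using \<tau>(3) w2(2) by auto
    ultimately show ?thesis by simp
  qed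
  show "boundary facet_chain \<rho> = 0"
  proof (cases "N = {}")
    case False
    then show ?thesis using bd card_N by simp
  qed (simp add: bd)
qed

text \<open>
  Across every ridge of a facet in a subcycle there is another facet of the subcycle, and this can only
  be the second facet of the polytope at that ridge. So a subcycle is closed under adjacency.
\<close>

lemma minimal_cycle_facet_chain: "minimal_cycle d facet_chain"
  unfolding minimal_cycle_def
proof (intro conjI allI impI)
  obtain F where "F facet_of P" using polytope_facet_exists[OF polytope] dim d by auto
  then obtain \<sigma> where "\<sigma> \<in> facets" using facet_vertices by metis
  then show "\<exists>\<sigma>. facet_chain \<sigma> \<noteq> 0" by auto
next
  fix c assume c: "cycle d c" "subchain c facet_chain" "\<exists>\<sigma>. c \<sigma> \<noteq> 0"
  define S where "S = {\<sigma>. c \<sigma> \<noteq> 0}"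
  have sub: "S \<subseteq> facets" using c(2) unfolding S_def subchain_def facet_chain_nonzero by blast
  have "S = facets"
  proof (rule facets_strongly_connected[OF sub])
    show "S \<noteq> {}" using c(3) by (simp add: S_def)
    fix \<sigma> \<tau> assume a: "\<sigma> \<in> S" "\<tau> \<in> facets" "card (\<sigma> \<inter> \<tau>) = d - 1"
    have \<sigma>: "\<sigma> \<in> facets" "c \<sigma> \<noteq> 0" using a(1) sub by (auto simp: S_def)
    have fin: "finite \<sigma>" using facets_finite[OF \<sigma>(1)] .
    have "card (\<sigma> - \<sigma> \<inter> \<tau>) = 1"
      using facetsD(4)[OF \<sigma>(1)] a(3) fin d by (simp add: card_Diff_subset)
    then obtain w where w: "\<sigma> - \<sigma> \<inter> \<tau> = {w}" by (auto simp: card_1_singleton_iff)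
    then have w': "w \<in> \<sigma>" "\<sigma> - {w} = \<sigma> \<inter> \<tau>" "w \<notin> \<tau>" by auto
    obtain x where x: "x \<in> polytope_vertices P - \<sigma>" "c (insert x (\<sigma> - {w})) \<noteq> 0"
      using cycle_adjacent_facet[OF c(1) \<sigma>(2) w'(1)] by blast
    define \<upsilon> where "\<upsilon> = insert x (\<sigma> \<inter> \<tau>)"
    have \<upsilon>: "\<upsilon> \<in> S" "\<upsilon> \<noteq> \<sigma>" using x w'(2) by (auto simp: S_def \<upsilon>_def)
    have "\<upsilon> = \<tau>"
    proof (rule ccontr)
      assume "\<upsilon> \<noteq> \<tau>"
      moreover have "\<tau> \<noteq> \<sigma>" using w' by auto
      moreover have "\<upsilon> \<in> facets" using \<upsilon> sub by blast
      ultimately show False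
        using ridge_at_most_two_facets[OF \<sigma>(1) a(2) _ a(3)] \<upsilon>(2) by (auto simp: \<upsilon>_def)
    qed
    then show "\<tau> \<in> S" using \<upsilon> by simp
  qed
  then have "c \<sigma> \<noteq> 0 \<longleftrightarrow> facet_chain \<sigma> \<noteq> 0" for \<sigma>
    unfolding facet_chain_nonzero by (auto simp: S_def)
  then show "c = facet_chain" using bit_eq_iff_nonzero by blast
qed (rule cycle_facet_chain)

lemma facet_chain_vertices: "chain_vertices facet_chain = polytope_vertices P"
proof
  show "chain_vertices facet_chain \<subseteq> polytope_vertices P"
    using chain_vertices_subset[OF cycle_facet_chain] .
  show "polytope_vertices P \<subseteq> chain_vertices facet_chain"
    unfolding chain_vertices_def facet_chain_nonzero using vertex_in_facet by blast
qed

lemma adjacent_facet_chain: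
  "adjacent facet_chain a b \<Longrightarrow> a \<in> polytope_vertices P \<and> b \<in> polytope_vertices P
    \<and> (a = b \<or> {a, b} \<in> polytope_edges P)"
  unfolding adjacent_def facet_chain_nonzero using facet_edge facetsD(1) by blast

section \<open>Edge cuts\<close>

text \<open>
  Rigidity excludes the motion that moves \<open>X\<close> by an infinitesimal isometry \<open>A\<close> and keeps \<open>Y\<close> at rest;
  such an \<open>A\<close> compatible with the cut edges exists whenever they are fewer than \<open>d (d + 1) / 2\<close>.
\<close>

lemma large_cut:
  assumes "3 \<le> d" and X: "X \<subseteq> polytope_vertices P" "d \<le> card X"
    and Y: "Y = polytope_vertices P - X" "d \<le> card Y"
    and C: "finite C" "\<And>x y. x \<in> X \<Longrightarrow> y \<in> Y \<Longrightarrow> {x, y} \<in> polytope_edges P \<Longrightarrow> {x, y} \<in> C"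
  shows "d * (d + 1) div 2 \<le> card C"
proof (rule ccontr)
  assume "\<not> ?thesis"
  then have small: "card C < d * (d + 1) div 2" by simp
  have fin: "finite X" "finite Y" using X Y finite_vertices finite_subset by auto
  have U: "d < card (polytope_vertices P)"
  proof -
    have "card (polytope_vertices P) = card X + card Y"
      using X Y fin finite_vertices by (simp add: card_Diff_subset card_mono)
    then show ?thesis using X(2) Y(2) assms(1) by simp
  qed
  obtain p where p: "general_position d p" "rigid d facet_chain p"
    using minimal_cycle_generically_rigid[OF minimal_cycle_facet_chain assms(1)]
    by (auto simp: generically_rigid_def)
  \<comment> \<open>The pairs are oriented from \<open>X\<close> to \<open>Y\<close>, so that every cut edge gives one equation.\<close>
  define K where "K = {(x, y). x \<in> X \<and> y \<in> Y \<and> {x, y} \<in> polytope_edges P}"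
  have XY: "X \<inter> Y = {}" using Y by blast
  have "inj_on (\<lambda>(x, y). {x, y}) K"
    using XY by (auto simp: inj_on_def K_def doubleton_eq_iff)
  moreover have "(\<lambda>(x, y). {x, y}) ` K \<subseteq> C" using C(2) by (auto simp: K_def)
  ultimately have "card K \<le> card C" using C(1) card_inj_on_le by blast
  moreover have "finite K" using fin by (intro finite_subset[of K "X \<times> Y"]) (auto simp: K_def)
  ultimately obtain A where A: "skew d A" "\<exists>i j. A i j \<noteq> 0"
    "\<And>x y. (x, y) \<in> K \<Longrightarrow> dot d (mat_app d A (p x)) (p y) = 0"
    using skew_vanishing_on_few_pairs[of K d "\<lambda>(x, y). p x" "\<lambda>(x, y). p y"] small by force
  define m where "m v = (if v \<in> X then mat_app d A (p v) else (\<lambda>_. 0))" for v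
  have cut: "dot d (m a) (p b) + dot d (m b) (p a) = 0"
    if "a \<in> X" "b \<in> Y" "{a, b} \<in> polytope_edges P" for a b
    using that A(3)[of a b] XY by (auto simp: K_def m_def dot_zero)
  have "motion d facet_chain p m"
    unfolding motion_def
  proof (intro allI impI)
    fix a b assume "adjacent facet_chain a b"
    then have ab: "a \<in> X \<union> Y" "b \<in> X \<union> Y" "a = b \<or> {a, b} \<in> polytope_edges P"
      using adjacent_facet_chain Y X by auto
    consider "a \<in> X" "b \<in> X" | "a \<in> Y" "b \<in> Y" | "a \<in> X" "b \<in> Y" "a \<noteq> b" | "a \<in> Y" "b \<in> X" "a \<noteq> b"
      using ab XY by blast
    then show "dot d (m a) (p b) + dot d (m b) (p a) = 0"
    proof cases
      case 1
      then show ?thesis using skew_dot[OF A(1), of "p a" "p b"] by (simp add: m_def)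
    next
      case 2
      then have "a \<notin> X" "b \<notin> X" using XY by auto
      then show ?thesis by (simp add: m_def dot_zero)
    next
      case 3
      then show ?thesis using cut[of a b] ab by simp
    next
      case 4
      then show ?thesis using cut[of b a] ab by (simp add: insert_commute add.commute)
    qed
  qed
  then obtain B where B: "skew d B" "trivial_on d B (polytope_vertices P) p m"
    using p(2) facet_chain_vertices by (auto simp: rigid_def)
  obtain Y' where Y': "Y' \<subseteq> Y" "card Y' = d" using obtain_subset_with_card_n[OF Y(2)] by metis
  obtain X' where X': "X' \<subseteq> X" "card X' = d" using obtain_subset_with_card_n[OF X(2)] by metis
  have "mat_app d B (p f) i = 0" if "f \<in> Y'" "i \<le> d" for f i
  proof -
    have "f \<notin> X" "f \<in> polytope_vertices P" using that(1) Y'(1) Y(1) by auto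
    then have "m f i = mat_app d B (p f) i" using B(2) that(2) unfolding trivial_on_def by blast
    then show ?thesis using \<open>f \<notin> X\<close> by (simp add: m_def)
  qed
  then have B0: "B i j = 0" for i j
    using skew_zero[OF p(1) B(1) _ Y'(2) U] Y' Y(1) by blast
  have "mat_app d A (p f) i = 0" if "f \<in> X'" "i \<le> d" for f i
  proof -
    have "f \<in> X" "f \<in> polytope_vertices P" using that(1) X'(1) X(1) by auto
    then have "m f i = 0" using B(2) that(2) B0 by (simp add: trivial_on_def mat_app_def)
    then show ?thesis using \<open>f \<in> X\<close> by (simp add: m_def)
  qed
  then have "A i j = 0" for i j
    using skew_zero[OF p(1) A(1) _ X'(2) U] X' X(1) by blast
  then show False using A(2) by blast
qed

lemma graph_degree_ge:
  assumes v: "v \<in> polytope_vertices P" and E: "finite (polytope_edges P)"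
  shows "d - 1 \<le> graph_degree (polytope_edges P) v"
proof -
  obtain \<sigma> where \<sigma>: "\<sigma> \<in> facets" "v \<in> \<sigma>" using vertex_in_facet[OF v] by blast
  have "inj_on (\<lambda>w. {v, w}) (\<sigma> - {v})" by (auto simp: inj_on_def doubleton_eq_iff)
  then have "d - 1 = card ((\<lambda>w. {v, w}) ` (\<sigma> - {v}))"
    using facetsD(4)[OF \<sigma>(1)] \<sigma>(2) facets_finite[OF \<sigma>(1)] by (simp add: card_image)
  also have "\<dots> \<le> graph_degree (polytope_edges P) v"
    unfolding graph_degree_def using facet_edge[OF \<sigma>(1) \<sigma>(2)] E by (intro card_mono) auto
  finally show ?thesis .
qed

end

lemma disconnected_cut:
  assumes "V \<noteq> {}" "\<not> graph_connected V E"
  obtains X where "X \<subseteq> V" "X \<noteq> {}" "V - X \<noteq> {}"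
    "\<And>x y. x \<in> X \<Longrightarrow> y \<in> V - X \<Longrightarrow> {x, y} \<notin> E"
proof -
  define R where "R = {(x, y). x \<in> V \<and> y \<in> V \<and> {x, y} \<in> E}"
  obtain u v where uv: "u \<in> V" "v \<in> V" "(u, v) \<notin> R\<^sup>*"
    using assms by (auto simp: graph_connected_def R_def)
  show thesis
  proof (rule that[of "{x \<in> V. (u, x) \<in> R\<^sup>*}"])
    fix x y assume xy: "x \<in> {x \<in> V. (u, x) \<in> R\<^sup>*}" "y \<in> V - {x \<in> V. (u, x) \<in> R\<^sup>*}"
    show "{x, y} \<notin> E"
    proof
      assume "{x, y} \<in> E"
      then have "(x, y) \<in> R" using xy by (auto simp: R_def)
      then show False using xy by (auto intro: rtrancl_into_rtrancl)
    qed
  qed (use uv in auto)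
qed

text \<open>
  A vertex of \<open>X\<close> has at most \<open>card X - 1\<close> neighbours in \<open>X\<close>, hence at least \<open>k + 1 - card X\<close> outside. The
  product \<open>card X * (k + 1 - card X)\<close> is at least \<open>k\<close> for \<open>1 \<le> card X \<le> k\<close>.
\<close>

lemma small_side_cut:
  fixes E :: "'v set set"
  assumes V: "finite V" and E: "\<And>e. e \<in> E \<Longrightarrow> e \<subseteq> V \<and> card e = 2"
    and deg: "\<And>v. v \<in> V \<Longrightarrow> k \<le> graph_degree E v"
    and X: "X \<subseteq> V" "X \<noteq> {}" "card X \<le> k"
    and C: "finite C" "\<And>x y. x \<in> X \<Longrightarrow> y \<in> V - X \<Longrightarrow> {x, y} \<in> E \<Longrightarrow> {x, y} \<in> C"
  shows "k \<le> card C"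
proof -
  have fin: "finite X" using X V finite_subset by blast
  define N where "N x = {y \<in> V - X. {x, y} \<in> E}" for x
  have N: "k + 1 \<le> card (N x) + card X" if x: "x \<in> X" for x
  proof -
    have "{e \<in> E. x \<in> e} \<subseteq> (\<lambda>y. {x, y}) ` ((X - {x}) \<union> N x)"
    proof
      fix e assume e: "e \<in> {e \<in> E. x \<in> e}"
      then have "card e = 2" "e \<subseteq> V" using E by auto
      then obtain y where y: "e = {x, y}" "x \<noteq> y" using e by (auto simp: card_2_iff)
      then have "y \<in> (X - {x}) \<union> N x" using e \<open>e \<subseteq> V\<close> by (auto simp: N_def)
      then show "e \<in> (\<lambda>y. {x, y}) ` ((X - {x}) \<union> N x)" using y by blast
    qed
    moreover have finN: "finite ((X - {x}) \<union> N x)" using fin V by (simp add: N_def)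
    ultimately have "graph_degree E x \<le> card ((X - {x}) \<union> N x)"
      unfolding graph_degree_def
      by (meson card_image_le card_mono finite_imageI le_trans)
    also have "\<dots> \<le> card (X - {x}) + card (N x)" by (rule card_Un_le)
    also have "card (X - {x}) = card X - 1" using x fin by simp
    finally have "k \<le> (card X - 1) + card (N x)" using deg[of x] x X(1) by auto
    moreover have "0 < card X" using X(2) fin by (simp add: card_gt_0_iff)
    ultimately show ?thesis by simp
  qed
  have "k \<le> card X * (k + 1 - card X)"
  proof -
    have c: "1 \<le> card X" using X(2) fin by (simp add: Suc_leI card_gt_0_iff)
    obtain a where a: "card X = Suc a" using c by (cases "card X") auto
    obtain b where b: "k = Suc a + b" using X(3) a le_Suc_ex by metis
    show ?thesis by (simp add: a b)
  qed
  also have "\<dots> = (\<Sum>x\<in>X. k + 1 - card X)" by simp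
  also have "\<dots> \<le> (\<Sum>x\<in>X. card (N x))"
  proof (rule sum_mono)
    fix x assume "x \<in> X"
    then show "k + 1 - card X \<le> card (N x)" using N[of x] by simp
  qed
  also have "\<dots> = card (SIGMA x:X. N x)" using fin V by (simp add: N_def)
  also have "\<dots> \<le> card C"
  proof (rule card_inj_on_le[of "\<lambda>(x, y). {x, y}"])
    show "inj_on (\<lambda>(x, y). {x, y}) (SIGMA x:X. N x)"
      by (auto simp: inj_on_def N_def doubleton_eq_iff)
    show "(\<lambda>(x, y). {x, y}) ` (SIGMA x:X. N x) \<subseteq> C" using C(2) by (auto simp: N_def)
  qed (rule C(1))
  finally show ?thesis .
qed

theorem corollary12:
  fixes P :: "'a::euclidean_space set" and d \<delta> :: nat
  assumes "d \<ge> 3"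
    and "simplicial_polytope P"
    and "aff_dim P = int d"
    and "\<delta> = min_degree (polytope_vertices P) (polytope_edges P)"
  shows "k_edge_connected (min \<delta> (d * (d + 1) div 2)) (polytope_vertices P) (polytope_edges P)"
proof -
  interpret simplicial_d_polytope P d
    using assms by unfold_locales auto
  define V where "V = polytope_vertices P"
  define E where "E = polytope_edges P"
  have V: "finite V" "V \<noteq> {}"
  proof -
    show "finite V" using finite_vertices by (simp add: V_def)
    obtain \<sigma> where "facet_chain \<sigma> \<noteq> 0" using minimal_cycle_facet_chain by (auto simp: minimal_cycle_def)
    then have "\<sigma> \<in> facets" by simp
    then show "V \<noteq> {}" using facetsD(1,4)[of \<sigma>] assms(1) by (auto simp: V_def)
  qed
  have E: "e \<subseteq> V \<and> card e = 2" if e: "e \<in> E" for e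
  proof -
    obtain u v where uv: "e = {u, v}" "u \<noteq> v" "closed_segment u v face_of P"
      using e by (auto simp: E_def polytope_edges_eq[OF polytope])
    have "u extreme_point_of P" "v extreme_point_of P"
      using extreme_point_of_face[OF uv(3)] by (auto simp: extreme_point_of_segment)
    then show ?thesis using uv by (simp add: V_def polytope_vertices_eq[OF polytope])
  qed
  have finE: "finite E" using E V(1) by (intro finite_subset[of E "Pow V"]) auto
  have deg: "\<delta> \<le> graph_degree E v" if "v \<in> V" for v
    using that V(1) assms(4) by (simp add: min_degree_def V_def E_def)
  have "\<delta> \<in> graph_degree E ` V"
    using V assms(4) unfolding min_degree_def V_def[symmetric] E_def[symmetric] by (simp add: Min_in)
  then have \<delta>: "d - 1 \<le> \<delta>"
    using graph_degree_ge finE by (auto simp: V_def E_def)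
  have cut: "min \<delta> (d * (d + 1) div 2) \<le> card C" if C: "C \<subseteq> E" "\<not> graph_connected V (E - C)" for C
  proof -
    have finC: "finite C" using C(1) finE finite_subset by blast
    obtain X where X: "X \<subseteq> V" "X \<noteq> {}" "V - X \<noteq> {}"
      "\<And>x y. x \<in> X \<Longrightarrow> y \<in> V - X \<Longrightarrow> {x, y} \<notin> E - C"
      using disconnected_cut[OF V(2) C(2)] by blast
    have XC: "{x, y} \<in> C" if "x \<in> X" "y \<in> V - X" "{x, y} \<in> E" for x y
      using X(4)[OF that(1,2)] that(3) by blast
    have YC: "{y, x} \<in> C" if "y \<in> V - X" "x \<in> V - (V - X)" "{y, x} \<in> E" for x y
      using XC[of x y] that by (auto simp: insert_commute)
    consider "card X \<le> \<delta>" | "card (V - X) \<le> \<delta>" | "d \<le> card X" "d \<le> card (V - X)"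
      using \<delta> assms(1) by linarith
    then show ?thesis
    proof cases
      case 1
      then show ?thesis
        using small_side_cut[OF V(1) E deg X(1,2) _ finC XC] by simp
    next
      case 2
      then show ?thesis
        using small_side_cut[OF V(1) E deg _ X(3) _ finC YC] by simp
    next
      case 3
      then show ?thesis
        using large_cut[OF assms(1), of X "V - X" C] X(1) finC XC unfolding V_def E_def by simp
    qed
  qed
  have "graph_connected V E"
  proof (rule ccontr)
    assume "\<not> graph_connected V E"
    then have "min \<delta> (d * (d + 1) div 2) \<le> 0" using cut[of "{}"] by simp
    moreover have "2 \<le> d * (d + 1)" using mult_le_mono[of 1 d 2 "d + 1"] assms(1) by simp
    ultimately show False using \<delta> assms(1) by (simp add: min_def split: if_splits)
  qed
  moreover have "enat (min \<delta> (d * (d + 1) div 2)) \<le> edge_connectivity V E"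
    unfolding edge_connectivity_def using cut by (auto intro!: Inf_greatest)
  ultimately show ?thesis
    by (simp add: k_edge_connected_def V_def E_def)
qed

end
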